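(* Let $\mathcal{N}$ be a von Neumann algebra with a faithful normal trace $tr$, normalized by $tr(1)=1$, let $\theta$ be a trace preserving weakly mixing automorphism of $\mathcal{N}$ defining an action $\alpha_n=\theta^n$ of $\mathbb{Z}$ on $\mathcal{N}$, let $u$ be the unitary in $\mathcal{M}=\mathcal{N}\rtimes_\alpha\mathbb{Z}$ which implements $\theta$, and let $\mathcal{B}$ be the abelian von Neumann algebra generated by $u$. Then $\mathcal{B}$ is a strongly singular masa in $\mathcal{M}=\mathcal{N}\rtimes_\alpha\mathbb{Z}$.
   Context: The crossed product $\mathcal{M}=\mathcal{N}\rtimes_\alpha\mathbb{Z}$ is represented on $L^2(\mathcal{N},tr)\otimes\ell^2(\mathbb{Z})$; there are a representation $\pi$ of $\mathcal{N}$ and a unitary $u$ on this space with $\pi(\theta^n(x))=u^n\pi(x)u^{-n}$ ($x\in\mathcal{N}$, $n\in\mathbb{Z}$), and $\mathcal{M}$ is generated by $\pi(\mathcal{N})$ and $u$. Elements of $\mathcal{M}$ are uniquely of the form $\sum_{n}\pi(x_n)u^n$, and $\mathcal{M}$ carries the faithful normal trace $tr(\sum_n\pi(x_n)u^n)=tr(x_0)$. The automorphism $\theta$ is weakly mixing if $$\lim_{n\to\infty}\frac1n\sum_{k=0}^{n-1}|tr(x\theta^k(y))-tr(x)tr(y)|=0\qquad\text{for all }x,y\in\mathcal{N}.$$ Put $\|x\|_2=(tr(x^*x))^{1/2}$, and for a linear map $\phi:\mathcal{M}\to\mathcal{M}$ put $\|\phi\|_{\infty,2}=\sup\{\|\phi(x)\|_2:\|x\|\le1\}$.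 For a von Neumann subalgebra $\mathcal{A}\subseteq\mathcal{M}$, $\mathbb{E}_{\mathcal{A}}$ is the unique trace preserving conditional expectation of $\mathcal{M}$ onto $\mathcal{A}$. $\mathcal{A}$ is strongly singular in $\mathcal{M}$ if $\|\mathbb{E}_{\mathcal{A}}-\mathbb{E}_{w\mathcal{A}w^*}\|_{\infty,2}\ge\|(I-\mathbb{E}_{\mathcal{A}})(w)\|_2$ for all unitaries $w\in\mathcal{M}$. A masa is a maximal abelian self-adjoint subalgebra. *)

theory Defs
  imports "HOL-Analysis.Analysis"
begin

section \<open>Complex Hilbert spaces\<close>

text \<open>The inner product \<open>cinner\<close> is conjugate-linear in its first argument.
  The real Hilbert space structure provides the norm, the topology and completeness.\<close>

class chilbert_space = real_inner + complete_space +
  fixes scaleC :: "complex \<Rightarrow> 'a \<Rightarrow> 'a" (infixr \<open>*\<^sub>C\<close> 75)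
    and cinner :: "'a \<Rightarrow> 'a \<Rightarrow> complex"
  assumes scaleC_add_right: "c *\<^sub>C (x + y) = c *\<^sub>C x + c *\<^sub>C y"
    and scaleC_add_left: "(c + d) *\<^sub>C x = c *\<^sub>C x + d *\<^sub>C x"
    and scaleC_scaleC: "c *\<^sub>C (d *\<^sub>C x) = (c * d) *\<^sub>C x"
    and scaleR_scaleC: "r *\<^sub>R x = complex_of_real r *\<^sub>C x"
    and cinner_commute: "cinner x y = cnj (cinner y x)"
    and cinner_add_right: "cinner x (y + z) = cinner x y + cinner x z"
    and cinner_scaleC_right: "cinner x (c *\<^sub>C y) = c * cinner x y"
    and inner_cinner: "inner x y = Re (cinner x y)"

lemma cinner_add_left: "cinner (x + y) z = cinner x z + cinner y z" for x :: "'a::chilbert_space"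
  by (metis cinner_commute cinner_add_right complex_cnj_add)

lemma cinner_scaleC_left: "cinner (c *\<^sub>C x) y = cnj c * cinner x y" for x :: "'a::chilbert_space"
  by (metis cinner_commute cinner_scaleC_right complex_cnj_mult)

lemma cinner_self: "cinner x x = complex_of_real ((norm x)\<^sup>2)" for x :: "'a::chilbert_space"
proof -
  have "Im (cinner x x) = 0"
    using arg_cong[OF cinner_commute[of x x], of Im] by simp
  moreover have "Re (cinner x x) = (norm x)\<^sup>2"
    by (metis inner_cinner power2_norm_eq_inner)
  ultimately show ?thesis by (simp add: complex_eq_iff)
qed

lemma norm_scaleC: "norm (c *\<^sub>C x) = cmod c * norm x" for x :: "'a::chilbert_space"
proof -
  have "complex_of_real ((norm (c *\<^sub>C x))\<^sup>2) = complex_of_real ((cmod c * norm x)\<^sup>2)"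
    unfolding cinner_self[symmetric] cinner_scaleC_left cinner_scaleC_right
    by (simp add: cinner_self complex_norm_square power_mult_distrib)
       (metis complex_mult_cnj complex_norm_square mult.assoc mult.commute of_real_power)
  then show ?thesis
    by (metis norm_ge_zero norm_mult norm_of_real of_real_eq_iff power2_eq_iff_nonneg zero_le_mult_iff)
qed

lemma scaleC_one [simp]: "1 *\<^sub>C x = x" for x :: "'a::chilbert_space"
  by (metis of_real_1 scaleR_one scaleR_scaleC)

lemma bounded_linear_scaleC: "bounded_linear (\<lambda>x. c *\<^sub>C x :: 'a::chilbert_space)"
proof (rule bounded_linear_intro)
  show "c *\<^sub>C (r *\<^sub>R x) = r *\<^sub>R (c *\<^sub>C x)" for r and x :: 'a
    by (simp add: scaleR_scaleC scaleC_scaleC mult.commute)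
  show "norm (c *\<^sub>C x) \<le> norm x * cmod c" for x :: 'a
    by (simp add: norm_scaleC mult.commute)
qed (rule scaleC_add_right)

lemma cmod_cinner_le: "cmod (cinner x y) \<le> norm x * norm y" for x :: "'a::chilbert_space"
proof (cases "cinner x y = 0")
  case False
  define c where "c = cnj (cinner x y) / cmod (cinner x y)"
  have c: "cmod c = 1" using False by (simp add: c_def norm_divide)
  have "c * cinner x y = complex_of_real (cmod (cinner x y))"
    using False complex_norm_square[of "cinner x y"]
    by (simp add: c_def power2_eq_square mult.commute field_simps)
  then have "cmod (cinner x y) = inner x (c *\<^sub>C y)"
    by (simp add: inner_cinner cinner_scaleC_right)
  also have "\<dots> \<le> norm x * norm (c *\<^sub>C y)" by (rule norm_cauchy_schwarz)
  finally show ?thesis using c by (simp add: norm_scaleC)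
qed simp


section \<open>The Hilbert space \<open>K \<otimes> \<ell>\<^sup>2(\<int>)\<close>, realised as \<open>\<ell>\<^sup>2(\<int>, K)\<close>\<close>

typedef (overloaded) 'k ell2Z = "{f :: int \<Rightarrow> 'k::real_inner. (\<lambda>n. (norm (f n))\<^sup>2) summable_on UNIV}"
  morphisms coord Abs_ell2Z
  by (rule exI[of _ "\<lambda>_. 0"]) simp

setup_lifting type_definition_ell2Z

lemma coord_summable: "(\<lambda>n. (norm (coord f n))\<^sup>2) summable_on UNIV"
  using coord[of f] by simp

lemma coord_inject_ext: "(\<And>n. coord f n = coord g n) \<Longrightarrow> f = g"
  using coord_inject by blast

lemma square_summable_add:
  fixes f g :: "int \<Rightarrow> 'k::real_inner"
  assumes "(\<lambda>n. (norm (f n))\<^sup>2) summable_on UNIV" "(\<lambda>n. (norm (g n))\<^sup>2) summable_on UNIV"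
  shows "(\<lambda>n. (norm (f n + g n))\<^sup>2) summable_on UNIV"
proof (rule summable_on_comparison_test)
  show "(\<lambda>n. 2 * (norm (f n))\<^sup>2 + 2 * (norm (g n))\<^sup>2) summable_on UNIV"
    by (intro summable_on_add summable_on_cmult_right assms)
  fix n :: int
  have "(norm (f n + g n))\<^sup>2 \<le> (norm (f n) + norm (g n))\<^sup>2"
    by (simp add: norm_triangle_ineq)
  also have "\<dots> \<le> 2 * (norm (f n))\<^sup>2 + 2 * (norm (g n))\<^sup>2"
    using sum_squares_bound[of "norm (f n)" "norm (g n)"] by (simp add: power2_sum)
  finally show "(norm (f n + g n))\<^sup>2 \<le> 2 * (norm (f n))\<^sup>2 + 2 * (norm (g n))\<^sup>2" .
qed simp

lemma square_summable_prod:
  fixes f g :: "int \<Rightarrow> 'k::real_inner"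
  assumes "(\<lambda>n. (norm (f n))\<^sup>2) summable_on UNIV" "(\<lambda>n. (norm (g n))\<^sup>2) summable_on UNIV"
  shows "(\<lambda>n. norm (f n) * norm (g n)) summable_on UNIV"
proof (rule summable_on_comparison_test)
  show "(\<lambda>n. (norm (f n))\<^sup>2 + (norm (g n))\<^sup>2) summable_on UNIV"
    by (intro summable_on_add assms)
  fix n :: int
  show "norm (f n) * norm (g n) \<le> (norm (f n))\<^sup>2 + (norm (g n))\<^sup>2"
    using sum_squares_bound[of "norm (f n)" "norm (g n)"]
      mult_nonneg_nonneg[OF norm_ge_zero[of "f n"] norm_ge_zero[of "g n"]]
    by linarith
qed simp

lemma inner_summable: "(\<lambda>n. inner (coord f n) (coord g n)) summable_on UNIV"
proof -
  have "(\<lambda>n. norm (inner (coord f n) (coord g n))) summable_on UNIV"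
    by (rule summable_on_comparison_test[OF square_summable_prod[OF coord_summable[of f] coord_summable[of g]]])
       (auto simp: Cauchy_Schwarz_ineq2)
  then show ?thesis by (rule abs_summable_summable)
qed

lemma cinner_summable:
  "(\<lambda>n. cinner (coord f n) (coord g n)) summable_on UNIV" for f :: "'k::chilbert_space ell2Z"
proof -
  have "(\<lambda>n. norm (cinner (coord f n) (coord g n))) summable_on UNIV"
    by (rule summable_on_comparison_test[OF square_summable_prod[OF coord_summable[of f] coord_summable[of g]]])
       (auto simp: cmod_cinner_le)
  then show ?thesis by (rule abs_summable_summable)
qed

instantiation ell2Z :: (real_inner) real_inner
begin

lift_definition zero_ell2Z :: "'a ell2Z" is "\<lambda>_. 0" by simp
lift_definition plus_ell2Z :: "'a ell2Z \<Rightarrow> 'a ell2Z \<Rightarrow> 'a ell2Z" is "\<lambda>f g n. f n + g n"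
  by (simp add: square_summable_add)
lift_definition uminus_ell2Z :: "'a ell2Z \<Rightarrow> 'a ell2Z" is "\<lambda>f n. - f n" by simp
definition minus_ell2Z_def: "f - g = f + (- g)" for f :: "'a ell2Z"
lift_definition scaleR_ell2Z :: "real \<Rightarrow> 'a ell2Z \<Rightarrow> 'a ell2Z" is "\<lambda>r f n. r *\<^sub>R f n"
  by (simp add: power_mult_distrib summable_on_cmult_right)
definition inner_ell2Z_def: "inner f g = (\<Sum>\<^sub>\<infinity>n. inner (coord f n) (coord g n))" for f :: "'a ell2Z"
definition norm_ell2Z_def: "norm f = sqrt (inner f f)" for f :: "'a ell2Z"
definition dist_ell2Z_def: "dist f g = norm (f - g)" for f :: "'a ell2Z"
definition sgn_ell2Z_def: "sgn f = inverse (norm f) *\<^sub>R f" for f :: "'a ell2Z"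
definition uniformity_ell2Z_def: "uniformity = (INF e\<in>{0<..}. principal {(x, y :: 'a ell2Z). dist x y < e})"
definition open_ell2Z_def: "open U \<longleftrightarrow> (\<forall>x\<in>U. \<forall>\<^sub>F (x', y) in uniformity. x' = x \<longrightarrow> y \<in> U)" for U :: "'a ell2Z set"

lemmas coord_defs = zero_ell2Z.rep_eq plus_ell2Z.rep_eq uminus_ell2Z.rep_eq scaleR_ell2Z.rep_eq

instance
proof
  fix x y z :: "'a ell2Z" and a b :: real
  show "x + y + z = x + (y + z)" by (rule coord_inject_ext) (simp add: coord_defs add.assoc)
  show "x + y = y + x" by (rule coord_inject_ext) (simp add: coord_defs add.commute)
  show "0 + x = x" by (rule coord_inject_ext) (simp add: coord_defs)
  show "- x + x = 0" by (rule coord_inject_ext) (simp add: coord_defs)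
  show "x - y = x + - y" by (rule minus_ell2Z_def)
  show "a *\<^sub>R (x + y) = a *\<^sub>R x + a *\<^sub>R y" by (rule coord_inject_ext) (simp add: coord_defs scaleR_right_distrib)
  show "(a + b) *\<^sub>R x = a *\<^sub>R x + b *\<^sub>R x" by (rule coord_inject_ext) (simp add: coord_defs scaleR_left_distrib)
  show "a *\<^sub>R b *\<^sub>R x = (a * b) *\<^sub>R x" by (rule coord_inject_ext) (simp add: coord_defs)
  show "1 *\<^sub>R x = x" by (rule coord_inject_ext) (simp add: coord_defs)
  show "dist x y = norm (x - y)" by (rule dist_ell2Z_def)
  show "sgn x = inverse (norm x) *\<^sub>R x" by (rule sgn_ell2Z_def)
  show "uniformity = (INF e\<in>{0<..}. principal {(x, y::'a ell2Z). dist x y < e})"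
    by (rule uniformity_ell2Z_def)
  show "open U \<longleftrightarrow> (\<forall>x\<in>U. \<forall>\<^sub>F (x', y) in uniformity. x' = x \<longrightarrow> y \<in> U)" for U :: "'a ell2Z set"
    by (rule open_ell2Z_def)
  show "inner x y = inner y x" by (simp add: inner_ell2Z_def inner_commute)
  show "inner (x + y) z = inner x z + inner y z"
    unfolding inner_ell2Z_def plus_ell2Z.rep_eq inner_add_left
    by (rule infsum_add[OF inner_summable inner_summable])
  show "inner (a *\<^sub>R x) y = a * inner x y"
    by (simp add: inner_ell2Z_def scaleR_ell2Z.rep_eq infsum_cmult_right')
  show "0 \<le> inner x x" unfolding inner_ell2Z_def by (rule infsum_nonneg) simp
  show "inner x x = 0 \<longleftrightarrow> x = 0"
  proof
    assume 0: "inner x x = 0"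
    have "coord x n = 0" for n
    proof -
      have "inner (coord x n) (coord x n) = 0"
        using nonneg_infsum_le_0D[OF _ inner_summable[of x x], of n] 0
        by (simp add: inner_ell2Z_def)
      then show ?thesis by simp
    qed
    then show "x = 0" by (intro coord_inject_ext) (simp add: zero_ell2Z.rep_eq)
  qed (simp add: inner_ell2Z_def zero_ell2Z.rep_eq)
  show "norm x = sqrt (inner x x)" by (rule norm_ell2Z_def)
qed

end

lemma norm_ell2Z_square: "(norm f)\<^sup>2 = (\<Sum>\<^sub>\<infinity>n. (norm (coord f n))\<^sup>2)"
  unfolding power2_norm_eq_inner inner_ell2Z_def ..

lemma norm_coord_le: "norm (coord f n) \<le> norm f"
proof -
  have "(norm (coord f n))\<^sup>2 \<le> (norm f)\<^sup>2"
    unfolding norm_ell2Z_square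
    using finite_sum_le_infsum[OF coord_summable[of f], of "{n}"] by simp
  then show ?thesis by (rule power2_le_imp_le) simp
qed

lemma coord_simps [simp]:
  "coord 0 n = 0" "coord (f + g) n = coord f n + coord g n" "coord (- f) n = - coord f n"
  "coord (f - g) n = coord f n - coord g n" "coord (r *\<^sub>R f) n = r *\<^sub>R coord f n"
  by (simp_all only: coord_defs minus_ell2Z_def diff_conv_add_uminus)

lemma bounded_linear_coord: "bounded_linear (\<lambda>f. coord f n)"
  by (rule bounded_linear_intro[where K = 1]) (auto simp: norm_coord_le)

instance ell2Z :: ("{real_inner, complete_space}") complete_space
proof
  fix X :: "nat \<Rightarrow> 'a ell2Z"
  assume X: "Cauchy X"
  have "Cauchy (\<lambda>i. coord (X i) n)" for n
    by (rule bounded_linear.Cauchy[OF bounded_linear_coord X])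
  then have "\<forall>n. \<exists>l. (\<lambda>i. coord (X i) n) \<longlonglongrightarrow> l"
    by (simp add: Cauchy_convergent_iff convergent_def)
  then obtain g where g: "\<And>n. (\<lambda>i. coord (X i) n) \<longlonglongrightarrow> g n" by metis
  have part: "(\<Sum>n\<in>F. (norm (coord (X i) n - g n))\<^sup>2) \<le> e\<^sup>2"
    if F: "finite F" and i: "\<And>j. j \<ge> M \<Longrightarrow> norm (X i - X j) \<le> e" for F i M e
  proof (rule tendsto_upperbound)
    show "(\<lambda>j. \<Sum>n\<in>F. (norm (coord (X i) n - coord (X j) n))\<^sup>2)
        \<longlonglongrightarrow> (\<Sum>n\<in>F. (norm (coord (X i) n - g n))\<^sup>2)"
      by (intro tendsto_intros g)
    show "\<forall>\<^sub>F j in sequentially. (\<Sum>n\<in>F. (norm (coord (X i) n - coord (X j) n))\<^sup>2) \<le> e\<^sup>2"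
    proof (rule eventually_sequentiallyI)
      fix j assume "j \<ge> M"
      have "(\<Sum>n\<in>F. (norm (coord (X i - X j) n))\<^sup>2) \<le> (norm (X i - X j))\<^sup>2"
        unfolding norm_ell2Z_square by (rule finite_sum_le_infsum[OF coord_summable F]) auto
      also have "\<dots> \<le> e\<^sup>2" using i[OF \<open>j \<ge> M\<close>] by (simp add: power_mono)
      finally show "(\<Sum>n\<in>F. (norm (coord (X i) n - coord (X j) n))\<^sup>2) \<le> e\<^sup>2" by simp
    qed
  qed simp
  have diff: "(\<lambda>n. (norm (coord (X i) n - g n))\<^sup>2) summable_on UNIV \<and>
      (\<Sum>\<^sub>\<infinity>n. (norm (coord (X i) n - g n))\<^sup>2) \<le> e\<^sup>2"
    if i: "\<And>j. j \<ge> M \<Longrightarrow> norm (X i - X j) \<le> e" for i M e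
  proof
    show s: "(\<lambda>n. (norm (coord (X i) n - g n))\<^sup>2) summable_on UNIV"
      by (rule nonneg_bdd_above_summable_on)
         (auto intro!: bdd_aboveI[where M = "e\<^sup>2"] part[OF _ i])
    show "(\<Sum>\<^sub>\<infinity>n. (norm (coord (X i) n - g n))\<^sup>2) \<le> e\<^sup>2"
      by (rule infsum_le_finite_sums[OF s]) (rule part[OF _ i])
  qed
  obtain M1 where M1: "\<And>m n. m \<ge> M1 \<Longrightarrow> n \<ge> M1 \<Longrightarrow> norm (X m - X n) < 1"
    using CauchyD[OF X, of 1] by auto
  have "(\<lambda>n. (norm (coord (X M1) n - g n))\<^sup>2) summable_on UNIV"
    using diff[of M1 M1 1] M1 by (auto intro: less_imp_le)
  then have "(\<lambda>n. (norm (coord (X M1) n + - (coord (X M1) n - g n)))\<^sup>2) summable_on UNIV"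
    by (intro square_summable_add coord_summable) (simp only: norm_minus_cancel)
  then have gs: "(\<lambda>n. (norm (g n))\<^sup>2) summable_on UNIV" by simp
  define G where "G = Abs_ell2Z g"
  have G: "coord G = g" unfolding G_def using gs by (intro Abs_ell2Z_inverse) simp
  have "X \<longlonglongrightarrow> G"
  proof (rule LIMSEQ_I)
    fix r :: real assume r: "r > 0"
    obtain M where M: "\<And>m n. m \<ge> M \<Longrightarrow> n \<ge> M \<Longrightarrow> norm (X m - X n) < r / 2"
      using CauchyD[OF X, of "r/2"] r by auto
    show "\<exists>no. \<forall>n\<ge>no. norm (X n - G) < r"
    proof (intro exI allI impI)
      fix i assume i: "i \<ge> M"
      have "(norm (X i - G))\<^sup>2 \<le> (r/2)\<^sup>2"
        using diff[of M i "r/2"] M i by (auto simp: norm_ell2Z_square G intro: less_imp_le)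
      then have "norm (X i - G) \<le> r / 2" by (rule power2_le_imp_le) (use r in simp)
      then show "norm (X i - G) < r" using r by simp
    qed
  qed
  then show "convergent X" by (auto simp: convergent_def)
qed

instantiation ell2Z :: (chilbert_space) chilbert_space
begin

lift_definition scaleC_ell2Z :: "complex \<Rightarrow> 'a ell2Z \<Rightarrow> 'a ell2Z" is "\<lambda>c f n. c *\<^sub>C f n"
  by (simp add: norm_scaleC power_mult_distrib summable_on_cmult_right)
definition cinner_ell2Z_def: "cinner f g = (\<Sum>\<^sub>\<infinity>n. cinner (coord f n) (coord g n))" for f :: "'a ell2Z"

instance
proof
  fix x y z :: "'a ell2Z" and c d :: complex and r :: real
  show "c *\<^sub>C (x + y) = c *\<^sub>C x + c *\<^sub>C y" by (rule coord_inject_ext) (simp add: scaleC_ell2Z.rep_eq scaleC_add_right)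
  show "(c + d) *\<^sub>C x = c *\<^sub>C x + d *\<^sub>C x" by (rule coord_inject_ext) (simp add: scaleC_ell2Z.rep_eq scaleC_add_left)
  show "c *\<^sub>C d *\<^sub>C x = (c * d) *\<^sub>C x" by (rule coord_inject_ext) (simp add: scaleC_ell2Z.rep_eq scaleC_scaleC)
  show "r *\<^sub>R x = complex_of_real r *\<^sub>C x" by (rule coord_inject_ext) (simp add: scaleC_ell2Z.rep_eq scaleR_scaleC)
  show "cinner x y = cnj (cinner y x)"
    unfolding cinner_ell2Z_def infsum_cnj[symmetric]
    by (rule infsum_cong) (rule cinner_commute)
  show "cinner x (y + z) = cinner x y + cinner x z"
    unfolding cinner_ell2Z_def coord_simps cinner_add_right
    by (rule infsum_add[OF cinner_summable cinner_summable])
  show "cinner x (c *\<^sub>C y) = c * cinner x y"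
    by (simp add: cinner_ell2Z_def scaleC_ell2Z.rep_eq cinner_scaleC_right infsum_cmult_right')
  show "inner x y = Re (cinner x y)"
    unfolding cinner_ell2Z_def inner_ell2Z_def inner_cinner
    by (rule infsum_Re[OF cinner_summable])
qed

end


section \<open>Bounded operators and von Neumann algebras\<close>

text \<open>The type \<open>'a \<Rightarrow>\<^sub>L 'a\<close> consists of the bounded real-linear maps; \<open>cops\<close> is \<open>B(H)\<close>.\<close>

definition cops :: "('a::chilbert_space \<Rightarrow>\<^sub>L 'a) set" where
  "cops = {T. \<forall>c x. blinfun_apply T (c *\<^sub>C x) = c *\<^sub>C blinfun_apply T x}"

lift_definition scaleC_op :: "complex \<Rightarrow> ('a::chilbert_space \<Rightarrow>\<^sub>L 'a) \<Rightarrow> ('a \<Rightarrow>\<^sub>L 'a)"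
  is "\<lambda>c T x. c *\<^sub>C T x"
  by (rule bounded_linear_compose[OF bounded_linear_scaleC])

definition adj :: "('a::chilbert_space \<Rightarrow>\<^sub>L 'a) \<Rightarrow> ('a \<Rightarrow>\<^sub>L 'a)" where
  "adj T = (THE S. \<forall>x y. cinner (T x) y = cinner x (blinfun_apply S y))"

definition positive_op :: "('a::chilbert_space \<Rightarrow>\<^sub>L 'a) \<Rightarrow> bool" where
  "positive_op T \<longleftrightarrow> T \<in> cops \<and> (\<forall>x. cinner x (T x) \<in> \<real> \<and> 0 \<le> Re (cinner x (T x)))"

definition op_le :: "('a::chilbert_space \<Rightarrow>\<^sub>L 'a) \<Rightarrow> ('a \<Rightarrow>\<^sub>L 'a) \<Rightarrow> bool" where
  "op_le S T \<longleftrightarrow> positive_op (T - S)"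

definition unitary_op :: "('a::chilbert_space \<Rightarrow>\<^sub>L 'a) \<Rightarrow> bool" where
  "unitary_op w \<longleftrightarrow> w \<in> cops \<and> adj w o\<^sub>L w = id_blinfun \<and> w o\<^sub>L adj w = id_blinfun"

definition commutant :: "('a::chilbert_space \<Rightarrow>\<^sub>L 'a) set \<Rightarrow> ('a \<Rightarrow>\<^sub>L 'a) set" where
  "commutant S = {T \<in> cops. \<forall>s\<in>S. T o\<^sub>L s = s o\<^sub>L T}"

definition von_neumann_algebra :: "('a::chilbert_space \<Rightarrow>\<^sub>L 'a) set \<Rightarrow> bool" where
  "von_neumann_algebra A \<longleftrightarrow>
    A \<subseteq> cops \<and> (\<forall>a\<in>A. adj a \<in> A) \<and> commutant (commutant A) = A"

definition vn_generated :: "('a::chilbert_space \<Rightarrow>\<^sub>L 'a) set \<Rightarrow> ('a \<Rightarrow>\<^sub>L 'a) set" where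
  "vn_generated S = commutant (commutant (S \<union> adj ` S))"

definition star_subalgebra :: "('a::chilbert_space \<Rightarrow>\<^sub>L 'a) set \<Rightarrow> ('a \<Rightarrow>\<^sub>L 'a) set \<Rightarrow> bool" where
  "star_subalgebra A M \<longleftrightarrow> A \<subseteq> M \<and> 0 \<in> A \<and>
    (\<forall>a\<in>A. \<forall>b\<in>A. a + b \<in> A \<and> a o\<^sub>L b \<in> A) \<and> (\<forall>c. \<forall>a\<in>A. scaleC_op c a \<in> A) \<and>
    (\<forall>a\<in>A. adj a \<in> A)"

definition abelian :: "('a::chilbert_space \<Rightarrow>\<^sub>L 'a) set \<Rightarrow> bool" where
  "abelian A \<longleftrightarrow> (\<forall>a\<in>A. \<forall>b\<in>A. a o\<^sub>L b = b o\<^sub>L a)"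

definition masa :: "('a::chilbert_space \<Rightarrow>\<^sub>L 'a) set \<Rightarrow> ('a \<Rightarrow>\<^sub>L 'a) set \<Rightarrow> bool" where
  "masa A M \<longleftrightarrow> star_subalgebra A M \<and> abelian A \<and>
    (\<forall>C. star_subalgebra C M \<and> abelian C \<and> A \<subseteq> C \<longrightarrow> C = A)"


section \<open>Traces, automorphisms, weak mixing\<close>

definition normal_on :: "('a::chilbert_space \<Rightarrow>\<^sub>L 'a) set \<Rightarrow> (('a \<Rightarrow>\<^sub>L 'a) \<Rightarrow> complex) \<Rightarrow> bool" where
  "normal_on N tr \<longleftrightarrow> (\<forall>D s.
     D \<noteq> {} \<and> D \<subseteq> {x \<in> N. positive_op x} \<and>
     (\<forall>x\<in>D. \<forall>y\<in>D. \<exists>z\<in>D. op_le x z \<and> op_le y z) \<and>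
     s \<in> N \<and> (\<forall>x\<in>D. op_le x s) \<and> (\<forall>t\<in>N. (\<forall>x\<in>D. op_le x t) \<longrightarrow> op_le s t)
     \<longrightarrow> Re (tr s) = (SUP x\<in>D. Re (tr x)))"

definition faithful_normal_trace ::
    "('a::chilbert_space \<Rightarrow>\<^sub>L 'a) set \<Rightarrow> (('a \<Rightarrow>\<^sub>L 'a) \<Rightarrow> complex) \<Rightarrow> bool" where
  "faithful_normal_trace N tr \<longleftrightarrow>
    (\<forall>x\<in>N. \<forall>y\<in>N. tr (x + y) = tr x + tr y) \<and>
    (\<forall>c. \<forall>x\<in>N. tr (scaleC_op c x) = c * tr x) \<and>
    (\<forall>x\<in>N. positive_op x \<longrightarrow> tr x \<in> \<real> \<and> 0 \<le> Re (tr x)) \<and>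
    (\<forall>x\<in>N. \<forall>y\<in>N. tr (x o\<^sub>L y) = tr (y o\<^sub>L x)) \<and>
    (\<forall>x\<in>N. tr (adj x o\<^sub>L x) = 0 \<longrightarrow> x = 0) \<and>
    normal_on N tr"

definition star_automorphism ::
    "('a::chilbert_space \<Rightarrow>\<^sub>L 'a) set \<Rightarrow> (('a \<Rightarrow>\<^sub>L 'a) \<Rightarrow> ('a \<Rightarrow>\<^sub>L 'a)) \<Rightarrow> bool" where
  "star_automorphism N \<theta> \<longleftrightarrow> bij_betw \<theta> N N \<and>
    (\<forall>x\<in>N. \<forall>y\<in>N. \<theta> (x + y) = \<theta> x + \<theta> y \<and> \<theta> (x o\<^sub>L y) = \<theta> x o\<^sub>L \<theta> y) \<and>
    (\<forall>c. \<forall>x\<in>N. \<theta> (scaleC_op c x) = scaleC_op c (\<theta> x)) \<and>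
    (\<forall>x\<in>N. \<theta> (adj x) = adj (\<theta> x))"

definition trace_preserving ::
    "('a::chilbert_space \<Rightarrow>\<^sub>L 'a) set \<Rightarrow> (('a \<Rightarrow>\<^sub>L 'a) \<Rightarrow> complex) \<Rightarrow> (('a \<Rightarrow>\<^sub>L 'a) \<Rightarrow> ('a \<Rightarrow>\<^sub>L 'a)) \<Rightarrow> bool" where
  "trace_preserving N tr \<theta> \<longleftrightarrow> (\<forall>x\<in>N. tr (\<theta> x) = tr x)"

definition weakly_mixing ::
    "('a::chilbert_space \<Rightarrow>\<^sub>L 'a) set \<Rightarrow> (('a \<Rightarrow>\<^sub>L 'a) \<Rightarrow> complex) \<Rightarrow> (('a \<Rightarrow>\<^sub>L 'a) \<Rightarrow> ('a \<Rightarrow>\<^sub>L 'a)) \<Rightarrow> bool" where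
  "weakly_mixing N tr \<theta> \<longleftrightarrow> (\<forall>x\<in>N. \<forall>y\<in>N.
    (\<lambda>n. 1 / real n * (\<Sum>k<n. cmod (tr (x o\<^sub>L (\<theta> ^^ k) y) - tr x * tr y))) \<longlonglongrightarrow> 0)"

text \<open>\<open>\<alpha>\<^sub>n = \<theta>\<^sup>n\<close> for \<open>n \<in> \<int>\<close>.\<close>

definition aut_power :: "'x set \<Rightarrow> ('x \<Rightarrow> 'x) \<Rightarrow> int \<Rightarrow> 'x \<Rightarrow> 'x" where
  "aut_power N \<theta> n = (if 0 \<le> n then \<theta> ^^ nat n else inv_into N \<theta> ^^ nat (- n))"


section \<open>The crossed product by \<open>\<int>\<close>\<close>

text \<open>\<open>L\<^sup>2(N, tr)\<close> is the Hilbert space completion of \<open>N\<close> for \<open>\<langle>x, y\<rangle> = tr (x\<^sup>* y)\<close>. It depends on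
  \<open>N\<close> and \<open>tr\<close>, so it is given as a Hilbert space type \<open>'k\<close> with the canonical map \<open>\<Lambda>\<close> of \<open>N\<close>
  into it; this determines \<open>('k, \<Lambda>)\<close> up to a unique unitary.\<close>

definition is_L2_space ::
    "('a::chilbert_space \<Rightarrow>\<^sub>L 'a) set \<Rightarrow> (('a \<Rightarrow>\<^sub>L 'a) \<Rightarrow> complex) \<Rightarrow>
      (('a \<Rightarrow>\<^sub>L 'a) \<Rightarrow> 'k::chilbert_space) \<Rightarrow> bool" where
  "is_L2_space N tr \<Lambda> \<longleftrightarrow>
    (\<forall>x\<in>N. \<forall>y\<in>N. \<Lambda> (x + y) = \<Lambda> x + \<Lambda> y) \<and>
    (\<forall>c. \<forall>x\<in>N. \<Lambda> (scaleC_op c x) = c *\<^sub>C \<Lambda> x) \<and>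
    (\<forall>x\<in>N. \<forall>y\<in>N. cinner (\<Lambda> x) (\<Lambda> y) = tr (adj x o\<^sub>L y)) \<and>
    closure (\<Lambda> ` N) = UNIV"

definition left_mult ::
    "('a::chilbert_space \<Rightarrow>\<^sub>L 'a) set \<Rightarrow> (('a \<Rightarrow>\<^sub>L 'a) \<Rightarrow> 'k::chilbert_space) \<Rightarrow>
      ('a \<Rightarrow>\<^sub>L 'a) \<Rightarrow> ('k \<Rightarrow>\<^sub>L 'k)" where
  "left_mult N \<Lambda> x = (THE T. T \<in> cops \<and> (\<forall>y\<in>N. blinfun_apply T (\<Lambda> y) = \<Lambda> (x o\<^sub>L y)))"

text \<open>\<open>(\<pi>(x) \<xi>)(n) = \<theta>\<^sup>-\<^sup>n(x) \<xi>(n)\<close> and \<open>(u \<xi>)(n) = \<xi>(n - 1)\<close>, so that \<open>u \<pi>(x) u\<^sup>* = \<pi>(\<theta>(x))\<close>.\<close>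

definition crossed_rep ::
    "('a::chilbert_space \<Rightarrow>\<^sub>L 'a) set \<Rightarrow> (('a \<Rightarrow>\<^sub>L 'a) \<Rightarrow> ('a \<Rightarrow>\<^sub>L 'a)) \<Rightarrow>
      (('a \<Rightarrow>\<^sub>L 'a) \<Rightarrow> 'k::chilbert_space) \<Rightarrow> ('a \<Rightarrow>\<^sub>L 'a) \<Rightarrow> ('k ell2Z \<Rightarrow>\<^sub>L 'k ell2Z)" where
  "crossed_rep N \<theta> \<Lambda> x =
    Blinfun (\<lambda>\<xi>. Abs_ell2Z (\<lambda>n. left_mult N \<Lambda> (aut_power N \<theta> (- n) x) (coord \<xi> n)))"

lemma square_summable_shift:
  fixes f :: "int \<Rightarrow> 'k::real_inner"
  shows "(\<lambda>n. (norm (f (n - 1)))\<^sup>2) summable_on UNIV \<longleftrightarrow> (\<lambda>n. (norm (f n))\<^sup>2) summable_on UNIV"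
  by (rule summable_on_reindex_bij_betw[of "\<lambda>n. n - 1" UNIV UNIV "\<lambda>n. (norm (f n))\<^sup>2"])
     (rule bij_betw_byWitness[where f' = "\<lambda>n. n + 1"]; simp)

lift_definition shift :: "'k::real_inner ell2Z \<Rightarrow> 'k ell2Z" is "\<lambda>f n. f (n - 1)"
  by (simp add: square_summable_shift)

lemma norm_shift: "norm (shift f) = norm f"
proof -
  have "(norm (shift f))\<^sup>2 = (norm f)\<^sup>2"
    unfolding norm_ell2Z_square shift.rep_eq
    by (rule infsum_reindex_bij_betw[of "\<lambda>n. n - 1" UNIV UNIV "\<lambda>n. (norm (coord f n))\<^sup>2"])
       (rule bij_betw_byWitness[where f' = "\<lambda>n. n + 1"]; simp)
  then show ?thesis by (simp add: power2_eq_iff_nonneg)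
qed

lift_definition crossed_unitary :: "'k::chilbert_space ell2Z \<Rightarrow>\<^sub>L 'k ell2Z" is shift
  by (rule bounded_linear_intro[where K = 1])
     (auto simp: norm_shift shift.rep_eq intro!: coord_inject_ext)

definition crossed_product ::
    "('a::chilbert_space \<Rightarrow>\<^sub>L 'a) set \<Rightarrow> (('a \<Rightarrow>\<^sub>L 'a) \<Rightarrow> ('a \<Rightarrow>\<^sub>L 'a)) \<Rightarrow>
      (('a \<Rightarrow>\<^sub>L 'a) \<Rightarrow> 'k::chilbert_space) \<Rightarrow> ('k ell2Z \<Rightarrow>\<^sub>L 'k ell2Z) set" where
  "crossed_product N \<theta> \<Lambda> = vn_generated (insert crossed_unitary (crossed_rep N \<theta> \<Lambda> ` N))"

lift_definition delta :: "int \<Rightarrow> 'k::real_inner \<Rightarrow> 'k ell2Z" is "\<lambda>m v n. if n = m then v else 0"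
proof -
  fix m and v :: 'k
  have "(\<lambda>n. (norm (if n = m then v else 0))\<^sup>2) summable_on {m}" by simp
  then show "(\<lambda>n. (norm (if n = m then v else 0))\<^sup>2) summable_on UNIV"
    by (subst summable_on_cong_neutral[where T = "{m}"]) auto
qed

text \<open>The trace of \<open>M\<close>, as the vector state of \<open>\<Lambda>(1) \<otimes> \<delta>\<^sub>0\<close>. The lemma \<open>crossed_trace_Fourier\<close>
  below shows that its value at \<open>T = \<Sum>\<^sub>n \<pi>(x\<^sub>n) u\<^sup>n\<close> is \<open>tr(x\<^sub>0)\<close>.\<close>

definition crossed_trace ::
    "(('a::chilbert_space \<Rightarrow>\<^sub>L 'a) \<Rightarrow> 'k::chilbert_space) \<Rightarrow> ('k ell2Z \<Rightarrow>\<^sub>L 'k ell2Z) \<Rightarrow> complex" where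
  "crossed_trace \<Lambda> T = cinner (delta 0 (\<Lambda> id_blinfun)) (T (delta 0 (\<Lambda> id_blinfun)))"


section \<open>Conditional expectations and strong singularity\<close>

definition is_cond_exp ::
    "(('a::chilbert_space \<Rightarrow>\<^sub>L 'a) \<Rightarrow> complex) \<Rightarrow> ('a \<Rightarrow>\<^sub>L 'a) set \<Rightarrow> ('a \<Rightarrow>\<^sub>L 'a) set \<Rightarrow>
      (('a \<Rightarrow>\<^sub>L 'a) \<Rightarrow> ('a \<Rightarrow>\<^sub>L 'a)) \<Rightarrow> bool" where
  "is_cond_exp \<tau> M A E \<longleftrightarrow>
    (\<forall>x\<in>M. E x \<in> A) \<and> (\<forall>a\<in>A. E a = a) \<and>
    (\<forall>x\<in>M. \<forall>y\<in>M. E (x + y) = E x + E y) \<and>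
    (\<forall>c. \<forall>x\<in>M. E (scaleC_op c x) = scaleC_op c (E x)) \<and>
    (\<forall>x\<in>M. positive_op x \<longrightarrow> positive_op (E x)) \<and>
    (\<forall>a\<in>A. \<forall>b\<in>A. \<forall>x\<in>M. E (a o\<^sub>L x o\<^sub>L b) = a o\<^sub>L E x o\<^sub>L b) \<and>
    (\<forall>x\<in>M. \<tau> (E x) = \<tau> x)"

text \<open>Uniqueness is meant for maps on \<open>M\<close>, hence the restriction to \<open>extensional M\<close>.\<close>

definition cond_exp ::
    "(('a::chilbert_space \<Rightarrow>\<^sub>L 'a) \<Rightarrow> complex) \<Rightarrow> ('a \<Rightarrow>\<^sub>L 'a) set \<Rightarrow> ('a \<Rightarrow>\<^sub>L 'a) set \<Rightarrow>
      ('a \<Rightarrow>\<^sub>L 'a) \<Rightarrow> ('a \<Rightarrow>\<^sub>L 'a)" where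
  "cond_exp \<tau> M A = (THE E. E \<in> extensional M \<and> is_cond_exp \<tau> M A E)"

definition norm2 :: "(('a::chilbert_space \<Rightarrow>\<^sub>L 'a) \<Rightarrow> complex) \<Rightarrow> ('a \<Rightarrow>\<^sub>L 'a) \<Rightarrow> real" where
  "norm2 \<tau> x = sqrt (Re (\<tau> (adj x o\<^sub>L x)))"

definition norm_inf_2 ::
    "(('a::chilbert_space \<Rightarrow>\<^sub>L 'a) \<Rightarrow> complex) \<Rightarrow> ('a \<Rightarrow>\<^sub>L 'a) set \<Rightarrow>
      (('a \<Rightarrow>\<^sub>L 'a) \<Rightarrow> ('a \<Rightarrow>\<^sub>L 'a)) \<Rightarrow> ereal" where
  "norm_inf_2 \<tau> M \<phi> = (SUP x\<in>{x \<in> M. norm x \<le> 1}. ereal (norm2 \<tau> (\<phi> x)))"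

definition strongly_singular ::
    "(('a::chilbert_space \<Rightarrow>\<^sub>L 'a) \<Rightarrow> complex) \<Rightarrow> ('a \<Rightarrow>\<^sub>L 'a) set \<Rightarrow> ('a \<Rightarrow>\<^sub>L 'a) set \<Rightarrow> bool" where
  "strongly_singular \<tau> M A \<longleftrightarrow> von_neumann_algebra A \<and> A \<subseteq> M \<and>
    (\<forall>w\<in>M. unitary_op w \<longrightarrow>
      norm_inf_2 \<tau> M (\<lambda>x. cond_exp \<tau> M A x - cond_exp \<tau> M ((\<lambda>a. w o\<^sub>L a o\<^sub>L adj w) ` A) x)
        \<ge> ereal (norm2 \<tau> (w - cond_exp \<tau> M A w)))"


section \<open>Adjoints, covariance of \<open>(\<pi>, u)\<close>, and the Fourier formula for the trace\<close>

lemma riesz_real: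
  fixes f :: "'a::{real_inner, complete_space} \<Rightarrow> real"
  assumes "bounded_linear f"
  shows "\<exists>y. \<forall>x. f x = inner y x"
proof -
  interpret f: bounded_linear f by fact
  obtain K where K: "K > 0" "\<And>x. \<bar>f x\<bar> \<le> norm x * K" using f.pos_bounded by auto
  define q where "q x = (norm x)\<^sup>2 / 2 - f x" for x
  have q_ge: "q x \<ge> - (K\<^sup>2 / 2)" for x
  proof -
    have "f x \<le> norm x * K" using K(2)[of x] by linarith
    moreover have "2 * (norm x * K) \<le> (norm x)\<^sup>2 + K\<^sup>2"
      using sum_squares_bound[of "norm x" K] by (simp add: algebra_simps)
    ultimately show ?thesis unfolding q_def by linarith
  qed
  define m where "m = (INF x. q x)"
  have m_le: "m \<le> q x" for x
    unfolding m_def by (rule cINF_lower) (auto intro!: bdd_belowI[where m = "- (K\<^sup>2/2)"] q_ge)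
  have ex: "\<exists>x. q x < m + e" if "e > 0" for e
  proof (rule ccontr)
    assume "\<not> ?thesis"
    then have "m + e \<le> m" unfolding m_def by (intro cINF_greatest) (auto simp: not_less m_def)
    then show False using that by simp
  qed
  define X where "X n = (SOME x. q x < m + inverse (real (Suc n)))" for n
  have X: "q (X n) < m + inverse (real (Suc n))" for n
    unfolding X_def by (rule someI_ex) (rule ex, simp)
  have par: "(norm (x - y))\<^sup>2 \<le> 4 * (q x + q y - 2 * m)" for x y
  proof -
    have "q ((1/2) *\<^sub>R (x + y)) = (q x + q y) / 2 - (norm (x - y))\<^sup>2 / 8"
      unfolding q_def f.scaleR f.add
      by (simp add: power2_norm_eq_inner inner_add inner_diff inner_commute field_simps)
    then have "m \<le> (q x + q y) / 2 - (norm (x - y))\<^sup>2 / 8" using m_le by metis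
    moreover have "d \<le> 4 * (a + b - 2 * c)" if "c \<le> (a + b) / 2 - d / 8" for a b c d :: real
      using that by (simp add: field_simps)
    ultimately show ?thesis by blast
  qed
  have lim0: "(\<lambda>n. 8 * inverse (real (Suc n))) \<longlonglongrightarrow> 0"
    by (intro tendsto_mult_right_zero LIMSEQ_inverse_real_of_nat)
  have "Cauchy X"
  proof (rule metric_CauchyI)
    fix e :: real assume e: "e > 0"
    then obtain M where M: "\<And>n. n \<ge> M \<Longrightarrow> 8 * inverse (real (Suc n)) < e\<^sup>2"
      using order_tendstoD(2)[OF lim0, of "e\<^sup>2"] by (auto simp: eventually_sequentially)
    show "\<exists>M. \<forall>m\<ge>M. \<forall>n\<ge>M. dist (X m) (X n) < e"
    proof (intro exI allI impI)
      fix a b assume "a \<ge> M" "b \<ge> M"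
      then have "(norm (X a - X b))\<^sup>2 < e\<^sup>2"
        using par[of "X a" "X b"] X[of a] X[of b] M[OF \<open>a \<ge> M\<close>] M[OF \<open>b \<ge> M\<close>]
        by (simp add: algebra_simps)
      then show "dist (X a) (X b) < e"
        using e by (auto simp: dist_norm intro: power2_less_imp_less)
    qed
  qed
  then obtain y where y: "X \<longlonglongrightarrow> y" using Cauchy_convergent convergent_def by blast
  have "(\<lambda>n. q (X n)) \<longlonglongrightarrow> q y"
    unfolding q_def by (intro tendsto_intros y f.tendsto) simp
  moreover have "(\<lambda>n. m + inverse (real (Suc n))) \<longlonglongrightarrow> m + 0"
    by (intro tendsto_intros LIMSEQ_inverse_real_of_nat)
  ultimately have "q y \<le> m + 0"
    by (rule LIMSEQ_le) (use X in \<open>auto intro: less_imp_le\<close>)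
  then have min: "q y \<le> q x" for x using m_le[of x] by linarith
  have "f x = inner y x" for x
  proof (cases "x = 0")
    case False
    define d where "d = f x - inner y x"
    define t where "t = d / (norm x)\<^sup>2"
    have n: "(norm x)\<^sup>2 > 0" using False by simp
    have "inner (y + t *\<^sub>R x) (y + t *\<^sub>R x) = inner y y + 2 * t * inner y x + t\<^sup>2 * inner x x"
      by (simp add: inner_add inner_commute power2_eq_square)
    then have "q (y + t *\<^sub>R x) = q y - t * d + t\<^sup>2 * (norm x)\<^sup>2 / 2"
      unfolding q_def d_def f.scaleR f.add
      by (simp add: power2_norm_eq_inner field_simps)
    with min[of "y + t *\<^sub>R x"] have "t * d \<le> t\<^sup>2 * (norm x)\<^sup>2 / 2" by linarith
    moreover have "t * d = d\<^sup>2 / (norm x)\<^sup>2" "t\<^sup>2 * (norm x)\<^sup>2 = d\<^sup>2 / (norm x)\<^sup>2"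
      using n by (simp_all add: t_def power2_eq_square field_simps)
    ultimately have "d\<^sup>2 / (norm x)\<^sup>2 \<le> 0" by linarith
    then have "d\<^sup>2 \<le> 0" using n by (simp add: divide_le_0_iff)
    then show ?thesis by (simp add: d_def)
  qed (simp add: f.zero)
  then show ?thesis by blast
qed

lemma blinfun_eq_iff: "S = T \<longleftrightarrow> (\<forall>x. blinfun_apply S x = blinfun_apply T x)"
  by (auto intro: blinfun_eqI)

lemma copsD: "T \<in> cops \<Longrightarrow> blinfun_apply T (c *\<^sub>C x) = c *\<^sub>C blinfun_apply T x"
  by (simp add: cops_def)

lemma adj_ex:
  fixes T :: "'a::chilbert_space \<Rightarrow>\<^sub>L 'a"
  assumes T: "T \<in> cops"
  shows "\<exists>S. \<forall>x y. cinner (T x) y = cinner x (blinfun_apply S y)"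
proof -
  have "\<exists>z. \<forall>x. inner (T x) y = inner z x" for y
    by (rule riesz_real) (intro bounded_linear_intros)
  then obtain g where g: "\<And>x y. inner (T x) y = inner (g y) x" by metis
  have g': "inner (g y) x = inner y (T x)" for x y using g by (simp add: inner_commute)
  have eqI: "a = b" if "\<And>x. inner a x = inner b x" for a b :: 'a
    using that[of "a - b"] by (metis inner_diff_left inner_eq_zero_iff right_minus_eq)
  have "bounded_linear g"
  proof (rule bounded_linear_intro)
    show "g (x + y) = g x + g y" for x y by (rule eqI) (simp add: g' inner_add_left)
    show "g (r *\<^sub>R x) = r *\<^sub>R g x" for r x by (rule eqI) (simp add: g')
    fix x
    have "norm (g x) * norm (g x) = inner x (T (g x))"
      by (metis g' power2_norm_eq_inner power2_eq_square)
    also have "\<dots> \<le> norm x * norm (T (g x))" by (rule norm_cauchy_schwarz)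
    also have "\<dots> \<le> norm x * (norm T * norm (g x))"
      by (intro mult_left_mono norm_blinfun) simp
    finally have "norm (g x) * norm (g x) \<le> (norm x * norm T) * norm (g x)" by (simp add: mult_ac)
    then show "norm (g x) \<le> norm x * norm T"
      by (cases "norm (g x) = 0") (auto simp: mult_le_cancel_right)
  qed
  then have S: "blinfun_apply (Blinfun g) = g" by (rule bounded_linear_Blinfun_apply)
  have Re: "Re (cinner (T x) y) = Re (cinner x (g y))" for x y
    using g[of x y] by (simp add: inner_cinner[symmetric] inner_commute)
  have "cinner (T x) y = cinner x (g y)" for x y
  proof (rule complex_eqI[OF Re])
    have "Re (cinner (T (\<i> *\<^sub>C x)) y) = Re (cinner (\<i> *\<^sub>C x) (g y))" by (rule Re)
    then show "Im (cinner (T x) y) = Im (cinner x (g y))"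
      by (simp add: copsD[OF T] cinner_scaleC_left)
  qed
  then show ?thesis using S by metis
qed

lemma adj_adjoint:
  fixes T :: "'a::chilbert_space \<Rightarrow>\<^sub>L 'a"
  assumes T: "T \<in> cops"
  shows "cinner (T x) y = cinner x (adj T y)"
proof -
  obtain S where S: "\<forall>x y. cinner (T x) y = cinner x (blinfun_apply S y)" using adj_ex[OF T] by blast
  have "adj T = S"
    unfolding adj_def
  proof (rule the_equality)
    show "\<forall>x y. cinner (T x) y = cinner x (blinfun_apply S y)" by (rule S)
    fix R assume R: "\<forall>x y. cinner (T x) y = cinner x (blinfun_apply R y)"
    show "R = S"
    proof (rule blinfun_eqI)
      fix y
      have "inner (R y - S y) x = 0" for x
      proof -
        have "cinner x (R y) = cinner x (S y)" using R S by metis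
        then have "inner x (R y) = inner x (S y)" by (simp add: inner_cinner)
        then show ?thesis by (simp add: inner_diff_right inner_commute)
      qed
      then show "R y = S y" by (metis inner_eq_zero_iff right_minus_eq)
    qed
  qed
  then show ?thesis using S by simp
qed


lemma cinner_right_eqI: "(\<And>x. cinner x y = cinner x z) \<Longrightarrow> y = z" for y z :: "'a::chilbert_space"
proof -
  assume "\<And>x. cinner x y = cinner x z"
  then have "inner (y - z) y = inner (y - z) z" by (simp add: inner_cinner)
  then have "inner (y - z) (y - z) = 0" by (simp add: inner_diff_right)
  then show ?thesis by simp
qed

lemma cops_compose: "S \<in> cops \<Longrightarrow> T \<in> cops \<Longrightarrow> S o\<^sub>L T \<in> cops"
  and cops_add: "S \<in> cops \<Longrightarrow> T \<in> cops \<Longrightarrow> S + T \<in> cops"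
  and cops_scaleC: "S \<in> cops \<Longrightarrow> scaleC_op c S \<in> cops"
  and cops_id: "id_blinfun \<in> cops"
  by (simp_all add: cops_def blinfun.add_left scaleC_add_right scaleC_op.rep_eq scaleC_scaleC mult.commute)

lemma cops_adj: assumes T: "T \<in> cops" shows "adj T \<in> cops"
proof -
  have "adj T (c *\<^sub>C y) = c *\<^sub>C adj T y" for c y
    by (rule cinner_right_eqI) (simp add: adj_adjoint[OF T, symmetric] cinner_scaleC_right)
  then show ?thesis by (simp add: cops_def)
qed

lemma adj_unique:
  assumes "T \<in> cops" "\<And>x y. cinner (T x) y = cinner x (blinfun_apply S y)"
  shows "adj T = S"
  using assms by (intro blinfun_eqI cinner_right_eqI) (metis adj_adjoint)

lemma adj_compose: assumes "S \<in> cops" "T \<in> cops" shows "adj (S o\<^sub>L T) = adj T o\<^sub>L adj S"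
  by (rule adj_unique) (simp_all add: assms cops_compose adj_adjoint)

lemma adj_id: "adj id_blinfun = id_blinfun"
  by (rule adj_unique) (simp_all add: cops_id)

lemma commutant_closed:
  "S \<in> commutant A \<Longrightarrow> T \<in> commutant A \<Longrightarrow> S o\<^sub>L T \<in> commutant A"
  "S \<in> commutant A \<Longrightarrow> T \<in> commutant A \<Longrightarrow> S + T \<in> commutant A"
  "A \<subseteq> cops \<Longrightarrow> S \<in> commutant A \<Longrightarrow> scaleC_op c S \<in> commutant A"
  "id_blinfun \<in> commutant A"
proof -
  assume "S \<in> commutant A" "T \<in> commutant A"
  then show "S o\<^sub>L T \<in> commutant A"
    by (auto simp: commutant_def cops_compose blinfun_eq_iff)
next
  assume "S \<in> commutant A" "T \<in> commutant A"
  then show "S + T \<in> commutant A"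
    by (auto simp: commutant_def cops_add blinfun_eq_iff blinfun.add_left blinfun.add_right)
next
  assume "A \<subseteq> cops" "S \<in> commutant A"
  then show "scaleC_op c S \<in> commutant A"
    by (auto simp: commutant_def cops_scaleC blinfun_eq_iff scaleC_op.rep_eq copsD)
next
  show "id_blinfun \<in> commutant A" by (auto simp: commutant_def cops_id blinfun_eq_iff)
qed

lemma von_neumann_algebraD:
  assumes "von_neumann_algebra A"
  shows "A \<subseteq> cops" "\<And>a. a \<in> A \<Longrightarrow> adj a \<in> A" "id_blinfun \<in> A"
    "\<And>a b. a \<in> A \<Longrightarrow> b \<in> A \<Longrightarrow> a o\<^sub>L b \<in> A" "\<And>a b. a \<in> A \<Longrightarrow> b \<in> A \<Longrightarrow> a + b \<in> A"
    "\<And>a c. a \<in> A \<Longrightarrow> scaleC_op c a \<in> A"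
proof -
  have A: "commutant (commutant A) = A" and c: "commutant A \<subseteq> cops"
    using assms by (auto simp: von_neumann_algebra_def commutant_def)
  show "A \<subseteq> cops" "\<And>a. a \<in> A \<Longrightarrow> adj a \<in> A" using assms by (auto simp: von_neumann_algebra_def)
  show "id_blinfun \<in> A" "\<And>a b. a \<in> A \<Longrightarrow> b \<in> A \<Longrightarrow> a o\<^sub>L b \<in> A" "\<And>a b. a \<in> A \<Longrightarrow> b \<in> A \<Longrightarrow> a + b \<in> A"
    "\<And>a c. a \<in> A \<Longrightarrow> scaleC_op c a \<in> A"
    using commutant_closed[where A = "commutant A"] c unfolding A by blast+
qed

context
  fixes N :: "('a::chilbert_space \<Rightarrow>\<^sub>L 'a) set" and tr :: "('a \<Rightarrow>\<^sub>L 'a) \<Rightarrow> complex"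
    and \<Lambda> :: "('a \<Rightarrow>\<^sub>L 'a) \<Rightarrow> 'k::chilbert_space"
  assumes N: "von_neumann_algebra N" and tr: "faithful_normal_trace N tr" and L2: "is_L2_space N tr \<Lambda>"
begin

lemma L2D:
  "x \<in> N \<Longrightarrow> y \<in> N \<Longrightarrow> \<Lambda> (x + y) = \<Lambda> x + \<Lambda> y"
  "x \<in> N \<Longrightarrow> \<Lambda> (scaleC_op c x) = c *\<^sub>C \<Lambda> x"
  "x \<in> N \<Longrightarrow> y \<in> N \<Longrightarrow> cinner (\<Lambda> x) (\<Lambda> y) = tr (adj x o\<^sub>L y)"
  "closure (\<Lambda> ` N) = UNIV"
  using L2 by (auto simp: is_L2_space_def)

lemma norm_L2_mult:
  assumes x: "x \<in> N" and y: "y \<in> N"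
  shows "norm (\<Lambda> (x o\<^sub>L y)) \<le> norm x * norm (\<Lambda> y)"
proof -
  note [simp] = von_neumann_algebraD(2-)[OF N]
  have c: "x \<in> cops" "y \<in> cops" using x y von_neumann_algebraD(1)[OF N] by blast+
  define a where "a = adj y o\<^sub>L y"
  define b where "b = adj (x o\<^sub>L y) o\<^sub>L (x o\<^sub>L y)"
  have ab: "a \<in> N" "b \<in> N" using x y by (auto simp: a_def b_def)
  define P where "P = scaleC_op (complex_of_real ((norm x)\<^sup>2)) a + scaleC_op (- 1) b"
  have PN: "P \<in> N" using ab by (simp add: P_def)
  have "positive_op P"
    unfolding positive_op_def
  proof (intro conjI allI)
    show "P \<in> cops" using PN von_neumann_algebraD(1)[OF N] by blast
    fix v
    have a: "cinner v (a v) = complex_of_real ((norm (y v))\<^sup>2)"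
      by (simp add: a_def adj_adjoint[OF c(2), symmetric] cinner_self)
    have b: "cinner v (b v) = complex_of_real ((norm (x (y v)))\<^sup>2)"
      using adj_adjoint[OF cops_compose[OF c], of v "(x o\<^sub>L y) v"] by (simp add: b_def cinner_self)
    have P: "cinner v (P v) = complex_of_real ((norm x)\<^sup>2 * (norm (y v))\<^sup>2 - (norm (x (y v)))\<^sup>2)"
      by (simp add: P_def blinfun.add_left scaleC_op.rep_eq cinner_add_right cinner_scaleC_right a b)
    show "cinner v (P v) \<in> \<real>" unfolding P by simp
    have "(norm (x (y v)))\<^sup>2 \<le> (norm x * norm (y v))\<^sup>2"
      by (intro power_mono norm_blinfun) simp
    then show "0 \<le> Re (cinner v (P v))" unfolding P by (simp add: power_mult_distrib)
  qed
  then have "0 \<le> Re (tr P)" using tr PN by (auto simp: faithful_normal_trace_def)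
  also have "tr P = complex_of_real ((norm x)\<^sup>2) * tr a - tr b"
    using tr ab by (auto simp: faithful_normal_trace_def P_def)
  also have "tr a = complex_of_real ((norm (\<Lambda> y))\<^sup>2)"
    using y by (simp add: a_def L2D(3)[symmetric] cinner_self)
  also have "tr b = complex_of_real ((norm (\<Lambda> (x o\<^sub>L y)))\<^sup>2)"
    using x y by (simp add: b_def L2D(3)[symmetric] cinner_self)
  finally have "(norm (\<Lambda> (x o\<^sub>L y)))\<^sup>2 \<le> (norm x * norm (\<Lambda> y))\<^sup>2"
    by (simp add: power_mult_distrib)
  then show ?thesis by (rule power2_le_imp_le) simp
qed

lemma L2_diff: assumes "x \<in> N" "y \<in> N"
  shows "x + scaleC_op (-1) y \<in> N" "\<Lambda> (x + scaleC_op (-1) y) = \<Lambda> x - \<Lambda> y"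
proof -
  show "x + scaleC_op (-1) y \<in> N" using assms von_neumann_algebraD[OF N] by auto
  have "(-1) *\<^sub>C v = - v" for v :: 'k
    by (metis of_real_1 of_real_minus scaleR_minus1_left scaleR_scaleC)
  then show "\<Lambda> (x + scaleC_op (-1) y) = \<Lambda> x - \<Lambda> y"
    using assms von_neumann_algebraD[OF N] by (simp add: L2D)
qed

lemma left_mult_ex:
  assumes x: "x \<in> N"
  shows "\<exists>T \<in> cops. norm T \<le> norm x \<and> (\<forall>y\<in>N. blinfun_apply T (\<Lambda> y) = \<Lambda> (x o\<^sub>L y))"
proof -
  note [simp] = von_neumann_algebraD(2-)[OF N]
  define g where "g v = \<Lambda> (x o\<^sub>L (SOME y. y \<in> N \<and> \<Lambda> y = v))" for v
  have dist: "norm (\<Lambda> (x o\<^sub>L y) - \<Lambda> (x o\<^sub>L z)) \<le> norm x * norm (\<Lambda> y - \<Lambda> z)"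
    if "y \<in> N" "z \<in> N" for y z
  proof -
    have "x o\<^sub>L (y + scaleC_op (-1) z) = (x o\<^sub>L y) + scaleC_op (-1) (x o\<^sub>L z)"
      using copsD[OF subsetD[OF von_neumann_algebraD(1)[OF N] x]]
      by (simp add: blinfun_eq_iff blinfun.add_left blinfun.add_right scaleC_op.rep_eq)
    then show ?thesis
      using norm_L2_mult[OF x L2_diff(1)[OF that]] L2_diff(2)[OF that]
        L2_diff(2)[of "x o\<^sub>L y" "x o\<^sub>L z"] x that by simp
  qed
  have g: "g (\<Lambda> y) = \<Lambda> (x o\<^sub>L y)" if "y \<in> N" for y
  proof -
    have s: "(SOME z. z \<in> N \<and> \<Lambda> z = \<Lambda> y) \<in> N \<and> \<Lambda> (SOME z. z \<in> N \<and> \<Lambda> z = \<Lambda> y) = \<Lambda> y"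
      by (rule someI[of _ y]) (use that in simp)
    show ?thesis using dist[of "SOME z. z \<in> N \<and> \<Lambda> z = \<Lambda> y" y] s that by (simp add: g_def)
  qed
  have "uniformly_continuous_on (\<Lambda> ` N) g"
    unfolding uniformly_continuous_on_def
  proof (intro allI impI)
    fix e :: real assume e: "e > 0"
    show "\<exists>d>0. \<forall>v\<in>\<Lambda> ` N. \<forall>w\<in>\<Lambda> ` N. dist w v < d \<longrightarrow> dist (g w) (g v) < e"
    proof (intro exI[of _ "e / (norm x + 1)"] conjI ballI impI)
      show "e / (norm x + 1) > 0" using e by (simp add: add_nonneg_pos)
      fix v w assume "v \<in> \<Lambda> ` N" "w \<in> \<Lambda> ` N" and d: "dist w v < e / (norm x + 1)"
      then have "dist (g w) (g v) \<le> norm x * dist w v" using dist by (auto simp: g dist_norm)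
      also have "\<dots> \<le> (norm x + 1) * dist w v" by (intro mult_right_mono) auto
      also have "\<dots> < e" using d by (simp add: pos_less_divide_eq add_nonneg_pos mult.commute)
      finally show "dist (g w) (g v) < e" .
    qed
  qed
  then obtain h where h: "uniformly_continuous_on (closure (\<Lambda> ` N)) h" "\<And>v. v \<in> \<Lambda> ` N \<Longrightarrow> g v = h v"
    by (rule uniformly_continuous_on_extension_on_closure) metis
  have cont: "continuous_on UNIV h" using h(1) L2D(4) uniformly_continuous_imp_continuous by metis
  have hL: "h (\<Lambda> y) = \<Lambda> (x o\<^sub>L y)" if "y \<in> N" for y using g h(2) that by simp
  have ind: "P v" if "closed {v. P v}" "\<And>y. y \<in> N \<Longrightarrow> P (\<Lambda> y)" for P and v :: 'k
    using closure_minimal[of "\<Lambda> ` N" "{v. P v}"] that L2D(4) by auto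
  have hc: "continuous_on UNIV (\<lambda>v. h (f v))" if "continuous_on UNIV f" for f :: "'k \<Rightarrow> 'k"
    by (rule continuous_on_compose2[OF cont that]) simp
  have comp: "x o\<^sub>L (y + z) = (x o\<^sub>L y) + (x o\<^sub>L z)" for y z
    by (simp add: blinfun_eq_iff blinfun.add_left blinfun.add_right)
  have compC: "x o\<^sub>L scaleC_op c y = scaleC_op c (x o\<^sub>L y)" for c y
    using copsD[OF subsetD[OF von_neumann_algebraD(1)[OF N] x]]
    by (simp add: blinfun_eq_iff scaleC_op.rep_eq)
  have add: "h (v + w) = h v + h w" for v w
  proof (rule ind[of "\<lambda>v. h (v + w) = h v + h w"])
    show "closed {v. h (v + w) = h v + h w}"
      by (intro closed_Collect_eq continuous_intros hc cont)
    fix y assume y: "y \<in> N"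
    show "h (\<Lambda> y + w) = h (\<Lambda> y) + h w"
    proof (rule ind[of "\<lambda>w. h (\<Lambda> y + w) = h (\<Lambda> y) + h w"])
      show "closed {w. h (\<Lambda> y + w) = h (\<Lambda> y) + h w}"
        by (intro closed_Collect_eq continuous_intros hc cont)
      fix z assume z: "z \<in> N"
      show "h (\<Lambda> y + \<Lambda> z) = h (\<Lambda> y) + h (\<Lambda> z)"
        using hL[of "y + z"] x y z by (simp add: L2D hL comp)
    qed
  qed
  have contC: "continuous_on UNIV (\<lambda>v::'k. c *\<^sub>C f v)" if "continuous_on UNIV f" for c and f :: "'k \<Rightarrow> 'k"
    using bounded_linear.continuous_on[OF bounded_linear_scaleC that] .
  have scC: "h (c *\<^sub>C v) = c *\<^sub>C h v" for c v
  proof (rule ind[of "\<lambda>v. h (c *\<^sub>C v) = c *\<^sub>C h v"])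
    show "closed {v. h (c *\<^sub>C v) = c *\<^sub>C h v}"
      by (intro closed_Collect_eq hc contC cont continuous_on_id)
    show "h (c *\<^sub>C \<Lambda> y) = c *\<^sub>C h (\<Lambda> y)" if "y \<in> N" for y
      using hL[of "scaleC_op c y"] x that by (simp add: L2D hL compC)
  qed
  have bnd: "norm (h v) \<le> norm x * norm v" for v
  proof (rule ind[of "\<lambda>v. norm (h v) \<le> norm x * norm v"])
    show "closed {v. norm (h v) \<le> norm x * norm v}"
      by (intro closed_Collect_le continuous_intros cont)
    show "norm (h (\<Lambda> y)) \<le> norm x * norm (\<Lambda> y)" if "y \<in> N" for y
      using norm_L2_mult[OF x that] hL[OF that] by simp
  qed
  have bl: "bounded_linear h"
  proof (rule bounded_linear_intro[where K = "norm x"])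
    show "norm (h v) \<le> norm v * norm x" for v using bnd[of v] by (simp add: mult.commute)
  qed (simp_all add: add scC scaleR_scaleC)
  show ?thesis
  proof (intro bexI[of _ "Blinfun h"] conjI ballI)
    show "norm (Blinfun h) \<le> norm x"
      by (rule norm_blinfun_bound) (auto simp: bounded_linear_Blinfun_apply[OF bl] bnd)
    show "Blinfun h \<in> cops" by (simp add: cops_def bounded_linear_Blinfun_apply[OF bl] scC)
  qed (simp add: bounded_linear_Blinfun_apply[OF bl] hL)
qed

lemma left_mult_unique:
  fixes S T :: "'k \<Rightarrow>\<^sub>L 'k"
  assumes "\<And>y. y \<in> N \<Longrightarrow> S (\<Lambda> y) = T (\<Lambda> y)"
  shows "S = T"
proof (rule blinfun_eqI)
  have "closed {v. S v = T v}" by (intro closed_Collect_eq continuous_intros)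
  then have "closure (\<Lambda> ` N) \<subseteq> {v. S v = T v}" by (intro closure_minimal) (auto simp: assms)
  then show "S v = T v" for v using L2D(4) by auto
qed

lemma left_mult:
  assumes x: "x \<in> N"
  shows "left_mult N \<Lambda> x \<in> cops" "norm (left_mult N \<Lambda> x) \<le> norm x"
    "\<And>y. y \<in> N \<Longrightarrow> left_mult N \<Lambda> x (\<Lambda> y) = \<Lambda> (x o\<^sub>L y)"
proof -
  obtain T where T: "T \<in> cops" "norm T \<le> norm x" "\<forall>y\<in>N. blinfun_apply T (\<Lambda> y) = \<Lambda> (x o\<^sub>L y)"
    using left_mult_ex[OF x] by blast
  have "left_mult N \<Lambda> x = T"
    unfolding left_mult_def by (rule the_equality) (use T in \<open>auto intro: left_mult_unique\<close>)
  then show "left_mult N \<Lambda> x \<in> cops" "norm (left_mult N \<Lambda> x) \<le> norm x"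
    "\<And>y. y \<in> N \<Longrightarrow> left_mult N \<Lambda> x (\<Lambda> y) = \<Lambda> (x o\<^sub>L y)" using T by auto
qed


context
  fixes \<theta> :: "('a \<Rightarrow>\<^sub>L 'a) \<Rightarrow> ('a \<Rightarrow>\<^sub>L 'a)"
  assumes \<theta>: "star_automorphism N \<theta>" and \<theta>tr: "trace_preserving N tr \<theta>"
begin

lemma norm_L2_automorphism: assumes "x \<in> N" shows "norm (\<Lambda> (\<theta> x)) = norm (\<Lambda> x)"
proof -
  have N': "\<theta> x \<in> N" using \<theta> assms by (auto simp: star_automorphism_def bij_betw_def)
  have "adj (\<theta> x) o\<^sub>L \<theta> x = \<theta> (adj x o\<^sub>L x)"
    using \<theta> assms von_neumann_algebraD[OF N] by (auto simp: star_automorphism_def)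
  then have "cinner (\<Lambda> (\<theta> x)) (\<Lambda> (\<theta> x)) = cinner (\<Lambda> x) (\<Lambda> x)"
    using \<theta>tr assms N' von_neumann_algebraD[OF N] by (simp add: L2D trace_preserving_def)
  then have "(norm (\<Lambda> (\<theta> x)))\<^sup>2 = (norm (\<Lambda> x))\<^sup>2" by (simp add: cinner_self flip: of_real_power)
  then show ?thesis by (simp add: power2_eq_iff_nonneg)
qed

lemma aut_power:
  "bij_betw (aut_power N \<theta> n) N N \<and>
   (\<forall>x\<in>N. \<forall>y\<in>N. aut_power N \<theta> n (x o\<^sub>L y) = aut_power N \<theta> n x o\<^sub>L aut_power N \<theta> n y) \<and>
   (\<forall>x\<in>N. norm (\<Lambda> (aut_power N \<theta> n x)) = norm (\<Lambda> x))"
proof -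
  define good where "good \<sigma> \<longleftrightarrow> bij_betw \<sigma> N N \<and>
     (\<forall>x\<in>N. \<forall>y\<in>N. \<sigma> (x o\<^sub>L y) = \<sigma> x o\<^sub>L \<sigma> y) \<and> (\<forall>x\<in>N. norm (\<Lambda> (\<sigma> x)) = norm (\<Lambda> x))" for \<sigma>
  have pow: "good (\<sigma> ^^ k)" if \<sigma>: "good \<sigma>" for \<sigma> k
  proof (induction k)
    case 0
    show ?case by (simp add: good_def bij_betw_def)
  next
    case (Suc k)
    have "bij_betw (\<sigma> \<circ> (\<sigma> ^^ k)) N N"
      using bij_betw_trans[of "\<sigma> ^^ k" N N \<sigma> N] Suc \<sigma> by (simp add: good_def)
    moreover have "(\<sigma> ^^ k) x \<in> N" if "x \<in> N" for x
      using Suc that by (auto simp: good_def bij_betw_def)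
    ultimately show ?case using Suc \<sigma> by (simp add: good_def o_def)
  qed
  have g: "good \<theta>"
    using \<theta> norm_L2_automorphism by (simp add: good_def star_automorphism_def)
  have inv: "bij_betw (inv_into N \<theta>) N N" using g by (simp add: good_def bij_betw_inv_into)
  have r: "\<theta> (inv_into N \<theta> x) = x" if "x \<in> N" for x
    using g that by (metis good_def bij_betw_inv_into_right)
  have l: "inv_into N \<theta> (\<theta> x) = x" if "x \<in> N" for x
    using g that by (metis good_def bij_betw_inv_into_left)
  have m: "inv_into N \<theta> x \<in> N" if "x \<in> N" for x using inv that by (auto simp: bij_betw_def)
  have "good (inv_into N \<theta>)"
    unfolding good_def
  proof (intro conjI ballI)
    show "bij_betw (inv_into N \<theta>) N N" by (rule inv)
    fix x assume x: "x \<in> N"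
    show "norm (\<Lambda> (inv_into N \<theta> x)) = norm (\<Lambda> x)"
      using norm_L2_automorphism[OF m[OF x]] r[OF x] by simp
    fix y assume y: "y \<in> N"
    have "\<theta> (inv_into N \<theta> x o\<^sub>L inv_into N \<theta> y) = x o\<^sub>L y"
      using g m[OF x] m[OF y] r[OF x] r[OF y] by (simp add: good_def)
    then show "inv_into N \<theta> (x o\<^sub>L y) = inv_into N \<theta> x o\<^sub>L inv_into N \<theta> y"
      using l m[OF x] m[OF y] von_neumann_algebraD(4)[OF N] by metis
  qed
  then have "good (aut_power N \<theta> n)" using pow[OF g] pow by (simp add: aut_power_def)
  then show ?thesis by (simp add: good_def)
qed

lemma aut_power_mem: "x \<in> N \<Longrightarrow> aut_power N \<theta> n x \<in> N"
  using aut_power[of n] by (auto simp: bij_betw_def)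

lemma aut_power_shift: assumes x: "x \<in> N" shows "aut_power N \<theta> n (\<theta> x) = aut_power N \<theta> (n + 1) x"
proof (cases "n \<ge> 0")
  case True
  then have "nat (n + 1) = Suc (nat n)" by simp
  then show ?thesis using True by (simp only: aut_power_def funpow_Suc_right) simp
next
  case False
  define k where "k = nat (- n - 1)"
  have k: "nat (- n) = Suc k" "nat (- (n + 1)) = k" "n + 1 \<ge> 0 \<Longrightarrow> k = 0 \<and> nat (n + 1) = 0"
    using False by (auto simp: k_def)
  have "inv_into N \<theta> (\<theta> x) = x"
    using \<theta> x by (metis star_automorphism_def bij_betw_inv_into_left)
  then show ?thesis using False k by (auto simp: aut_power_def funpow_Suc_right simp del: funpow.simps)
qed

lemma norm_left_mult_aut_power:
  assumes x: "x \<in> N"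
  shows "norm (left_mult N \<Lambda> (aut_power N \<theta> n x) v) \<le> norm x * norm v"
proof -
  let ?T = "left_mult N \<Lambda> (aut_power N \<theta> n x)"
  have "closed {v. norm (?T v) \<le> norm x * norm v}" by (intro closed_Collect_le continuous_intros)
  moreover have "\<Lambda> ` N \<subseteq> {v. norm (?T v) \<le> norm x * norm v}"
  proof clarify
    fix y assume y: "y \<in> N"
    then have "y \<in> aut_power N \<theta> n ` N" using aut_power[of n] by (simp add: bij_betw_def)
    then obtain z where z: "z \<in> N" "y = aut_power N \<theta> n z" by blast
    have "aut_power N \<theta> n x o\<^sub>L y = aut_power N \<theta> n (x o\<^sub>L z)" using aut_power[of n] x z by simp
    then have "?T (\<Lambda> y) = \<Lambda> (aut_power N \<theta> n (x o\<^sub>L z))"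
      using left_mult(3)[OF aut_power_mem[OF x] y] by simp
    moreover have "norm (\<Lambda> (aut_power N \<theta> n (x o\<^sub>L z))) = norm (\<Lambda> (x o\<^sub>L z))"
      using aut_power[of n] x z von_neumann_algebraD(4)[OF N] by blast
    ultimately have "norm (?T (\<Lambda> y)) = norm (\<Lambda> (x o\<^sub>L z))" by (simp only:)
    also have "\<dots> \<le> norm x * norm (\<Lambda> z)" by (rule norm_L2_mult[OF x z(1)])
    finally show "norm (?T (\<Lambda> y)) \<le> norm x * norm (\<Lambda> y)" using aut_power[of n] z by simp
  qed
  ultimately show ?thesis using closure_minimal[of "\<Lambda> ` N"] L2D(4) by blast
qed

lemma coord_crossed_rep:
  assumes x: "x \<in> N"
  shows "coord (crossed_rep N \<theta> \<Lambda> x \<xi>) n = left_mult N \<Lambda> (aut_power N \<theta> (- n) x) (coord \<xi> n)"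
proof -
  let ?T = "\<lambda>n. left_mult N \<Lambda> (aut_power N \<theta> (- n) x)"
  define g where "g \<xi> = Abs_ell2Z (\<lambda>n. ?T n (coord \<xi> n))" for \<xi>
  have le: "(norm (?T n (coord \<xi> n)))\<^sup>2 \<le> (norm x)\<^sup>2 * (norm (coord \<xi> n))\<^sup>2" for \<xi> n
    using power_mono[OF norm_left_mult_aut_power[OF x, of "- n" "coord \<xi> n"], of 2]
    by (simp add: power_mult_distrib)
  have s: "(\<lambda>n. (norm (?T n (coord \<xi> n)))\<^sup>2) summable_on UNIV" for \<xi>
    by (rule summable_on_comparison_test[OF summable_on_cmult_right[OF coord_summable[of \<xi>], of "(norm x)\<^sup>2"]])
       (auto intro: le)
  have g: "coord (g \<xi>) n = ?T n (coord \<xi> n)" for \<xi> n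
    using s[of \<xi>] by (simp add: g_def Abs_ell2Z_inverse)
  have "bounded_linear g"
  proof (rule bounded_linear_intro[where K = "norm x"])
    show "g (a + b) = g a + g b" for a b by (rule coord_inject_ext) (simp add: g blinfun.add_right)
    show "g (r *\<^sub>R a) = r *\<^sub>R g a" for r a by (rule coord_inject_ext) (simp add: g blinfun.scaleR_right)
    fix \<xi>
    have "(norm (g \<xi>))\<^sup>2 \<le> (\<Sum>\<^sub>\<infinity>n. (norm x)\<^sup>2 * (norm (coord \<xi> n))\<^sup>2)"
      unfolding norm_ell2Z_square g
      by (rule infsum_mono[OF s summable_on_cmult_right[OF coord_summable]]) (rule le)
    also have "\<dots> = (norm \<xi> * norm x)\<^sup>2"
      by (simp add: infsum_cmult_right' norm_ell2Z_square power_mult_distrib mult.commute)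
    finally show "norm (g \<xi>) \<le> norm \<xi> * norm x" by (rule power2_le_imp_le) simp
  qed
  then have "crossed_rep N \<theta> \<Lambda> x \<xi> = g \<xi>"
    unfolding crossed_rep_def g_def by (rule bounded_linear_Blinfun_apply[THEN fun_cong])
  then show ?thesis by (simp add: g)
qed

lemma crossed_covariance:
  assumes x: "x \<in> N"
  shows "crossed_unitary o\<^sub>L crossed_rep N \<theta> \<Lambda> x = crossed_rep N \<theta> \<Lambda> (\<theta> x) o\<^sub>L crossed_unitary"
proof -
  have \<theta>x: "\<theta> x \<in> N" using \<theta> x by (auto simp: star_automorphism_def bij_betw_def)
  show ?thesis
  proof (rule blinfun_eqI, rule coord_inject_ext)
    fix \<xi> n
    show "coord ((crossed_unitary o\<^sub>L crossed_rep N \<theta> \<Lambda> x) \<xi>) n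
        = coord ((crossed_rep N \<theta> \<Lambda> (\<theta> x) o\<^sub>L crossed_unitary) \<xi>) n"
      by (simp add: crossed_unitary.rep_eq shift.rep_eq coord_crossed_rep x \<theta>x aut_power_shift)
  qed
qed

lemma crossed_unitary_delta: "crossed_unitary (delta m v) = delta (m + 1) (v :: 'k)"
  by (rule coord_inject_ext) (auto simp: crossed_unitary.rep_eq shift.rep_eq delta.rep_eq)

lemma cinner_delta: "cinner (delta 0 v) \<xi> = cinner v (coord \<xi> 0)" for v :: 'k
proof -
  have [simp]: "cinner 0 w = 0" for w :: 'k using cinner_add_left[of 0 0 w] by simp
  have "cinner (delta 0 v) \<xi> = (\<Sum>\<^sub>\<infinity>n\<in>{0}. cinner (coord (delta 0 v) n) (coord \<xi> n))"
    unfolding cinner_ell2Z_def by (rule infsum_cong_neutral) (auto simp: delta.rep_eq)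
  then show ?thesis by (simp add: delta.rep_eq)
qed

text \<open>Here \<open>\<delta>\<^sub>n \<otimes> \<Lambda>(1) = u\<^sup>n (\<delta>\<^sub>0 \<otimes> \<Lambda>(1))\<close>, and the series \<open>T = \<Sum>\<^sub>n \<pi>(x\<^sub>n) u\<^sup>n\<close> is taken in \<open>\<parallel>\<cdot>\<parallel>\<^sub>2\<close>, that is,
  after applying both sides to \<open>\<delta>\<^sub>0 \<otimes> \<Lambda>(1)\<close>.\<close>

lemma crossed_trace_Fourier:
  assumes x: "\<And>n. x n \<in> N"
    and T: "((\<lambda>n. crossed_rep N \<theta> \<Lambda> (x n) (delta n (\<Lambda> id_blinfun)))
              has_sum blinfun_apply T (delta 0 (\<Lambda> id_blinfun))) UNIV"
  shows "crossed_trace \<Lambda> T = tr (x 0)"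
proof -
  note id = von_neumann_algebraD(3)[OF N]
  have "((\<lambda>n. coord (crossed_rep N \<theta> \<Lambda> (x n) (delta n (\<Lambda> id_blinfun))) 0)
      has_sum coord (T (delta 0 (\<Lambda> id_blinfun))) 0) UNIV"
    using has_sum_bounded_linear[OF bounded_linear_coord T, of 0] by (simp add: o_def)
  moreover have "(\<lambda>n. coord (crossed_rep N \<theta> \<Lambda> (x n) (delta n (\<Lambda> id_blinfun))) 0)
      = (\<lambda>n. if n = 0 then \<Lambda> (x 0) else 0)"
  proof
    have "x 0 o\<^sub>L id_blinfun = x 0" by (simp add: blinfun_eq_iff)
    then show "coord (crossed_rep N \<theta> \<Lambda> (x n) (delta n (\<Lambda> id_blinfun))) 0
        = (if n = 0 then \<Lambda> (x 0) else 0)" for n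
      using left_mult(3)[OF x id, of 0] by (simp add: coord_crossed_rep x delta.rep_eq aut_power_def)
  qed
  ultimately have "((\<lambda>n::int. if n = 0 then \<Lambda> (x 0) else 0) has_sum coord (T (delta 0 (\<Lambda> id_blinfun))) 0) UNIV"
    by simp
  moreover have "((\<lambda>n. if n = 0 then \<Lambda> (x 0) else 0) has_sum \<Lambda> (x 0)) (UNIV :: int set)"
    using has_sum_finite[of "{0::int}" "\<lambda>n. \<Lambda> (x 0)"]
    by (subst has_sum_cong_neutral[where T = "{0}" and g = "\<lambda>n. \<Lambda> (x 0)"]) auto
  ultimately have "coord (T (delta 0 (\<Lambda> id_blinfun))) 0 = \<Lambda> (x 0)" by (rule has_sum_unique)
  then have "crossed_trace \<Lambda> T = cinner (\<Lambda> id_blinfun) (\<Lambda> (x 0))"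
    by (simp add: crossed_trace_def cinner_delta)
  also have "\<dots> = tr (id_blinfun o\<^sub>L x 0)" by (simp add: L2D id x adj_id)
  also have "id_blinfun o\<^sub>L x 0 = x 0" by (simp add: blinfun_eq_iff)
  finally show ?thesis .
qed

end

end

end

theory Submission
  imports Defs
begin

text \<open>
  Write \<open>\<Omega> = \<delta>\<^sub>0 \<otimes> \<Lambda>(1)\<close> and let \<open>Q\<close> be the projection onto \<open>\<ell>\<^sup>2(\<int>) \<otimes> \<complex>\<Lambda>(1)\<close>. Right multiplications lie
  in \<open>M'\<close> and move \<open>\<Omega>\<close> to a total set, so elements of \<open>M\<close> are determined by their value at \<open>\<Omega>\<close>, and
  strong convergence of a bounded sequence in \<open>M\<close> can be tested at \<open>\<Omega>\<close>. There, conjugation by \<open>u\<^sup>k\<close>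
  acts as \<open>1 \<otimes> W\<^sup>k\<close> with \<open>W \<Lambda>(y) = \<Lambda>(\<theta>(y))\<close>, and weak mixing makes the Cesaro means of these operators
  converge strongly to \<open>Q\<close>. Hence the means of \<open>u\<^sup>k T u\<^sup>-\<^sup>k\<close> converge strongly to some \<open>E T\<close> in \<open>M\<close> with
  \<open>E T \<Omega> = Q T \<Omega>\<close>; this says that \<open>E T\<close> is a Laurent operator with scalar coefficients, thus in \<open>B\<close>.
  So \<open>M \<inter> {u}' = B\<close>, which is the masa property, and \<open>E\<close> is the conditional expectation onto \<open>B\<close>.

  For a unitary \<open>w\<close> in \<open>M\<close>, testing the difference of the two expectations at \<open>x = u\<^sup>k\<close> gives
  \<open>\<parallel>\<cdot>\<parallel>\<^sub>2\<^sup>2 = 1 - \<parallel>Q w\<^sup>* u\<^sup>k w \<Omega>\<parallel>\<^sup>2\<close>. Split \<open>w \<Omega> = Q w \<Omega> + \<zeta>\<close>. The first part contributes at most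
  \<open>\<parallel>Q w \<Omega>\<parallel>\<close> to \<open>\<parallel>Q w\<^sup>* u\<^sup>k w \<Omega>\<parallel>\<close>, and weak mixing makes \<open>\<parallel>Q w\<^sup>* u\<^sup>k \<zeta>\<parallel>\<close> tend to \<open>0\<close> in Cesaro mean, so it
  is arbitrarily small for some \<open>k\<close>. Therefore the supremum is at least
  \<open>(1 - \<parallel>Q w \<Omega>\<parallel>\<^sup>2)\<^sup>1\<^sup>/\<^sup>2 = \<parallel>w - E w\<parallel>\<^sub>2\<close>.
\<close>

section \<open>Elementary facts on inner products, adjoints and commutants\<close>

lemma scaleC_minus1: "(-1) *\<^sub>C x = - x" for x :: "'a::chilbert_space"
  by (metis of_real_1 of_real_minus scaleR_minus1_left scaleR_scaleC)

lemma bounded_linear_cinner_right: "bounded_linear (cinner x)" for x :: "'a::chilbert_space"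
  by (rule bounded_linear_intro[where K = "norm x"])
     (simp_all add: cinner_add_right scaleR_scaleC cinner_scaleC_right cmod_cinner_le scaleR_conv_of_real
        mult.commute[of "norm _" "norm x"])

lemma bounded_linear_cinner_left: "bounded_linear (\<lambda>x. cinner x y)" for y :: "'a::chilbert_space"
  by (rule bounded_linear_intro[where K = "norm y"])
     (simp_all add: cinner_add_left scaleR_scaleC cinner_scaleC_left cmod_cinner_le scaleR_conv_of_real)

lemmas cinner_simps =
  linear_0[OF bounded_linear.linear[OF bounded_linear_cinner_right]]
  linear_0[OF bounded_linear.linear[OF bounded_linear_cinner_left]]
  linear_diff[OF bounded_linear.linear[OF bounded_linear_cinner_right]]
  linear_diff[OF bounded_linear.linear[OF bounded_linear_cinner_left]]
  cinner_add_left cinner_add_right cinner_scaleC_left cinner_scaleC_right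

text \<open>Reduces differences to sums and complex multiples, the operations covered by
  \<open>von_neumann_algebraD\<close>.\<close>

lemma minus_op_eq: "S - T = S + scaleC_op (-1) T"
  by (simp add: blinfun_eq_iff scaleC_op.rep_eq scaleC_minus1 blinfun.add_left blinfun.diff_left)

lemma blinfun_compose_assoc: "(R o\<^sub>L S) o\<^sub>L T = R o\<^sub>L (S o\<^sub>L T)"
  by (simp add: blinfun_eq_iff)

lemma blinfun_compose_id [simp]: "T o\<^sub>L id_blinfun = T" "id_blinfun o\<^sub>L T = T"
  by (simp_all add: blinfun_eq_iff)

lemma adj_adjoint': "T \<in> cops \<Longrightarrow> cinner (adj T x) y = cinner x (blinfun_apply T y)"
  by (metis adj_adjoint cinner_commute)

lemma adj_adj: "T \<in> cops \<Longrightarrow> adj (adj T) = T"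
  by (rule adj_unique) (simp_all add: cops_adj adj_adjoint')

lemma adj_add: "S \<in> cops \<Longrightarrow> T \<in> cops \<Longrightarrow> adj (S + T) = adj S + adj T"
  by (rule adj_unique) (simp_all add: cops_add adj_adjoint blinfun.add_left cinner_simps)

lemma adj_scaleC: "T \<in> cops \<Longrightarrow> adj (scaleC_op c T) = scaleC_op (cnj c) (adj T)"
  by (rule adj_unique) (simp_all add: cops_scaleC adj_adjoint scaleC_op.rep_eq cinner_simps)

lemma commutant_subset_cops: "commutant S \<subseteq> cops"
  by (auto simp: commutant_def)

lemma commutant_antimono: "S \<subseteq> T \<Longrightarrow> commutant T \<subseteq> commutant S"
  by (auto simp: commutant_def)

lemma commutant_apply:
  "T \<in> commutant S \<Longrightarrow> R \<in> S \<Longrightarrow> blinfun_apply T (blinfun_apply R x) = blinfun_apply R (blinfun_apply T x)"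
  by (auto simp: commutant_def blinfun_eq_iff)

lemma subset_double_commutant: "S \<subseteq> cops \<Longrightarrow> S \<subseteq> commutant (commutant S)"
  by (auto simp: commutant_def)

lemma triple_commutant: "S \<subseteq> cops \<Longrightarrow> commutant (commutant (commutant S)) = commutant S"
  by (meson commutant_antimono commutant_subset_cops subset_antisym subset_double_commutant)

text \<open>Taking adjoints in \<open>T o\<^sub>L adj s = adj s o\<^sub>L T\<close> gives the
  relation between \<open>adj T\<close> and \<open>s\<close>.\<close>

lemma commutant_adj:
  assumes S: "S \<subseteq> cops" "\<And>s. s \<in> S \<Longrightarrow> adj s \<in> S" and T: "T \<in> commutant S"
  shows "adj T \<in> commutant S"
proof -
  have Tc: "T \<in> cops" using T by (simp add: commutant_def)
  have "adj T o\<^sub>L s = s o\<^sub>L adj T" if s: "s \<in> S" for s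
  proof -
    have "adj (T o\<^sub>L adj s) = adj (adj s o\<^sub>L T)" using T S(2)[OF s] by (auto simp: commutant_def)
    then show ?thesis using S(1) s Tc by (simp add: adj_compose cops_adj adj_adj subset_iff)
  qed
  then show ?thesis using Tc by (simp add: commutant_def cops_adj)
qed

text \<open>The set \<open>?S\<close> is self-adjoint by construction, hence so are its commutant
  and bicommutant; being a commutant, the latter is its own bicommutant by
  \<open>triple_commutant\<close>.\<close>

lemma vn_generated:
  assumes S: "S \<subseteq> cops"
  shows "von_neumann_algebra (vn_generated S)" "S \<subseteq> vn_generated S"
proof -
  let ?S = "S \<union> adj ` S"
  have c: "?S \<subseteq> cops" using S cops_adj by blast
  have a: "adj s \<in> ?S" if "s \<in> ?S" for s using that S by (auto simp: adj_adj subset_iff)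
  have a': "adj s \<in> commutant ?S" if "s \<in> commutant ?S" for s
    by (rule commutant_adj[OF c a that])
  show "S \<subseteq> vn_generated S"
    using subset_double_commutant[OF c] by (auto simp: vn_generated_def)
  show "von_neumann_algebra (vn_generated S)"
    unfolding von_neumann_algebra_def vn_generated_def
    using commutant_adj[OF commutant_subset_cops a'] triple_commutant[OF commutant_subset_cops]
    by (simp add: commutant_subset_cops)
qed

lemma vn_generated_mono: "S \<subseteq> T \<Longrightarrow> vn_generated S \<subseteq> vn_generated T"
  unfolding vn_generated_def by (intro commutant_antimono) auto

lemma star_subalgebraI:
  assumes A: "von_neumann_algebra A" and AM: "A \<subseteq> M"
  shows "star_subalgebra A M"
proof -
  have "0 = scaleC_op 0 (id_blinfun :: 'a \<Rightarrow>\<^sub>L 'a)"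
    by (simp add: blinfun_eq_iff scaleC_op.rep_eq) (metis of_real_0 scaleR_scaleC scaleR_zero_left)
  then have "0 \<in> A" using von_neumann_algebraD(3,6)[OF A] by metis
  then show ?thesis
    using von_neumann_algebraD[OF A] AM by (auto simp: star_subalgebra_def)
qed

lemma star_subalgebra_diff:
  "star_subalgebra A M \<Longrightarrow> a \<in> A \<Longrightarrow> b \<in> A \<Longrightarrow> a - b \<in> A"
  unfolding minus_op_eq by (auto simp: star_subalgebra_def)

lemma unitary_norm:
  assumes "unitary_op w"
  shows "norm (blinfun_apply w x) = norm x"
proof -
  have e: "adj w o\<^sub>L w = id_blinfun" and c: "w \<in> cops" using assms by (simp_all add: unitary_op_def)
  have "adj w (w x) = x" using arg_cong[OF e, of "\<lambda>T. blinfun_apply T x"] by simp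
  then have "cinner (w x) (w x) = cinner x x" by (simp add: adj_adjoint[OF c])
  then have "(norm (w x))\<^sup>2 = (norm x)\<^sup>2" by (simp only: cinner_self of_real_eq_iff)
  then show ?thesis by (simp add: power2_eq_iff_nonneg)
qed

section \<open>Block-shift operators\<close>

lemma coord_scaleC [simp]: "coord (c *\<^sub>C f) n = c *\<^sub>C coord f n"
  by (simp add: scaleC_ell2Z.rep_eq)

lemma coord_sum: "coord (sum f F) n = (\<Sum>i\<in>F. coord (f i) n)"
  by (induction F rule: infinite_finite_induct) auto

lemma coord_delta [simp]: "coord (delta m v) n = (if n = m then v else 0)"
  by (simp add: delta.rep_eq)

lemma square_summable_translate:
  fixes f :: "int \<Rightarrow> 'k::real_normed_vector"
  assumes "(\<lambda>n. (norm (f n))\<^sup>2) summable_on UNIV"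
  shows "(\<lambda>n. (norm (f (n - m)))\<^sup>2) summable_on UNIV"
    "(\<Sum>\<^sub>\<infinity>n. (norm (f (n - m)))\<^sup>2) = (\<Sum>\<^sub>\<infinity>n. (norm (f n))\<^sup>2)"
proof -
  have b: "bij_betw (\<lambda>n. n - m) UNIV UNIV"
    by (rule bij_betw_byWitness[where f' = "\<lambda>n. n + m"]; simp)
  show "(\<lambda>n. (norm (f (n - m)))\<^sup>2) summable_on UNIV"
    using summable_on_reindex_bij_betw[OF b, of "\<lambda>n. (norm (f n))\<^sup>2"] assms by simp
  show "(\<Sum>\<^sub>\<infinity>n. (norm (f (n - m)))\<^sup>2) = (\<Sum>\<^sub>\<infinity>n. (norm (f n))\<^sup>2)"
    using infsum_reindex_bij_betw[OF b, of "\<lambda>n. (norm (f n))\<^sup>2"] by simp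
qed

lemma norm_blinfun_square_le: "(norm (blinfun_apply T x))\<^sup>2 \<le> (norm T)\<^sup>2 * (norm x)\<^sup>2"
  using power_mono[OF norm_blinfun[of T x], of 2] by (simp add: power_mult_distrib)

text \<open>This is the \<open>m\<close>-th power of the bilateral shift tensored with
  \<open>T\<close>. One family covers the powers of \<open>u\<close> (\<open>T\<close> the
  identity), the projection \<open>Q\<close> (\<open>m = 0\<close>) and the right multiplications,
  with a common calculus.\<close>

lift_definition amp_fun :: "int \<Rightarrow> ('k::real_inner \<Rightarrow>\<^sub>L 'k) \<Rightarrow> 'k ell2Z \<Rightarrow> 'k ell2Z"
  is "\<lambda>m T f n. blinfun_apply T (f (n - m))"
proof -
  fix m and T :: "'k \<Rightarrow>\<^sub>L 'k" and f :: "int \<Rightarrow> 'k"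
  assume "(\<lambda>n. (norm (f n))\<^sup>2) summable_on UNIV"
  then show "(\<lambda>n. (norm (blinfun_apply T (f (n - m))))\<^sup>2) summable_on UNIV"
    by (rule summable_on_comparison_test[OF
          summable_on_cmult_right[OF square_summable_translate(1), of f "(norm T)\<^sup>2" m]])
       (auto simp: norm_blinfun_square_le)
qed

lemma norm_amp_fun: "norm (amp_fun m T f) \<le> norm f * norm T"
proof (rule power2_le_imp_le)
  have "(norm (amp_fun m T f))\<^sup>2 \<le> (\<Sum>\<^sub>\<infinity>n. (norm T)\<^sup>2 * (norm (coord f (n - m)))\<^sup>2)"
    using coord_summable[of "amp_fun m T f"] unfolding norm_ell2Z_square amp_fun.rep_eq
    by (intro infsum_mono summable_on_cmult_right[OF square_summable_translate(1)[OF coord_summable]])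
       (auto simp: norm_blinfun_square_le)
  also have "\<dots> = (norm f * norm T)\<^sup>2"
    using square_summable_translate(2)[OF coord_summable[of f], of m]
    by (simp add: infsum_cmult_right' norm_ell2Z_square power_mult_distrib mult.commute)
  finally show "(norm (amp_fun m T f))\<^sup>2 \<le> (norm f * norm T)\<^sup>2" .
qed simp

lift_definition amp :: "int \<Rightarrow> ('k::real_inner \<Rightarrow>\<^sub>L 'k) \<Rightarrow> 'k ell2Z \<Rightarrow>\<^sub>L 'k ell2Z" is amp_fun
  by (rule bounded_linear_intro[OF _ _ norm_amp_fun])
     (auto intro!: coord_inject_ext simp: amp_fun.rep_eq blinfun.add_right blinfun.scaleR_right)

lemma coord_amp [simp]: "coord (amp m T f) n = T (coord f (n - m))"
  by (simp add: amp.rep_eq amp_fun.rep_eq)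

lemma norm_amp: "norm (amp m T) \<le> norm T"
  by (rule norm_blinfun_bound) (auto simp: amp.rep_eq norm_amp_fun mult.commute[of "norm T"])

lemma amp_delta [simp]: "amp m T (delta n v) = delta (n + m) (T v)"
  by (rule coord_inject_ext) auto

lemma amp_compose: "amp m S o\<^sub>L amp n T = amp (m + n) (S o\<^sub>L T)"
  by (intro blinfun_eqI coord_inject_ext) (simp add: diff_diff_eq)

lemma amp_0_id: "amp 0 id_blinfun = id_blinfun"
  by (intro blinfun_eqI coord_inject_ext) simp

lemma cops_amp: "T \<in> cops \<Longrightarrow> amp m T \<in> cops"
  by (auto simp: cops_def intro!: coord_inject_ext)

lemma crossed_unitary_eq_amp: "crossed_unitary = amp 1 id_blinfun"
  by (intro blinfun_eqI coord_inject_ext) (simp add: crossed_unitary.rep_eq shift.rep_eq)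

lemma adj_amp:
  fixes T :: "'k::chilbert_space \<Rightarrow>\<^sub>L 'k"
  assumes T: "T \<in> cops" shows "adj (amp m T) = amp (- m) (adj T)"
proof (rule adj_unique[OF cops_amp[OF T]])
  fix x y :: "'k ell2Z"
  have b: "bij_betw (\<lambda>n. n + m) UNIV UNIV"
    by (rule bij_betw_byWitness[where f' = "\<lambda>n. n - m"]; simp)
  have "cinner (amp m T x) y = (\<Sum>\<^sub>\<infinity>n. cinner (coord x (n - m)) (adj T (coord y n)))"
    by (simp add: cinner_ell2Z_def adj_adjoint[OF T])
  also have "\<dots> = (\<Sum>\<^sub>\<infinity>n. cinner (coord x n) (adj T (coord y (n + m))))"
    using infsum_reindex_bij_betw[OF b, of "\<lambda>n. cinner (coord x (n - m)) (adj T (coord y n))"] by simp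
  finally show "cinner (amp m T x) y = cinner x (amp (- m) (adj T) y)" by (simp add: cinner_ell2Z_def)
qed

lemma norm_delta [simp]: "norm (delta m v) = norm v"
proof -
  have "(norm (delta m v))\<^sup>2 = (\<Sum>\<^sub>\<infinity>n\<in>{m}. (norm (coord (delta m v) n))\<^sup>2)"
    unfolding norm_ell2Z_square by (rule infsum_cong_neutral) auto
  then show ?thesis by (simp add: power2_eq_iff_nonneg)
qed

lemma cinner_delta_left: "cinner (delta m v) \<xi> = cinner v (coord \<xi> m)" for v :: "'k::chilbert_space"
proof -
  have "cinner (delta m v) \<xi> = (\<Sum>\<^sub>\<infinity>n\<in>{m}. cinner (coord (delta m v) n) (coord \<xi> n))"
    unfolding cinner_ell2Z_def by (rule infsum_cong_neutral) (auto simp: cinner_simps)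
  then show ?thesis by simp
qed

lemma cinner_delta_right: "cinner \<xi> (delta m v) = cinner (coord \<xi> m) v" for v :: "'k::chilbert_space"
  by (metis cinner_commute cinner_delta_left)

lemma bounded_linear_delta: "bounded_linear (delta m)"
  by (rule bounded_linear_intro[where K = 1]) (auto intro!: coord_inject_ext)

text \<open>By orthogonality the squared distance from \<xi> to a finite partial sum is
  \<open>(norm \<xi>)\<^sup>2\<close> minus the partial sum of the squared coordinate norms, which
  tends to 0.\<close>

lemma delta_has_sum: "((\<lambda>n. delta n (coord \<xi> n)) has_sum \<xi>) UNIV"
proof -
  have eq: "(norm (\<xi> - (\<Sum>n\<in>F. delta n (coord \<xi> n))))\<^sup>2
      = (norm \<xi>)\<^sup>2 - (\<Sum>n\<in>F. (norm (coord \<xi> n))\<^sup>2)" if F: "finite F" for F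
  proof -
    have c: "coord (\<xi> - (\<Sum>n\<in>F. delta n (coord \<xi> n))) j = (if j \<in> F then 0 else coord \<xi> j)" for j
      using F by (simp add: coord_sum)
    have "(norm (\<xi> - (\<Sum>n\<in>F. delta n (coord \<xi> n))))\<^sup>2 = (\<Sum>\<^sub>\<infinity>n\<in>UNIV - F. (norm (coord \<xi> n))\<^sup>2)"
      unfolding norm_ell2Z_square c by (rule infsum_cong_neutral) auto
    also have "\<dots> = (norm \<xi>)\<^sup>2 - (\<Sum>n\<in>F. (norm (coord \<xi> n))\<^sup>2)"
      using F by (subst infsum_Diff) (auto simp: coord_summable norm_ell2Z_square)
    finally show ?thesis .
  qed
  have "((\<lambda>n. (norm (coord \<xi> n))\<^sup>2) has_sum (norm \<xi>)\<^sup>2) UNIV"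
    using has_sum_infsum[OF coord_summable[of \<xi>]] by (simp add: norm_ell2Z_square)
  then have "((\<lambda>F. (norm \<xi>)\<^sup>2 - (\<Sum>n\<in>F. (norm (coord \<xi> n))\<^sup>2)) \<longlongrightarrow> (norm \<xi>)\<^sup>2 - (norm \<xi>)\<^sup>2)
      (finite_subsets_at_top UNIV)"
    unfolding has_sum_def by (intro tendsto_intros)
  from this[unfolded diff_self]
  have "((\<lambda>F. (norm (\<xi> - (\<Sum>n\<in>F. delta n (coord \<xi> n))))\<^sup>2) \<longlongrightarrow> 0) (finite_subsets_at_top UNIV)"
    by (rule Lim_transform_eventually) (auto simp: eq intro!: eventually_finite_subsets_at_top_weakI)
  from tendsto_real_sqrt[OF this]
  have "((\<lambda>F. norm ((\<Sum>n\<in>F. delta n (coord \<xi> n)) - \<xi>)) \<longlongrightarrow> 0) (finite_subsets_at_top UNIV)"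
    by (simp add: norm_minus_commute)
  then show ?thesis
    unfolding has_sum_def by (subst Lim_null) (rule tendsto_norm_zero_cancel)
qed

text \<open>Continuity of \<open>delta m\<close> passes from \<open>D\<close> to all of
  \<open>'k\<close>, additivity gives finite sums, and \<open>delta_has_sum\<close> together with
  closedness gives every vector.\<close>

lemma ell2Z_dense_induct:
  fixes \<xi> :: "'k::{real_inner, complete_space} ell2Z"
  assumes D: "closure D = UNIV" and cl: "closed {\<xi>. P \<xi>}" and zero: "P 0"
    and add: "\<And>\<xi> \<eta>. P \<xi> \<Longrightarrow> P \<eta> \<Longrightarrow> P (\<xi> + \<eta>)"
    and d: "\<And>m v. v \<in> D \<Longrightarrow> P (delta m v)"
  shows "P \<xi>"
proof -
  have dv: "P (delta m v)" for m v
  proof -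
    have "closed (delta m -` {\<xi>. P \<xi>})"
      using cl linear_continuous_on[OF bounded_linear_delta] by (intro closed_vimage) auto
    then have "closure D \<subseteq> delta m -` {\<xi>. P \<xi>}" by (intro closure_minimal) (auto simp: d)
    then show ?thesis using D by auto
  qed
  have s: "P (\<Sum>n\<in>F. delta n (coord \<xi> n))" if "finite F" for F
    using that by (induction F) (auto simp: zero add dv)
  have "\<xi> \<in> {\<xi>. P \<xi>}"
    using delta_has_sum[of \<xi>] unfolding has_sum_def
    by (intro Lim_in_closed_set[OF cl _ finite_subsets_at_top_neq_bot])
       (auto simp: s intro!: eventually_finite_subsets_at_top_weakI)
  then show ?thesis by simp
qed

section \<open>Strong limits and Cesaro means\<close>

text \<open>An \<open>e / 3\<close> argument: the uniform bound makes \<open>X n x\<close> close to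
  \<open>X n (y i)\<close> for all \<open>n\<close> at once, so the sequence at a limit point is
  Cauchy.\<close>

lemma closed_convergent_bounded:
  fixes X :: "nat \<Rightarrow> 'a::real_normed_vector \<Rightarrow>\<^sub>L 'b::{real_normed_vector, complete_space}"
  assumes bd: "\<And>n. norm (X n) \<le> C"
  shows "closed {x. convergent (\<lambda>n. X n x)}"
  unfolding closed_sequential_limits
proof (intro allI impI, elim conjE)
  fix y x assume y: "\<forall>i. y i \<in> {x. convergent (\<lambda>n. X n x)}" and lim: "y \<longlonglongrightarrow> x"
  have C: "C \<ge> 0" using bd[of 0] norm_ge_zero order_trans by blast
  have "Cauchy (\<lambda>n. X n x)"
  proof (rule CauchyI)
    fix e :: real assume e: "e > 0"
    \<comment> \<open>\<open>C + 1\<close> in place of \<open>C\<close> keeps the denominator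
      positive when \<open>C\<close> is 0.\<close>
    have "e / (3 * (C + 1)) > 0" using e C by simp
    then obtain i where i: "norm (x - y i) < e / (3 * (C + 1))"
      using lim by (metis LIMSEQ_iff dual_order.refl norm_minus_commute)
    have d: "norm (X n x - X n (y i)) \<le> e / 3" for n
    proof -
      have "norm (X n x - X n (y i)) \<le> norm (X n) * norm (x - y i)"
        unfolding blinfun.diff_right[symmetric] by (rule norm_blinfun)
      also have "\<dots> \<le> (C + 1) * (e / (3 * (C + 1)))"
        using bd[of n] i C by (intro mult_mono) auto
      also have "\<dots> = e / 3" using C by (simp add: field_simps)
      finally show ?thesis .
    qed
    have "Cauchy (\<lambda>n. X n (y i))" using y by (auto intro: convergent_Cauchy)
    then obtain M where M: "\<And>m n. m \<ge> M \<Longrightarrow> n \<ge> M \<Longrightarrow> norm (X m (y i) - X n (y i)) < e / 3"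
      using CauchyD[of "\<lambda>n. X n (y i)" "e/3"] e by auto
    have "norm (X m x - X n x) < e" if "m \<ge> M" "n \<ge> M" for m n
    proof -
      have "norm (X m x - X n x) = norm ((X m x - X m (y i)) + (X m (y i) - X n (y i)) - (X n x - X n (y i)))"
        by simp
      also have "\<dots> \<le> norm (X m x - X m (y i)) + norm (X m (y i) - X n (y i)) + norm (X n x - X n (y i))"
        by (meson norm_triangle_le norm_triangle_ineq4 add_mono order_refl order_trans norm_triangle_ineq)
      also have "\<dots> < e" using d[of m] d[of n] M[OF that] by linarith
      finally show ?thesis .
    qed
    then show "\<exists>M. \<forall>m\<ge>M. \<forall>n\<ge>M. norm (X m x - X n x) < e" by blast
  qed
  then show "x \<in> {x. convergent (\<lambda>n. X n x)}" by (simp add: Cauchy_convergent_iff)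
qed

lemma strong_limit_exists:
  fixes X :: "nat \<Rightarrow> 'a::real_normed_vector \<Rightarrow>\<^sub>L 'b::real_normed_vector"
  assumes bd: "\<And>n. norm (X n) \<le> C" and conv: "\<And>x. convergent (\<lambda>n. X n x)"
  shows "\<exists>Y. \<forall>x. (\<lambda>n. X n x) \<longlonglongrightarrow> blinfun_apply Y x"
proof -
  define g where "g x = lim (\<lambda>n. X n x)" for x
  have g: "(\<lambda>n. X n x) \<longlonglongrightarrow> g x" for x using conv by (simp add: g_def convergent_LIMSEQ_iff)
  have "bounded_linear g"
  proof (rule bounded_linear_intro[where K = C])
    show "g (x + y) = g x + g y" for x y
      using tendsto_add[OF g g, of x y] by (intro LIMSEQ_unique[OF g]) (simp add: blinfun.add_right)
    show "g (r *\<^sub>R x) = r *\<^sub>R g x" for r x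
      using tendsto_scaleR[OF tendsto_const g, of r x]
      by (intro LIMSEQ_unique[OF g]) (simp add: blinfun.scaleR_right)
    fix x
    have "norm (X n x) \<le> norm x * C" for n
      using norm_blinfun[of "X n" x] mult_right_mono[OF bd[of n], of "norm x"] by (simp add: mult.commute)
    then show "norm (g x) \<le> norm x * C"
      by (intro tendsto_upperbound[OF tendsto_norm[OF g]]) auto
  qed
  then show ?thesis using g by (intro exI[of _ "Blinfun g"]) (simp add: bounded_linear_Blinfun_apply)
qed

definition cesaro_null :: "(nat \<Rightarrow> real) \<Rightarrow> bool" where
  "cesaro_null f \<longleftrightarrow> (\<lambda>n. 1 / real n * (\<Sum>k<n. f k)) \<longlonglongrightarrow> 0"

lemma cesaro_null_add: "cesaro_null f \<Longrightarrow> cesaro_null g \<Longrightarrow> cesaro_null (\<lambda>k. f k + g k)"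
  unfolding cesaro_null_def using tendsto_add[of _ 0 _ _ 0]
  by (force simp: sum.distrib distrib_left)

lemma cesaro_null_mono:
  assumes g: "cesaro_null g" and le: "\<And>k. 0 \<le> f k" "\<And>k. f k \<le> g k"
  shows "cesaro_null f"
  unfolding cesaro_null_def
proof (rule tendsto_sandwich[OF _ _ tendsto_const])
  show "(\<lambda>n. 1 / real n * (\<Sum>k<n. g k)) \<longlonglongrightarrow> 0" using g by (simp add: cesaro_null_def)
qed (auto intro!: always_eventually sum_nonneg divide_nonneg_nonneg divide_right_mono sum_mono le)

text \<open>Replacing \<open>x\<close> by a nearby \<open>y i\<close> costs at most
  \<open>e / 2\<close> in each norm, uniformly in \<open>k\<close>, and hence at most
  \<open>e / 2\<close> in every mean.\<close>

lemma closed_cesaro_null: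
  fixes X :: "nat \<Rightarrow> 'a::real_normed_vector \<Rightarrow>\<^sub>L 'b::real_normed_vector"
  assumes bd: "\<And>n. norm (X n) \<le> C"
  shows "closed {x. cesaro_null (\<lambda>k. norm (X k x))}"
  unfolding closed_sequential_limits
proof (intro allI impI, elim conjE)
  fix y x assume y: "\<forall>i. y i \<in> {x. cesaro_null (\<lambda>k. norm (X k x))}" and lim: "y \<longlonglongrightarrow> x"
  have C: "C \<ge> 0" using bd[of 0] norm_ge_zero order_trans by blast
  have "cesaro_null (\<lambda>k. norm (X k x))"
    unfolding cesaro_null_def
  proof (rule LIMSEQ_I)
    fix e :: real assume e: "e > 0"
    have "e / (2 * (C + 1)) > 0" using e C by simp
    then obtain i where i: "norm (x - y i) < e / (2 * (C + 1))"
      using lim by (metis LIMSEQ_iff dual_order.refl norm_minus_commute)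
    have d: "norm (X k x) \<le> e / 2 + norm (X k (y i))" for k
    proof -
      have "norm (X k x - X k (y i)) \<le> norm (X k) * norm (x - y i)"
        unfolding blinfun.diff_right[symmetric] by (rule norm_blinfun)
      also have "\<dots> \<le> (C + 1) * (e / (2 * (C + 1)))"
        using bd[of k] i C by (intro mult_mono) auto
      also have "\<dots> = e / 2" using C by (simp add: field_simps)
      finally show ?thesis using norm_triangle_sub[of "X k x" "X k (y i)"] by linarith
    qed
    have "cesaro_null (\<lambda>k. norm (X k (y i)))" using y by auto
    then obtain M where M: "\<And>n. n \<ge> M \<Longrightarrow> norm (1 / real n * (\<Sum>k<n. norm (X k (y i))) - 0) < e / 2"
      using e unfolding cesaro_null_def LIMSEQ_iff by (meson half_gt_zero)
    have "norm (1 / real n * (\<Sum>k<n. norm (X k x)) - 0) < e" if n: "n \<ge> M" for n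
    proof -
      have "(\<Sum>k<n. norm (X k x)) \<le> (\<Sum>k<n. e / 2 + norm (X k (y i)))" by (rule sum_mono) (rule d)
      also have "\<dots> = real n * (e / 2) + (\<Sum>k<n. norm (X k (y i)))" by (simp add: sum.distrib)
      finally have "1 / real n * (\<Sum>k<n. norm (X k x))
          \<le> 1 / real n * (real n * (e / 2) + (\<Sum>k<n. norm (X k (y i))))"
        by (intro mult_left_mono) auto
      also have "\<dots> = 1 / real n * (real n * (e / 2)) + 1 / real n * (\<Sum>k<n. norm (X k (y i)))"
        by (rule distrib_left)
      also have "\<dots> \<le> e / 2 + 1 / real n * (\<Sum>k<n. norm (X k (y i)))" using e by simp
      also have "\<dots> < e"
        using M[OF n] abs_ge_self[of "1 / real n * (\<Sum>k<n. norm (X k (y i)))"]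
        unfolding real_norm_def diff_0_right by linarith
      finally have "1 / real n * (\<Sum>k<n. norm (X k x)) < e" .
      moreover have "0 \<le> 1 / real n * (\<Sum>k<n. norm (X k x))" by (simp add: sum_nonneg)
      ultimately show ?thesis by simp
    qed
    then show "\<exists>M. \<forall>n\<ge>M. norm (1 / real n * (\<Sum>k<n. norm (X k x)) - 0) < e" by blast
  qed
  then show "x \<in> {x. cesaro_null (\<lambda>k. norm (X k x))}" by simp
qed

lemma cesaro_null_dense_induct:
  fixes X :: "nat \<Rightarrow> 'k::{real_inner, complete_space} ell2Z \<Rightarrow>\<^sub>L 'b::real_normed_vector"
  assumes D: "closure D = UNIV" and bd: "\<And>n. norm (X n) \<le> C"
    and d: "\<And>m v. v \<in> D \<Longrightarrow> cesaro_null (\<lambda>k. norm (X k (delta m v)))"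
  shows "cesaro_null (\<lambda>k. norm (X k \<xi>))"
proof (rule ell2Z_dense_induct[OF D, of "\<lambda>\<xi>. cesaro_null (\<lambda>k. norm (X k \<xi>))"])
  show "closed {\<xi>. cesaro_null (\<lambda>k. norm (X k \<xi>))}" by (rule closed_cesaro_null[OF bd])
  show "cesaro_null (\<lambda>k. norm (X k 0))" by (simp add: cesaro_null_def)
  show "cesaro_null (\<lambda>k. norm (X k (\<xi> + \<eta>)))"
    if "cesaro_null (\<lambda>k. norm (X k \<xi>))" "cesaro_null (\<lambda>k. norm (X k \<eta>))" for \<xi> \<eta>
    by (rule cesaro_null_mono[OF cesaro_null_add[OF that]]) (auto simp: blinfun.add_right norm_triangle_ineq)
qed (rule d)

section \<open>Laurent operators\<close>

lemma crossed_unitary_cops: "(crossed_unitary :: 'k::chilbert_space ell2Z \<Rightarrow>\<^sub>L 'k ell2Z) \<in> cops"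
  by (simp add: crossed_unitary_eq_amp cops_amp cops_id)

lemma adj_amp_id: "adj (amp m id_blinfun) = (amp (- m) id_blinfun :: 'k::chilbert_space ell2Z \<Rightarrow>\<^sub>L _)"
  by (simp add: adj_amp cops_id adj_id)

lemma amp_id_in_vn_generated:
  "amp m id_blinfun \<in> vn_generated {crossed_unitary :: 'k::chilbert_space ell2Z \<Rightarrow>\<^sub>L 'k ell2Z}"
proof -
  let ?B = "vn_generated {crossed_unitary :: 'k ell2Z \<Rightarrow>\<^sub>L 'k ell2Z}"
  have B: "von_neumann_algebra ?B" "crossed_unitary \<in> ?B"
    using vn_generated[of "{crossed_unitary}"] crossed_unitary_cops by auto
  have nat: "amp (int k) id_blinfun \<in> ?B" for k
  proof (induction k)
    case 0
    then show ?case using von_neumann_algebraD(3)[OF B(1)] by (simp add: amp_0_id)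
  next
    case (Suc k)
    have "amp (int (Suc k)) id_blinfun = crossed_unitary o\<^sub>L (amp (int k) id_blinfun :: 'k ell2Z \<Rightarrow>\<^sub>L _)"
      by (simp add: crossed_unitary_eq_amp amp_compose blinfun_compose_id)
    then show ?case using von_neumann_algebraD(4)[OF B(1) B(2) Suc] by simp
  qed
  show ?thesis
  proof (cases "m \<ge> 0")
    case True
    then show ?thesis using nat[of "nat m"] by simp
  next
    case False
    then show ?thesis
      using von_neumann_algebraD(2)[OF B(1) nat[of "nat (- m)"]] by (simp add: adj_amp_id)
  qed
qed

text \<open>Membership is tested against the commutant: an operator \<open>S\<close> commuting with
  the shift is a Laurent matrix with operator entries, and such a matrix commutes with one whose
  entries are scalars. Comparing entries avoids any choice of convergence for the Fourier series of
  \<open>T\<close>.\<close>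

lemma Laurent_in_vn_generated:
  fixes T :: "'k::chilbert_space ell2Z \<Rightarrow>\<^sub>L 'k ell2Z"
  assumes T: "T \<in> cops" and c: "\<And>m v j. coord (T (delta m v)) j = c (j - m) *\<^sub>C v"
  shows "T \<in> vn_generated {crossed_unitary}"
proof -
  let ?D = "{crossed_unitary :: 'k ell2Z \<Rightarrow>\<^sub>L 'k ell2Z} \<union> adj ` {crossed_unitary}"
  \<comment> \<open>The conjugate transpose matrix; it turns a row of \<open>T\<close> into a
    vector, so that entries of products become inner products.\<close>
  have cT: "coord (adj T (delta i v)) j = cnj (c (i - j)) *\<^sub>C v" for i v j
  proof (rule cinner_right_eqI)
    fix x
    have "cinner x (coord (adj T (delta i v)) j) = cinner (T (delta j x)) (delta i v)"
      by (simp add: cinner_delta_left adj_adjoint[OF T])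
    then show "cinner x (coord (adj T (delta i v)) j) = cinner x (cnj (c (i - j)) *\<^sub>C v)"
      by (simp add: cinner_delta_right c cinner_simps)
  qed
  have "T o\<^sub>L S = S o\<^sub>L T" if S: "S \<in> commutant ?D" for S
  proof -
    have Sc: "S \<in> cops" using S by (simp add: commutant_def)
    have "amp m id_blinfun \<in> commutant (commutant ?D)" for m
      using amp_id_in_vn_generated[of m, where 'k = 'k] by (simp add: vn_generated_def)
    then have com: "S (amp m id_blinfun \<xi>) = amp m id_blinfun (S \<xi>)" for m \<xi>
      using S commutant_apply by metis
    \<comment> \<open>\<open>S\<close> commutes with every translation, so its entries depend only
      on the difference of the indices.\<close>
    have Scoord: "coord (S (delta j v)) i = coord (S (delta n v)) (i + n - j)" for j n i v
    proof -
      have "S (delta j v) = amp (j - n) id_blinfun (S (delta n v))" by (simp flip: com)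
      then show ?thesis by (simp add: algebra_simps)
    qed
    have main: "S (T (delta n v)) = T (S (delta n v))" for n v
    proof (rule coord_inject_ext, rule cinner_right_eqI)
      fix i w
      have "cinner w (coord (S (T (delta n v))) i) = cinner (adj S (delta i w)) (T (delta n v))"
        by (simp add: adj_adjoint'[OF Sc] cinner_delta_left)
      also have "\<dots> = (\<Sum>\<^sub>\<infinity>j. cinner (coord (adj S (delta i w)) j) (c (j - n) *\<^sub>C v))"
        by (simp add: cinner_ell2Z_def c)
      also have "\<dots> = (\<Sum>\<^sub>\<infinity>j. c (j - n) * cinner w (coord (S (delta n v)) (i + n - j)))"
      proof (rule infsum_cong)
        fix j
        have "cinner (coord (adj S (delta i w)) j) v = cinner (adj S (delta i w)) (delta j v)"
          by (simp add: cinner_delta_right)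
        also have "\<dots> = cinner w (coord (S (delta j v)) i)"
          by (simp add: adj_adjoint'[OF Sc] cinner_delta_left)
        also have "\<dots> = cinner w (coord (S (delta n v)) (i + n - j))" using Scoord by metis
        finally show "cinner (coord (adj S (delta i w)) j) (c (j - n) *\<^sub>C v)
            = c (j - n) * cinner w (coord (S (delta n v)) (i + n - j))" by (simp add: cinner_simps)
      qed
      \<comment> \<open>The substitution \<open>j \<mapsto> i + n - j\<close> turns the convolution
        for \<open>S T\<close> into the one for \<open>T S\<close>.\<close>
      also have "\<dots> = (\<Sum>\<^sub>\<infinity>j. c (i - j) * cinner w (coord (S (delta n v)) j))"
      proof -
        have b: "bij_betw (\<lambda>j. i + n - j) UNIV UNIV"
          by (rule bij_betw_byWitness[where f' = "\<lambda>j. i + n - j"]; simp)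
        show ?thesis
          using infsum_reindex_bij_betw[OF b, of "\<lambda>j. c (i - j) * cinner w (coord (S (delta n v)) j)"]
          by simp
      qed
      also have "\<dots> = cinner (adj T (delta i w)) (S (delta n v))"
        by (simp add: cinner_ell2Z_def cT cinner_simps)
      also have "\<dots> = cinner w (coord (T (S (delta n v))) i)"
        by (simp add: adj_adjoint'[OF T] cinner_delta_left)
      finally show "cinner w (coord (S (T (delta n v))) i) = cinner w (coord (T (S (delta n v))) i)" .
    qed
    have "T (S \<xi>) = S (T \<xi>)" for \<xi>
    proof (rule ell2Z_dense_induct[of UNIV "\<lambda>\<xi>. T (S \<xi>) = S (T \<xi>)"])
      show "closed {\<xi>. T (S \<xi>) = S (T \<xi>)}" by (intro closed_Collect_eq continuous_intros)
    qed (auto simp: blinfun.add_right main)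
    then show ?thesis by (simp add: blinfun_eq_iff)
  qed
  then show ?thesis using T unfolding vn_generated_def commutant_def[of "commutant ?D"] by blast
qed

section \<open>Powers of an automorphism\<close>

lemma star_automorphism_compose:
  assumes "star_automorphism N \<sigma>" "star_automorphism N \<tau>"
  shows "star_automorphism N (\<lambda>x. \<sigma> (\<tau> x))"
proof -
  have "bij_betw (\<sigma> \<circ> \<tau>) N N"
    using assms bij_betw_trans by (auto simp: star_automorphism_def)
  moreover have "\<tau> x \<in> N" if "x \<in> N" for x
    using assms(2) that by (auto simp: star_automorphism_def bij_betw_def)
  ultimately show ?thesis using assms by (simp add: star_automorphism_def o_def)
qed

lemma star_automorphism_inv:
  assumes N: "von_neumann_algebra N" and s: "star_automorphism N \<sigma>"
  shows "star_automorphism N (inv_into N \<sigma>)"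
proof -
  note [simp] = von_neumann_algebraD(2-)[OF N]
  have b: "bij_betw \<sigma> N N" using s by (simp add: star_automorphism_def)
  have m: "inv_into N \<sigma> x \<in> N" if "x \<in> N" for x
    using bij_betw_inv_into[OF b] that by (auto simp: bij_betw_def)
  have r: "\<sigma> (inv_into N \<sigma> x) = x" if "x \<in> N" for x using bij_betw_inv_into_right[OF b that] .
  have eqI: "inv_into N \<sigma> x = y" if "y \<in> N" "\<sigma> y = x" for x y
    using bij_betw_inv_into_left[OF b that(1)] that(2) by simp
  show ?thesis
    using s m r bij_betw_inv_into[OF b]
    by (auto simp: star_automorphism_def intro!: eqI)
qed

lemma star_automorphism_id: "star_automorphism N (\<lambda>x. x)"
  by (simp add: star_automorphism_def bij_betw_def)

lemma star_automorphism_funpow: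
  "star_automorphism N \<sigma> \<Longrightarrow> star_automorphism N (\<sigma> ^^ k)"
  by (induction k) (simp_all add: star_automorphism_id id_def star_automorphism_compose o_def)

lemma star_automorphism_aut_power:
  "von_neumann_algebra N \<Longrightarrow> star_automorphism N \<sigma> \<Longrightarrow> star_automorphism N (aut_power N \<sigma> n)"
  by (simp add: aut_power_def star_automorphism_funpow star_automorphism_inv)

lemma trace_preserving_funpow:
  assumes "trace_preserving N tr \<sigma>" "\<And>x. x \<in> N \<Longrightarrow> \<sigma> x \<in> N"
  shows "trace_preserving N tr (\<sigma> ^^ k)"
proof (induction k)
  case (Suc k)
  have "(\<sigma> ^^ k) x \<in> N" if "x \<in> N" for x
    using that by (induction k) (auto simp: assms(2))
  then show ?case using Suc assms(1) by (simp add: trace_preserving_def)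
qed (simp add: trace_preserving_def)

lemma trace_preserving_aut_power:
  assumes b: "bij_betw \<sigma> N N" and t: "trace_preserving N tr \<sigma>"
  shows "trace_preserving N tr (aut_power N \<sigma> n)"
proof -
  have m: "\<sigma> x \<in> N" "inv_into N \<sigma> x \<in> N" if "x \<in> N" for x
    using b bij_betw_inv_into[OF b] that by (auto simp: bij_betw_def)
  have "trace_preserving N tr (inv_into N \<sigma>)"
    unfolding trace_preserving_def
    using t m(2) bij_betw_inv_into_right[OF b] by (metis trace_preserving_def)
  then show ?thesis using t m by (simp add: aut_power_def trace_preserving_funpow)
qed

section \<open>Right multiplication on the crossed product\<close>

locale tracial_system =
  fixes N :: "('h::chilbert_space \<Rightarrow>\<^sub>L 'h) set"
    and tr :: "('h \<Rightarrow>\<^sub>L 'h) \<Rightarrow> complex"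
    and \<theta> :: "('h \<Rightarrow>\<^sub>L 'h) \<Rightarrow> ('h \<Rightarrow>\<^sub>L 'h)"
    and \<Lambda> :: "('h \<Rightarrow>\<^sub>L 'h) \<Rightarrow> 'k::chilbert_space"
  assumes N: "von_neumann_algebra N" and tr: "faithful_normal_trace N tr" and tr1: "tr id_blinfun = 1"
    and \<theta>: "star_automorphism N \<theta>" and \<theta>tr: "trace_preserving N tr \<theta>" and L2: "is_L2_space N tr \<Lambda>"
begin

abbreviation "\<alpha> \<equiv> aut_power N \<theta>"
abbreviation "\<Omega> \<equiv> delta 0 (\<Lambda> id_blinfun)"
abbreviation "\<tau> \<equiv> crossed_trace \<Lambda>"
abbreviation "M \<equiv> crossed_product N \<theta> \<Lambda>"
abbreviation "B \<equiv> vn_generated {crossed_unitary :: 'k ell2Z \<Rightarrow>\<^sub>L 'k ell2Z}"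
abbreviation "U m \<equiv> (amp m id_blinfun :: 'k ell2Z \<Rightarrow>\<^sub>L 'k ell2Z)"

lemmas NI [simp, intro] = von_neumann_algebraD(2-)[OF N]
lemmas N_cops [simp, intro] = subsetD[OF von_neumann_algebraD(1)[OF N]]
lemmas \<Lambda>D = L2D[OF N tr L2]

lemma trD:
  "x \<in> N \<Longrightarrow> y \<in> N \<Longrightarrow> tr (x + y) = tr x + tr y" "x \<in> N \<Longrightarrow> tr (scaleC_op c x) = c * tr x"
  "x \<in> N \<Longrightarrow> y \<in> N \<Longrightarrow> tr (x o\<^sub>L y) = tr (y o\<^sub>L x)"
  using tr by (auto simp: faithful_normal_trace_def)

lemma \<alpha>_star: "star_automorphism N (\<alpha> n)"
  by (rule star_automorphism_aut_power[OF N \<theta>])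

lemma \<alpha>D:
  "x \<in> N \<Longrightarrow> \<alpha> n x \<in> N" "x \<in> N \<Longrightarrow> y \<in> N \<Longrightarrow> \<alpha> n (x + y) = \<alpha> n x + \<alpha> n y"
  "x \<in> N \<Longrightarrow> y \<in> N \<Longrightarrow> \<alpha> n (x o\<^sub>L y) = \<alpha> n x o\<^sub>L \<alpha> n y"
  "x \<in> N \<Longrightarrow> \<alpha> n (scaleC_op c x) = scaleC_op c (\<alpha> n x)" "x \<in> N \<Longrightarrow> \<alpha> n (adj x) = adj (\<alpha> n x)"
  "x \<in> N \<Longrightarrow> tr (\<alpha> n x) = tr x"
  using \<alpha>_star[of n] trace_preserving_aut_power[OF _ \<theta>tr, of n] \<theta>
  by (auto simp: star_automorphism_def bij_betw_def trace_preserving_def)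

lemmas \<alpha>_mem [simp, intro] = \<alpha>D(1)

lemma \<alpha>_0 [simp]: "\<alpha> 0 x = x"
  by (simp add: aut_power_def)

text \<open>By surjectivity the identity is some \<open>\<alpha> n y\<close>, and
  \<open>\<alpha> n id_blinfun\<close> acts on it as a unit.\<close>

lemma \<alpha>_id [simp]: "\<alpha> n id_blinfun = id_blinfun"
proof -
  obtain y where y: "y \<in> N" "\<alpha> n y = id_blinfun"
    using \<alpha>_star[of n] NI(2) unfolding star_automorphism_def bij_betw_def by (metis imageE)
  have "\<alpha> n id_blinfun o\<^sub>L \<alpha> n y = \<alpha> n y"
    using \<alpha>D(3)[of id_blinfun y n] y(1) by (simp add: blinfun_compose_id)
  then show ?thesis by (simp add: y(2) blinfun_compose_id)
qed

text \<open>Two-sided induction on \<open>b\<close>: \<open>aut_power_shift\<close> moves one factor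
  \<theta> between exponent and argument. Downwards this requires writing \<open>x\<close> as
  \<open>\<theta> y\<close>.\<close>

lemma \<alpha>_\<alpha>: "x \<in> N \<Longrightarrow> \<alpha> a (\<alpha> b x) = \<alpha> (a + b) x"
proof (induction b arbitrary: x rule: int_induct[where k = 0])
  case base
  then show ?case by simp
next
  note shift = aut_power_shift[OF N tr L2 \<theta> \<theta>tr]
  have \<theta>N: "\<theta> x \<in> N" if "x \<in> N" for x using \<theta> that by (auto simp: star_automorphism_def bij_betw_def)
  case (step1 b)
  show ?case
    using step1.IH[OF \<theta>N[OF step1.prems]] shift[OF step1.prems, of b] shift[OF step1.prems, of "a + b"]
    by (simp add: add.assoc)
next
  note shift = aut_power_shift[OF N tr L2 \<theta> \<theta>tr]
  case (step2 b)
  obtain y where y: "y \<in> N" "x = \<theta> y"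
    using \<theta> step2.prems unfolding star_automorphism_def bij_betw_def by (metis imageE)
  show ?case using step2.IH[OF y(1)] shift[OF y(1), of "b - 1"] shift[OF y(1), of "a + (b - 1)"]
    by (simp add: y(2) add.assoc)
qed

lemma norm_\<Lambda>_adj: assumes "x \<in> N" shows "norm (\<Lambda> (adj x)) = norm (\<Lambda> x)"
proof -
  have "cinner (\<Lambda> (adj x)) (\<Lambda> (adj x)) = cinner (\<Lambda> x) (\<Lambda> x)"
    using assms by (simp add: \<Lambda>D adj_adj trD(3)[of x "adj x"])
  then have "(norm (\<Lambda> (adj x)))\<^sup>2 = (norm (\<Lambda> x))\<^sup>2" by (simp only: cinner_self of_real_eq_iff)
  then show ?thesis by (simp add: power2_eq_iff_nonneg)
qed

lemma norm_\<Lambda>_\<alpha>: "x \<in> N \<Longrightarrow> norm (\<Lambda> (\<alpha> n x)) = norm (\<Lambda> x)"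
  using aut_power[OF N tr L2 \<theta> \<theta>tr] by blast

lemma L2_induct: "closed {v. P v} \<Longrightarrow> (\<And>y. y \<in> N \<Longrightarrow> P (\<Lambda> y)) \<Longrightarrow> P v"
  using closure_minimal[of "\<Lambda> ` N" "{v. P v}"] \<Lambda>D(4) by auto

lemma ell2Z_induct:
  assumes "closed {\<xi>. P \<xi>}" "\<And>\<xi> \<eta>. P \<xi> \<Longrightarrow> P \<eta> \<Longrightarrow> P (\<xi> + \<eta>)" "\<And>m y. y \<in> N \<Longrightarrow> P (delta m (\<Lambda> y))"
  shows "P \<xi>"
proof (rule ell2Z_dense_induct[OF \<Lambda>D(4) assms(1)])
  \<comment> \<open>The zero vector is itself elementary, namely
    \<open>delta 0 (\<Lambda> 0)\<close>, so the zero case is an instance of the third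
    assumption.\<close>
  have "0 = scaleC_op 0 (id_blinfun :: 'h \<Rightarrow>\<^sub>L 'h)" "0 *\<^sub>C v = 0" for v :: 'k
    by (auto simp add: blinfun_eq_iff scaleC_op.rep_eq) (metis of_real_0 scaleR_scaleC scaleR_zero_left)+
  then have "delta 0 (\<Lambda> 0) = 0" "0 \<in> N"
    using \<Lambda>D(2)[of id_blinfun 0] NI(5)[of id_blinfun 0] by (auto intro!: coord_inject_ext)
  then show "P 0" using assms(3)[of 0 0] by simp
qed (use assms in auto)

text \<open>The map induced on the image of \<Lambda> is Lipschitz, hence extends to the closure by
  uniform continuity. Linearity and the bound are closed conditions and pass to the
  extension.\<close>

lemma L2_operator_exists:
  assumes f: "\<And>y. y \<in> N \<Longrightarrow> f y \<in> N"
    and f_add: "\<And>y z. y \<in> N \<Longrightarrow> z \<in> N \<Longrightarrow> f (y + z) = f y + f z"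
    and f_scale: "\<And>y c. y \<in> N \<Longrightarrow> f (scaleC_op c y) = scaleC_op c (f y)"
    and bd: "\<And>y. y \<in> N \<Longrightarrow> norm (\<Lambda> (f y)) \<le> C * norm (\<Lambda> y)" and C: "C \<ge> 0"
  shows "\<exists>T \<in> cops. norm T \<le> C \<and> (\<forall>y\<in>N. blinfun_apply T (\<Lambda> y) = \<Lambda> (f y))"
proof -
  \<comment> \<open>A preimage under \<Lambda> is chosen; the estimate \<open>dist\<close> shows
    that the value does not depend on the choice.\<close>
  define g where "g v = \<Lambda> (f (SOME y. y \<in> N \<and> \<Lambda> y = v))" for v
  have dist: "norm (\<Lambda> (f y) - \<Lambda> (f z)) \<le> C * norm (\<Lambda> y - \<Lambda> z)" if "y \<in> N" "z \<in> N" for y z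
    using bd[of "y + scaleC_op (-1) z"] that f
    by (simp add: f_add f_scale \<Lambda>D scaleC_minus1)
  have g: "g (\<Lambda> y) = \<Lambda> (f y)" if "y \<in> N" for y
  proof -
    have s: "(SOME z. z \<in> N \<and> \<Lambda> z = \<Lambda> y) \<in> N \<and> \<Lambda> (SOME z. z \<in> N \<and> \<Lambda> z = \<Lambda> y) = \<Lambda> y"
      by (rule someI[of _ y]) (use that in simp)
    show ?thesis using dist[of "SOME z. z \<in> N \<and> \<Lambda> z = \<Lambda> y" y] s that by (simp add: g_def)
  qed
  have "C-lipschitz_on (\<Lambda> ` N) g"
    using C dist by (intro lipschitz_onI) (auto simp: g dist_norm)
  then obtain h where h: "uniformly_continuous_on (closure (\<Lambda> ` N)) h" "\<And>v. v \<in> \<Lambda> ` N \<Longrightarrow> g v = h v"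
    using uniformly_continuous_on_extension_on_closure[OF lipschitz_on_uniformly_continuous] by metis
  have cont: "continuous_on UNIV h" using h(1) \<Lambda>D(4) uniformly_continuous_imp_continuous by metis
  have hc: "continuous_on UNIV (\<lambda>v. h (k v))" if "continuous_on UNIV k" for k :: "'k \<Rightarrow> 'k"
    by (rule continuous_on_compose2[OF cont that]) simp
  have h\<Lambda>: "h (\<Lambda> y) = \<Lambda> (f y)" if "y \<in> N" for y using g h(2) that by simp
  have add: "h (v + w) = h v + h w" for v w
  proof (rule L2_induct[of "\<lambda>v. h (v + w) = h v + h w"])
    show "closed {v. h (v + w) = h v + h w}"
      by (intro closed_Collect_eq continuous_intros hc cont)
    fix y assume y: "y \<in> N"
    show "h (\<Lambda> y + w) = h (\<Lambda> y) + h w"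
    proof (rule L2_induct[of "\<lambda>w. h (\<Lambda> y + w) = h (\<Lambda> y) + h w"])
      show "closed {w. h (\<Lambda> y + w) = h (\<Lambda> y) + h w}"
        by (intro closed_Collect_eq continuous_intros hc cont)
      fix z assume z: "z \<in> N"
      show "h (\<Lambda> y + \<Lambda> z) = h (\<Lambda> y) + h (\<Lambda> z)"
        using h\<Lambda>[of "y + z"] y z by (simp add: \<Lambda>D h\<Lambda> f f_add)
    qed
  qed
  have contC: "continuous_on UNIV (\<lambda>v::'k. c *\<^sub>C k v)" if "continuous_on UNIV k" for c and k :: "'k \<Rightarrow> 'k"
    using bounded_linear.continuous_on[OF bounded_linear_scaleC that] .
  have scC: "h (c *\<^sub>C v) = c *\<^sub>C h v" for c v
  proof (rule L2_induct[of "\<lambda>v. h (c *\<^sub>C v) = c *\<^sub>C h v"])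
    show "closed {v. h (c *\<^sub>C v) = c *\<^sub>C h v}"
      by (intro closed_Collect_eq hc contC cont continuous_on_id)
    show "h (c *\<^sub>C \<Lambda> y) = c *\<^sub>C h (\<Lambda> y)" if "y \<in> N" for y
      using h\<Lambda>[of "scaleC_op c y"] that by (simp add: \<Lambda>D h\<Lambda> f f_scale)
  qed
  have bnd: "norm (h v) \<le> C * norm v" for v
  proof (rule L2_induct[of "\<lambda>v. norm (h v) \<le> C * norm v"])
    show "closed {v. norm (h v) \<le> C * norm v}"
      by (intro closed_Collect_le continuous_intros cont)
  qed (simp add: h\<Lambda> bd)
  have bl: "bounded_linear h"
  proof (rule bounded_linear_intro[where K = C])
    show "norm (h v) \<le> norm v * C" for v using bnd[of v] by (simp add: mult.commute)
  qed (simp_all add: add scC scaleR_scaleC)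
  show ?thesis
  proof (intro bexI[of _ "Blinfun h"] conjI ballI)
    show "norm (Blinfun h) \<le> C"
      by (rule norm_blinfun_bound[OF C]) (auto simp: bounded_linear_Blinfun_apply[OF bl] bnd)
    show "Blinfun h \<in> cops" by (simp add: cops_def bounded_linear_Blinfun_apply[OF bl] scC)
  qed (simp add: bounded_linear_Blinfun_apply[OF bl] h\<Lambda>)
qed

text \<open>Identifying \<open>\<delta>\<^sub>n \<otimes> \<Lambda>(y)\<close> with \<open>u\<^sup>n \<pi>(y)\<close>, the operator \<open>right_op m z\<close> below is right
  multiplication by \<open>u\<^sup>m \<pi>(z)\<close>, because \<open>\<pi>(y) u\<^sup>m = u\<^sup>m \<pi>(\<theta>\<^sup>-\<^sup>m(y))\<close>.\<close>

definition right_block :: "int \<Rightarrow> ('h \<Rightarrow>\<^sub>L 'h) \<Rightarrow> ('k \<Rightarrow>\<^sub>L 'k)" where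
  "right_block m z = (SOME T. T \<in> cops \<and> norm T \<le> norm (adj z) \<and>
     (\<forall>y\<in>N. blinfun_apply T (\<Lambda> y) = \<Lambda> (\<alpha> (- m) y o\<^sub>L z)))"

definition right_op :: "int \<Rightarrow> ('h \<Rightarrow>\<^sub>L 'h) \<Rightarrow> ('k ell2Z \<Rightarrow>\<^sub>L 'k ell2Z)" where
  "right_op m z = amp m (right_block m z)"

text \<open>By traciality \<Lambda> has the same norm at an element and at its adjoint, and adjoints
  turn right multiplication by \<open>z\<close> into left multiplication by \<open>adj z\<close>.
  This is why the bound is \<open>norm (adj z)\<close>.\<close>

lemma right_block:
  assumes z: "z \<in> N"
  shows "right_block m z \<in> cops" "norm (right_block m z) \<le> norm (adj z)"
    "\<And>y. y \<in> N \<Longrightarrow> right_block m z (\<Lambda> y) = \<Lambda> (\<alpha> (- m) y o\<^sub>L z)"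
proof -
  have "\<exists>T \<in> cops. norm T \<le> norm (adj z) \<and> (\<forall>y\<in>N. blinfun_apply T (\<Lambda> y) = \<Lambda> (\<alpha> (- m) y o\<^sub>L z))"
  proof (rule L2_operator_exists)
    fix y assume y: "y \<in> N"
    have "norm (\<Lambda> (\<alpha> (- m) y o\<^sub>L z)) = norm (\<Lambda> (adj z o\<^sub>L adj (\<alpha> (- m) y)))"
      using y z norm_\<Lambda>_adj[of "\<alpha> (- m) y o\<^sub>L z"] by (simp add: adj_compose)
    also have "\<dots> \<le> norm (adj z) * norm (\<Lambda> (adj (\<alpha> (- m) y)))"
      using y z by (intro norm_L2_mult[OF N tr L2]) auto
    also have "\<dots> = norm (adj z) * norm (\<Lambda> y)" using y by (simp add: norm_\<Lambda>_adj norm_\<Lambda>_\<alpha>)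
    finally show "norm (\<Lambda> (\<alpha> (- m) y o\<^sub>L z)) \<le> norm (adj z) * norm (\<Lambda> y)" .
  qed (use z in \<open>auto simp: \<alpha>D blinfun_eq_iff blinfun.add_left scaleC_op.rep_eq\<close>)
  from someI_ex[OF this[unfolded Bex_def]]
  show "right_block m z \<in> cops" "norm (right_block m z) \<le> norm (adj z)"
    "\<And>y. y \<in> N \<Longrightarrow> right_block m z (\<Lambda> y) = \<Lambda> (\<alpha> (- m) y o\<^sub>L z)"
    unfolding right_block_def by auto
qed

lemma right_op:
  assumes z: "z \<in> N"
  shows "right_op m z \<in> cops" "norm (right_op m z) \<le> norm (adj z)"
    "\<And>y. y \<in> N \<Longrightarrow> right_op m z (delta n (\<Lambda> y)) = delta (n + m) (\<Lambda> (\<alpha> (- m) y o\<^sub>L z))"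
    "right_op m z \<Omega> = delta m (\<Lambda> z)"
  using right_block[OF z] norm_amp[of m "right_block m z"]
  by (auto simp: right_op_def cops_amp blinfun_compose_id intro: order_trans)

text \<open>The formula reflects
  \<open>adj (u^m \<pi>(z)) = u^(-m) \<pi>(\<alpha> m (adj z))\<close>. On dense vectors it follows
  by applying the trace preserving \<open>\<alpha> m\<close> under the trace and then
  cyclicity.\<close>

lemma adj_right_block:
  assumes z: "z \<in> N"
  shows "adj (right_block m z) = right_block (- m) (\<alpha> m (adj z))"
proof (rule adj_unique[OF right_block(1)[OF z]])
  let ?S = "right_block (- m) (\<alpha> m (adj z))"
  note lin = bounded_linear.continuous_on[OF bounded_linear_cinner_left]
    bounded_linear.continuous_on[OF bounded_linear_cinner_right]
  fix v w
  show "cinner (right_block m z v) w = cinner v (?S w)"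
  proof (rule L2_induct[of "\<lambda>v. cinner (right_block m z v) w = cinner v (?S w)"])
    show "closed {v. cinner (right_block m z v) w = cinner v (?S w)}"
      by (intro closed_Collect_eq lin continuous_intros)
    fix y assume y: "y \<in> N"
    show "cinner (right_block m z (\<Lambda> y)) w = cinner (\<Lambda> y) (?S w)"
    proof (rule L2_induct[of "\<lambda>w. cinner (right_block m z (\<Lambda> y)) w = cinner (\<Lambda> y) (?S w)"])
      show "closed {w. cinner (right_block m z (\<Lambda> y)) w = cinner (\<Lambda> y) (?S w)}"
        by (intro closed_Collect_eq lin continuous_intros)
      fix x assume x: "x \<in> N"
      have "cinner (right_block m z (\<Lambda> y)) (\<Lambda> x) = tr (adj (\<alpha> (- m) y o\<^sub>L z) o\<^sub>L x)"
        using x y z by (simp add: right_block \<Lambda>D)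
      also have "\<dots> = tr (adj z o\<^sub>L (\<alpha> (- m) (adj y) o\<^sub>L x))"
        using x y z by (simp add: adj_compose \<alpha>D blinfun_compose_assoc)
      also have "\<dots> = tr (\<alpha> m (adj z o\<^sub>L (\<alpha> (- m) (adj y) o\<^sub>L x)))"
        using x y z by (intro \<alpha>D(6)[symmetric] NI \<alpha>_mem)
      also have "\<dots> = tr (\<alpha> m (adj z) o\<^sub>L (adj y o\<^sub>L \<alpha> m x))"
        using x y z by (simp add: \<alpha>D(3) \<alpha>_\<alpha>)
      also have "\<dots> = tr (adj y o\<^sub>L (\<alpha> m x o\<^sub>L \<alpha> m (adj z)))"
        using x y z by (subst trD(3)) (auto simp: blinfun_compose_assoc)
      also have "\<dots> = cinner (\<Lambda> y) (?S (\<Lambda> x))"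
        using x y z by (simp add: right_block \<Lambda>D)
      finally show "cinner (right_block m z (\<Lambda> y)) (\<Lambda> x) = cinner (\<Lambda> y) (?S (\<Lambda> x))" .
    qed
  qed
qed

lemma adj_right_op: "z \<in> N \<Longrightarrow> adj (right_op m z) = right_op (- m) (\<alpha> m (adj z))"
  by (simp add: right_op_def adj_amp right_block adj_right_block)

lemma crossed_rep_cops: assumes x: "x \<in> N" shows "crossed_rep N \<theta> \<Lambda> x \<in> cops"
  using left_mult(1)[OF N tr L2 \<alpha>_mem[OF x]]
  by (auto simp: cops_def coord_crossed_rep[OF N tr L2 \<theta> \<theta>tr x] intro!: coord_inject_ext)

text \<open>Left and right multiplications commute by associativity. In coordinates,
  \<open>right_op m z\<close> shifts the index by \<open>m\<close>, which changes the left factor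
  from \<open>\<alpha> (- n) x\<close> to \<open>\<alpha> (m - n) x\<close>; the twist
  \<open>\<alpha> (- m)\<close> in \<open>right_block\<close> undoes this.\<close>

lemma right_op_commutes:
  assumes z: "z \<in> N" and g: "g \<in> insert crossed_unitary (crossed_rep N \<theta> \<Lambda> ` N)"
  shows "right_op m z o\<^sub>L g = g o\<^sub>L right_op m z"
proof (cases "g = crossed_unitary")
  case True
  then show ?thesis
    by (simp add: crossed_unitary_eq_amp right_op_def amp_compose blinfun_compose_id add.commute)
next
  case False
  then obtain x where x: "x \<in> N" "g = crossed_rep N \<theta> \<Lambda> x" using g by auto
  have com: "right_block m z (left_mult N \<Lambda> (\<alpha> (m - n) x) v) = left_mult N \<Lambda> (\<alpha> (- n) x) (right_block m z v)"
    for n v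
  proof (rule L2_induct[of "\<lambda>v. right_block m z (left_mult N \<Lambda> (\<alpha> (m - n) x) v)
      = left_mult N \<Lambda> (\<alpha> (- n) x) (right_block m z v)"])
    show "closed {v. right_block m z (left_mult N \<Lambda> (\<alpha> (m - n) x) v)
        = left_mult N \<Lambda> (\<alpha> (- n) x) (right_block m z v)}"
      by (intro closed_Collect_eq continuous_intros)
    fix y assume y: "y \<in> N"
    have "\<alpha> (- m) (\<alpha> (m - n) x o\<^sub>L y) o\<^sub>L z = \<alpha> (- n) x o\<^sub>L (\<alpha> (- m) y o\<^sub>L z)"
      using x y z by (simp add: \<alpha>D(3) \<alpha>_\<alpha> blinfun_compose_assoc)
    then show "right_block m z (left_mult N \<Lambda> (\<alpha> (m - n) x) (\<Lambda> y))
        = left_mult N \<Lambda> (\<alpha> (- n) x) (right_block m z (\<Lambda> y))"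
      using x y z by (simp add: right_block left_mult(3)[OF N tr L2])
  qed
  show ?thesis
  proof (intro blinfun_eqI coord_inject_ext)
    fix \<xi> n
    show "coord ((right_op m z o\<^sub>L g) \<xi>) n = coord ((g o\<^sub>L right_op m z) \<xi>) n"
      using com[of n "coord \<xi> (n - m)"] x(1)
      by (simp add: x(2) right_op_def coord_crossed_rep[OF N tr L2 \<theta> \<theta>tr])
  qed
qed

lemma generators_cops: "insert crossed_unitary (crossed_rep N \<theta> \<Lambda> ` N) \<subseteq> cops"
  using crossed_unitary_cops crossed_rep_cops by auto

text \<open>Adjoints of right multiplications are right multiplications, so commuting with the
  generators also yields commuting with their adjoints.\<close>

lemma right_op_commutant:
  assumes z: "z \<in> N"
  shows "right_op m z \<in> commutant (insert crossed_unitary (crossed_rep N \<theta> \<Lambda> ` N) \<union>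
    adj ` insert crossed_unitary (crossed_rep N \<theta> \<Lambda> ` N))" (is "_ \<in> commutant (?G \<union> _)")
proof -
  have "right_op m z o\<^sub>L adj g = adj g o\<^sub>L right_op m z" if g: "g \<in> ?G" for g
  proof -
    have gc: "g \<in> cops" using generators_cops g by blast
    have a: "adj (right_op m z) o\<^sub>L g = g o\<^sub>L adj (right_op m z)"
      using right_op_commutes[OF _ g] z by (simp add: adj_right_op)
    have "adj (adj (right_op m z) o\<^sub>L g) = adj (g o\<^sub>L adj (right_op m z))" by (simp only: a)
    then show ?thesis
      using gc right_op(1)[OF z] by (simp add: adj_compose cops_adj adj_adj)
  qed
  then show ?thesis using right_op_commutes[OF z] right_op(1)[OF z] unfolding commutant_def by blast
qed

section \<open>The algebra \<open>M\<close> and its action on \<Omega>\<close>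

lemma M_vn: "von_neumann_algebra M"
  unfolding crossed_product_def by (rule vn_generated[OF generators_cops])

lemmas MI [simp, intro] = von_neumann_algebraD(2-)[OF M_vn]
lemmas M_cops [simp, intro] = subsetD[OF von_neumann_algebraD(1)[OF M_vn]]

lemma M_diff [simp, intro]: "S \<in> M \<Longrightarrow> T \<in> M \<Longrightarrow> S - T \<in> M"
  unfolding minus_op_eq by blast

lemma B_vn: "von_neumann_algebra B"
  by (rule vn_generated) (simp add: crossed_unitary_cops)

lemma B_subset_M: "B \<subseteq> M"
  unfolding crossed_product_def by (rule vn_generated_mono) simp

lemma U_B: "U m \<in> B"
  by (rule amp_id_in_vn_generated)

lemma U_M [simp, intro]: "U m \<in> M"
  using U_B B_subset_M by blast

lemma M_right_op: "T \<in> M \<Longrightarrow> z \<in> N \<Longrightarrow> T (right_op m z \<xi>) = right_op m z (T \<xi>)"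
  using right_op_commutant[of z m] commutant_apply unfolding crossed_product_def vn_generated_def by metis

text \<open>Recovers the values of \<open>T\<close> at elementary vectors from
  \<open>T \<Omega>\<close>; through this identity statements at \<Omega> spread to the whole
  space.\<close>

lemma M_delta: "T \<in> M \<Longrightarrow> z \<in> N \<Longrightarrow> T (delta m (\<Lambda> z)) = right_op m z (T \<Omega>)"
  using M_right_op[of T z m \<Omega>] by (simp add: right_op)

lemma \<Omega>_separating:
  assumes T: "T \<in> M" and 0: "T \<Omega> = 0"
  shows "T = 0"
proof (rule blinfun_eqI)
  fix \<xi>
  have "T \<xi> = 0"
  proof (rule ell2Z_induct[of "\<lambda>\<xi>. T \<xi> = 0"])
    show "closed {\<xi>. T \<xi> = 0}" by (intro closed_Collect_eq continuous_intros)
  qed (auto simp: blinfun.add_right M_delta[OF T] 0)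
  then show "T \<xi> = blinfun_apply 0 \<xi>" by simp
qed

section \<open>The trace property\<close>

text \<open>This is the tracial duality \<open>\<langle>T\<^sup>*\<Omega>, R\<Omega>\<rangle> = \<langle>R\<^sup>*\<Omega>, T\<Omega>\<rangle>\<close> for right multiplications \<open>R\<close>, read off in
  coordinates.\<close>

lemma cinner_coord_adj:
  assumes T: "T \<in> M" and y: "y \<in> N"
  shows "cinner (coord (adj T \<Omega>) m) (\<Lambda> y) = cinner (\<Lambda> (\<alpha> m (adj y))) (coord (T \<Omega>) (- m))"
proof -
  have "cinner (coord (adj T \<Omega>) m) (\<Lambda> y) = cinner (adj T \<Omega>) (right_op m y \<Omega>)"
    using y by (simp add: right_op cinner_delta_right)
  also have "\<dots> = cinner \<Omega> (right_op m y (T \<Omega>))"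
    using T y by (simp add: adj_adjoint' M_right_op)
  also have "\<dots> = cinner (adj (right_op m y) \<Omega>) (T \<Omega>)"
    using y by (simp add: adj_adjoint' right_op)
  also have "\<dots> = cinner (\<Lambda> (\<alpha> m (adj y))) (coord (T \<Omega>) (- m))"
    using y by (simp add: adj_right_op right_op cinner_delta_left)
  finally show ?thesis .
qed

text \<open>By \<open>cinner_coord_adj\<close>, coordinate \<open>m\<close> of
  \<open>adj T \<Omega>\<close> defines a functional bounded by the norm of coordinate
  \<open>- m\<close> of \<open>T \<Omega>\<close>, since \<open>\<alpha> m\<close> and adjoints
  preserve the norm of \<Lambda>. The squares are then summed after reflecting the index.\<close>

lemma norm_adj_\<Omega>_le:
  assumes T: "T \<in> M"
  shows "norm (adj T \<Omega>) \<le> norm (T \<Omega>)"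
proof (rule power2_le_imp_le)
  have le: "norm (coord (adj T \<Omega>) m) \<le> norm (coord (T \<Omega>) (- m))" for m
  proof -
    let ?x = "coord (adj T \<Omega>) m"
    have "cmod (cinner ?x v) \<le> norm (coord (T \<Omega>) (- m)) * norm v" for v
    proof (rule L2_induct[of "\<lambda>v. cmod (cinner ?x v) \<le> norm (coord (T \<Omega>) (- m)) * norm v"])
      show "closed {v. cmod (cinner ?x v) \<le> norm (coord (T \<Omega>) (- m)) * norm v}"
        by (intro closed_Collect_le continuous_intros bounded_linear.continuous_on[OF bounded_linear_cinner_right])
      fix y assume y: "y \<in> N"
      have "cmod (cinner ?x (\<Lambda> y)) \<le> norm (\<Lambda> (\<alpha> m (adj y))) * norm (coord (T \<Omega>) (- m))"
        unfolding cinner_coord_adj[OF T y] by (rule cmod_cinner_le)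
      then show "cmod (cinner ?x (\<Lambda> y)) \<le> norm (coord (T \<Omega>) (- m)) * norm (\<Lambda> y)"
        using y by (simp add: norm_\<Lambda>_\<alpha> norm_\<Lambda>_adj mult.commute)
    qed
    from this[of ?x] have "norm ?x * norm ?x \<le> norm (coord (T \<Omega>) (- m)) * norm ?x"
      by (simp add: cinner_self power2_eq_square norm_mult)
    then show ?thesis by (cases "norm ?x = 0") (auto simp: mult_le_cancel_right)
  qed
  have b: "bij_betw uminus UNIV (UNIV :: int set)"
    by (rule bij_betw_byWitness[where f' = uminus]; simp)
  have s: "(\<lambda>n. (norm (coord (T \<Omega>) (- n)))\<^sup>2) summable_on UNIV"
    using summable_on_reindex_bij_betw[OF b, of "\<lambda>n. (norm (coord (T \<Omega>) n))\<^sup>2"] coord_summable by simp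
  have "(norm (adj T \<Omega>))\<^sup>2 \<le> (\<Sum>\<^sub>\<infinity>n. (norm (coord (T \<Omega>) (- n)))\<^sup>2)"
    unfolding norm_ell2Z_square by (intro infsum_mono coord_summable s power_mono le) simp
  also have "\<dots> = (norm (T \<Omega>))\<^sup>2"
    using infsum_reindex_bij_betw[OF b, of "\<lambda>n. (norm (coord (T \<Omega>) n))\<^sup>2"]
    by (simp add: norm_ell2Z_square)
  finally show "(norm (adj T \<Omega>))\<^sup>2 \<le> (norm (T \<Omega>))\<^sup>2" .
qed simp

lemma norm_adj_\<Omega>: assumes T: "T \<in> M" shows "norm (adj T \<Omega>) = norm (T \<Omega>)"
  using norm_adj_\<Omega>_le[OF T] norm_adj_\<Omega>_le[OF MI(1)[OF T]] T by (simp add: adj_adj)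

text \<open>This is \<open>\<tau> (S o\<^sub>L adj T) = \<tau> (adj T o\<^sub>L S)\<close>, the
  trace property in vector form. Polarization derives the real part from
  \<open>norm_adj_\<Omega>\<close>; replacing \<open>S\<close> by \<open>scaleC_op \<i> S\<close>
  gives the imaginary part.\<close>

lemma cinner_adj_\<Omega>:
  assumes S: "S \<in> M" and T: "T \<in> M"
  shows "cinner (adj S \<Omega>) (adj T \<Omega>) = cinner (T \<Omega>) (S \<Omega>)"
proof -
  have Re: "Re (cinner (adj S \<Omega>) (adj T \<Omega>)) = Re (cinner (T \<Omega>) (S \<Omega>))" if S: "S \<in> M" for S
  proof -
    have n: "norm (adj S \<Omega> + adj T \<Omega>) = norm (S \<Omega> + T \<Omega>)"
      using norm_adj_\<Omega>[of "S + T"] S T by (simp add: adj_add blinfun.add_left)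
    have p: "inner x y = ((norm (x + y))\<^sup>2 - (norm x)\<^sup>2 - (norm y)\<^sup>2) / 2" for x y :: "'k ell2Z"
      by (simp add: power2_norm_eq_inner inner_add inner_commute)
    have "inner (adj S \<Omega>) (adj T \<Omega>) = inner (S \<Omega>) (T \<Omega>)"
      unfolding p n norm_adj_\<Omega>[OF S] norm_adj_\<Omega>[OF T] ..
    then show ?thesis by (metis inner_cinner inner_commute)
  qed
  show ?thesis
  proof (rule complex_eqI[OF Re[OF S]])
    have "Re (cinner (adj (scaleC_op \<i> S) \<Omega>) (adj T \<Omega>)) = Re (cinner (T \<Omega>) (scaleC_op \<i> S \<Omega>))"
      using S by (intro Re) auto
    then show "Im (cinner (adj S \<Omega>) (adj T \<Omega>)) = Im (cinner (T \<Omega>) (S \<Omega>))"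
      using S by (simp add: adj_scaleC scaleC_op.rep_eq cinner_simps)
  qed
qed

lemma norm_\<Omega>: "norm \<Omega> = 1"
proof -
  have "cinner (\<Lambda> id_blinfun) (\<Lambda> id_blinfun) = 1" by (simp add: \<Lambda>D adj_id blinfun_compose_id tr1)
  then have "(norm (\<Lambda> id_blinfun))\<^sup>2 = 1" unfolding cinner_self using of_real_eq_1_iff by blast
  then show ?thesis by (simp add: power2_eq_1_iff)  (smt (verit) norm_ge_zero)
qed

lemma norm2_\<tau>: "T \<in> M \<Longrightarrow> norm2 \<tau> T = norm (T \<Omega>)"
  using adj_adjoint[of T \<Omega> "T \<Omega>", symmetric]
  by (simp add: norm2_def crossed_trace_def cinner_self)

text \<open>The trace is written as an inner product of two adjoint vectors so that
  \<open>cinner_adj_\<Omega>\<close> applies; the two factors \<open>w\<close> then cancel.\<close>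

lemma \<tau>_unitary_conj:
  assumes w: "w \<in> M" "unitary_op w" and T: "T \<in> M"
  shows "\<tau> (w o\<^sub>L T o\<^sub>L adj w) = \<tau> T"
proof -
  have e: "adj w o\<^sub>L w = id_blinfun" using w by (simp add: unitary_op_def)
  have e': "adj w (w x) = x" for x using arg_cong[OF e, of "\<lambda>T. blinfun_apply T x"] by simp
  have "\<tau> (w o\<^sub>L T o\<^sub>L adj w) = cinner (adj w \<Omega>) (adj (w o\<^sub>L adj T) \<Omega>)"
    using w T by (simp add: crossed_trace_def adj_adjoint' adj_compose adj_adj cops_adj)
  also have "\<dots> = cinner (w (adj T \<Omega>)) (w \<Omega>)"
    using w T by (subst cinner_adj_\<Omega>) auto
  also have "\<dots> = cinner (adj T \<Omega>) \<Omega>" using w by (simp add: adj_adjoint e')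
  also have "\<dots> = \<tau> T" using T by (simp add: crossed_trace_def adj_adjoint')
  finally show ?thesis .
qed

end

section \<open>The mean ergodic theorem and the conditional expectation\<close>

text \<open>For a unit vector \<open>e\<close> this is the orthogonal projection onto its complex
  span.\<close>

lift_definition rank_one :: "'k::chilbert_space \<Rightarrow> 'k \<Rightarrow>\<^sub>L 'k" is "\<lambda>e v. cinner e v *\<^sub>C e"
proof (rule bounded_linear_intro)
  fix e v :: 'k
  show "norm (cinner e v *\<^sub>C e) \<le> norm v * (norm e * norm e)"
    using mult_right_mono[OF cmod_cinner_le[of e v], of "norm e"] by (simp add: norm_scaleC mult_ac)
qed (simp_all add: cinner_simps scaleC_add_left scaleR_scaleC scaleC_scaleC)

lemma cops_rank_one: "rank_one e \<in> cops"
  by (simp add: cops_def rank_one.rep_eq cinner_simps scaleC_scaleC)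

lemma adj_rank_one: "adj (rank_one e) = rank_one e"
proof (rule adj_unique[OF cops_rank_one])
  show "cinner (rank_one e x) y = cinner x (rank_one e y)" for x y
    using cinner_commute[of e x] by (simp add: rank_one.rep_eq cinner_simps)
qed

text \<open>If every term were at least \<open>e\<close>, so would be every mean with
  \<open>n > 0\<close>.\<close>

lemma cesaro_null_frequently_small:
  assumes f: "cesaro_null f" and e: "e > 0"
  shows "\<exists>k. f k < e"
proof (rule ccontr)
  assume "\<not> ?thesis"
  then have "e \<le> 1 / real n * (\<Sum>k<n. f k)" if "n > 0" for n
    using sum_mono[of "{..<n}" "\<lambda>_. e" f] that by (simp add: not_less field_simps)
  then have "e \<le> 0"
    using f unfolding cesaro_null_def
    by (intro tendsto_lowerbound[of _ 0 sequentially]) (auto intro!: eventually_sequentiallyI[of 1])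
  then show False using e by simp
qed

text \<open>Each distance from \<open>j\<close> occurs at most once on either side of
  \<open>j\<close>, which gives the factor 2.\<close>

lemma sum_distance_le:
  fixes b :: "nat \<Rightarrow> real"
  assumes b: "\<And>d. 0 \<le> b d" and j: "j < n"
  shows "(\<Sum>k<n. if k \<le> j then b (j - k) else b (k - j)) \<le> 2 * (\<Sum>d<n. b d)"
proof -
  have 1: "(\<Sum>k\<in>{..<n} \<inter> {k. k \<le> j}. b (j - k)) \<le> (\<Sum>d<n. b d)"
  proof -
    have "(\<Sum>k\<in>{..<n} \<inter> {k. k \<le> j}. b (j - k)) = (\<Sum>d\<in>(\<lambda>k. j - k) ` ({..<n} \<inter> {k. k \<le> j}). b d)"
      by (subst sum.reindex) (auto simp: inj_on_def)
    also have "\<dots> \<le> (\<Sum>d<n. b d)" using j b by (intro sum_mono2) auto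
    finally show ?thesis .
  qed
  have 2: "(\<Sum>k\<in>{..<n} \<inter> - {k. k \<le> j}. b (k - j)) \<le> (\<Sum>d<n. b d)"
  proof -
    have "(\<Sum>k\<in>{..<n} \<inter> - {k. k \<le> j}. b (k - j)) = (\<Sum>d\<in>(\<lambda>k. k - j) ` ({..<n} \<inter> - {k. k \<le> j}). b d)"
      by (subst sum.reindex) (auto simp: inj_on_def)
    also have "\<dots> \<le> (\<Sum>d<n. b d)" using j b by (intro sum_mono2) auto
    finally show ?thesis .
  qed
  have "(\<Sum>k<n. if k \<le> j then b (j - k) else b (k - j))
      = (\<Sum>k\<in>{..<n} \<inter> {k. k \<le> j}. b (j - k)) + (\<Sum>k\<in>{..<n} \<inter> - {k. k \<le> j}. b (k - j))"
    by (rule sum.If_cases) simp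
  then show ?thesis using 1 2 by linarith
qed

lemma norm_contraction_sandwich:
  assumes "norm V \<le> 1" shows "norm (S o\<^sub>L V o\<^sub>L T) \<le> norm S * norm T"
proof -
  have "norm (S o\<^sub>L V o\<^sub>L T) \<le> norm (S o\<^sub>L V) * norm T" by (rule norm_blinfun_compose)
  also have "\<dots> \<le> norm S * norm V * norm T" by (intro mult_right_mono norm_blinfun_compose) simp
  also have "\<dots> \<le> norm S * 1 * norm T" by (intro mult_right_mono mult_left_mono assms) auto
  finally show ?thesis by simp
qed

lemma norm_average_le:
  fixes f :: "nat \<Rightarrow> 'a::real_normed_vector"
  assumes "\<And>k. norm (f k) \<le> C"
  shows "norm ((1 / real n) *\<^sub>R (\<Sum>k<n. f k)) \<le> C"
proof (cases "n = 0")
  case True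
  then show ?thesis using order_trans[OF norm_ge_zero assms] by simp
next
  case False
  have "norm (\<Sum>k<n. f k) \<le> (\<Sum>k<n. C)" by (rule order_trans[OF norm_sum sum_mono]) (rule assms)
  then show ?thesis using False by (simp add: field_simps)
qed

lemma average_const: "n > 0 \<Longrightarrow> (1 / real n) *\<^sub>R (\<Sum>k<n. x) = x" for x :: "'a::real_vector"
  by (simp add: sum_constant_scaleR)

lemma average_apply:
  "blinfun_apply ((1 / real n) *\<^sub>R (\<Sum>k<n. f k)) x = (1 / real n) *\<^sub>R (\<Sum>k<n. blinfun_apply (f k) x)"
  by (simp add: blinfun.scaleR_left blinfun.sum_left)

lemma positive_op_conj:
  assumes "T \<in> cops" "positive_op x"
  shows "positive_op (adj T o\<^sub>L x o\<^sub>L T)"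
  using assms by (simp add: positive_op_def cops_compose cops_adj adj_adjoint[symmetric])

locale weakly_mixing_system = tracial_system N tr \<theta> \<Lambda>
  for N :: "('h::chilbert_space \<Rightarrow>\<^sub>L 'h) set"
    and tr :: "('h \<Rightarrow>\<^sub>L 'h) \<Rightarrow> complex"
    and \<theta> :: "('h \<Rightarrow>\<^sub>L 'h) \<Rightarrow> ('h \<Rightarrow>\<^sub>L 'h)"
    and \<Lambda> :: "('h \<Rightarrow>\<^sub>L 'h) \<Rightarrow> 'k::chilbert_space" +
  assumes mix: "weakly_mixing N tr \<theta>"
begin

abbreviation "Q \<equiv> amp 0 (rank_one (\<Lambda> id_blinfun))"

lemma norm_\<Lambda>_id: "norm (\<Lambda> id_blinfun) = 1"
  using norm_\<Omega> by simp

lemma coord_Q: "coord (Q \<xi>) n = cinner (\<Lambda> id_blinfun) (coord \<xi> n) *\<^sub>C \<Lambda> id_blinfun"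
  by (simp add: rank_one.rep_eq)

lemma Q_delta: "y \<in> N \<Longrightarrow> Q (delta m (\<Lambda> y)) = delta m (tr y *\<^sub>C \<Lambda> id_blinfun)"
  by (simp add: rank_one.rep_eq \<Lambda>D adj_id)

lemma Q_cops: "Q \<in> cops"
  by (rule cops_amp[OF cops_rank_one])

lemma Q_adj: "adj Q = Q"
  by (simp add: adj_amp cops_rank_one adj_rank_one)

lemma Q_Q: "Q (Q \<xi>) = Q \<xi>"
  using norm_\<Lambda>_id
  by (intro coord_inject_ext) (simp add: rank_one.rep_eq cinner_simps scaleC_scaleC cinner_self)

lemma Q_\<Omega>: "Q \<Omega> = \<Omega>"
  using NI(2) by (simp only: Q_delta tr1 scaleC_one)

lemma Q_Pythagoras: "(norm (\<xi> - Q \<xi>))\<^sup>2 = (norm \<xi>)\<^sup>2 - (norm (Q \<xi>))\<^sup>2"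
proof -
  have "cinner (Q \<xi>) \<xi> = cinner (Q \<xi>) (Q \<xi>)" "cinner \<xi> (Q \<xi>) = cinner (Q \<xi>) (Q \<xi>)"
    using adj_adjoint[OF Q_cops, of \<xi> "Q \<xi>"] adj_adjoint[OF Q_cops, of "Q \<xi>" \<xi>]
    by (simp_all only: Q_adj Q_Q)
  then have "inner (Q \<xi>) \<xi> = inner (Q \<xi>) (Q \<xi>)" by (simp only: inner_cinner)
  then show ?thesis by (simp add: power2_norm_eq_inner inner_diff inner_commute del: coord_amp)
qed

lemma norm_Q_le: "norm (Q \<xi>) \<le> norm \<xi>"
proof (rule power2_le_imp_le)
  show "(norm (Q \<xi>))\<^sup>2 \<le> (norm \<xi>)\<^sup>2"
    using Q_Pythagoras[of \<xi>] zero_le_power2[of "norm (\<xi> - Q \<xi>)"] by linarith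
qed simp

lemma norm_U: "norm (U m) \<le> 1"
  using norm_amp[of m id_blinfun] norm_blinfun_id_le order_trans by blast

lemma tr_adj: assumes y: "y \<in> N" shows "tr (adj y) = cnj (tr y)"
proof -
  have "tr (adj y) = cinner (\<Lambda> y) (\<Lambda> id_blinfun)" "tr y = cinner (\<Lambda> id_blinfun) (\<Lambda> y)"
    using y by (simp_all add: \<Lambda>D adj_id)
  then show ?thesis by (metis cinner_commute)
qed

lemma \<alpha>_funpow: "\<alpha> (int k) y = (\<theta> ^^ k) y"
  by (simp add: aut_power_def)

lemma mixingD:
  assumes "x \<in> N" "y \<in> N"
  shows "cesaro_null (\<lambda>k. cmod (tr (x o\<^sub>L \<alpha> (int k) y) - tr x * tr y))"
  using mix assms by (simp add: weakly_mixing_def cesaro_null_def \<alpha>_funpow)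

text \<open>The squared norm of the mean of the centred vectors \<open>v k\<close> is a double mean
  of their inner products. These depend only on \<open>k - j\<close> and are controlled by the
  mixing coefficients \<open>b\<close>, so the double mean is at most twice a null Cesaro
  mean.\<close>

lemma mean_ergodic_L2:
  assumes y: "y \<in> N"
  shows "(\<lambda>n. (1 / real n) *\<^sub>R (\<Sum>k<n. \<Lambda> (\<alpha> (int k) y))) \<longlonglongrightarrow> tr y *\<^sub>C \<Lambda> id_blinfun"
proof -
  define v where "v k = \<Lambda> (\<alpha> (int k) y) - tr y *\<^sub>C \<Lambda> id_blinfun" for k
  define b where "b d = cmod (tr (adj y o\<^sub>L \<alpha> (int d) y) - tr (adj y) * tr y)" for d
  have b: "cesaro_null b" unfolding b_def using y by (intro mixingD) auto
  have ip: "cinner (v j) (v k) = tr (adj y o\<^sub>L \<alpha> (int k - int j) y) - tr (adj y) * tr y" for j k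
  proof -
    have "tr (adj (\<alpha> (int j) y) o\<^sub>L \<alpha> (int k) y) = tr (\<alpha> (int j) (adj y o\<^sub>L \<alpha> (int k - int j) y))"
      using y by (simp add: \<alpha>D(3,5) \<alpha>_\<alpha>)
    also have "\<dots> = tr (adj y o\<^sub>L \<alpha> (int k - int j) y)" using y by (intro \<alpha>D(6)) auto
    finally have "cinner (\<Lambda> (\<alpha> (int j) y)) (\<Lambda> (\<alpha> (int k) y)) = tr (adj y o\<^sub>L \<alpha> (int k - int j) y)"
      using y by (simp add: \<Lambda>D)
    then show ?thesis
      using y by (simp add: v_def cinner_simps \<Lambda>D adj_id tr_adj tr1 \<alpha>D(6) flip: \<alpha>D(5))
  qed
  \<comment> \<open>Weak mixing speaks of nonnegative exponents; for \<open>k \<le> j\<close> the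
    symmetry of \<open>inner\<close> swaps the two vectors.\<close>
  have le: "inner (v j) (v k) \<le> (if k \<le> j then b (j - k) else b (k - j))" for j k
  proof (cases "k \<le> j")
    case True
    have "inner (v j) (v k) \<le> cmod (cinner (v k) (v j))"
      by (metis complex_Re_le_cmod inner_cinner inner_commute)
    then show ?thesis using True by (simp add: ip b_def of_nat_diff)
  next
    case False
    have "inner (v j) (v k) \<le> cmod (cinner (v j) (v k))"
      by (metis complex_Re_le_cmod inner_cinner)
    then show ?thesis using False by (simp add: ip b_def of_nat_diff)
  qed
  have sq: "(norm ((1 / real n) *\<^sub>R (\<Sum>k<n. v k)))\<^sup>2 \<le> 2 * (1 / real n * (\<Sum>d<n. b d))" for n
  proof (cases "n = 0")
    case False
    have "(norm (\<Sum>k<n. v k))\<^sup>2 = (\<Sum>j<n. \<Sum>k<n. inner (v j) (v k))"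
      by (simp only: power2_norm_eq_inner inner_sum_left) (simp only: inner_sum_right)
    also have "\<dots> \<le> (\<Sum>j<n. \<Sum>k<n. if k \<le> j then b (j - k) else b (k - j))"
      by (intro sum_mono le)
    also have "\<dots> \<le> (\<Sum>j<n. 2 * (\<Sum>d<n. b d))"
      by (intro sum_mono sum_distance_le) (auto simp: b_def)
    finally have "(norm (\<Sum>k<n. v k))\<^sup>2 \<le> real n * (2 * (\<Sum>d<n. b d))" by simp
    then have "(1 / real n)\<^sup>2 * (norm (\<Sum>k<n. v k))\<^sup>2 \<le> (1 / real n)\<^sup>2 * (real n * (2 * (\<Sum>d<n. b d)))"
      by (rule mult_left_mono) simp
    also have "\<dots> = 2 * (1 / real n * (\<Sum>d<n. b d))" using False by (simp add: power2_eq_square)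
    finally show ?thesis by (simp add: power_mult_distrib power_divide)
  qed simp
  have lim: "(\<lambda>n. 2 * (1 / real n * (\<Sum>d<n. b d))) \<longlonglongrightarrow> 0"
    using tendsto_mult_left[OF b[unfolded cesaro_null_def], of 2] by (simp only: mult_zero_right)
  have "(\<lambda>n. (norm ((1 / real n) *\<^sub>R (\<Sum>k<n. v k)))\<^sup>2) \<longlonglongrightarrow> 0"
    by (rule tendsto_sandwich[OF always_eventually always_eventually tendsto_const lim])
       (intro allI zero_le_power2, intro allI sq)
  from tendsto_real_sqrt[OF this, unfolded real_sqrt_zero real_sqrt_abs abs_norm_cancel]
  have "(\<lambda>n. (1 / real n) *\<^sub>R (\<Sum>k<n. v k)) \<longlonglongrightarrow> 0" by (rule tendsto_norm_zero_cancel)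
  then have "(\<lambda>n. (1 / real n) *\<^sub>R (\<Sum>k<n. v k) + tr y *\<^sub>C \<Lambda> id_blinfun) \<longlonglongrightarrow> 0 + tr y *\<^sub>C \<Lambda> id_blinfun"
    by (intro tendsto_add tendsto_const)
  \<comment> \<open>The equality is claimed from \<open>n = 1\<close> on, because the mean of a
    constant is 0 for \<open>n = 0\<close>.\<close>
  moreover have "\<forall>\<^sub>F n in sequentially. (1 / real n) *\<^sub>R (\<Sum>k<n. v k) + tr y *\<^sub>C \<Lambda> id_blinfun
      = (1 / real n) *\<^sub>R (\<Sum>k<n. \<Lambda> (\<alpha> (int k) y))"
  proof (rule eventually_sequentiallyI[of 1])
    fix n :: nat assume "n \<ge> 1"
    then show "(1 / real n) *\<^sub>R (\<Sum>k<n. v k) + tr y *\<^sub>C \<Lambda> id_blinfun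
        = (1 / real n) *\<^sub>R (\<Sum>k<n. \<Lambda> (\<alpha> (int k) y))"
      using average_const[of n "tr y *\<^sub>C \<Lambda> id_blinfun"]
      unfolding v_def sum_subtractf scaleR_diff_right by simp
  qed
  ultimately have "(\<lambda>n. (1 / real n) *\<^sub>R (\<Sum>k<n. \<Lambda> (\<alpha> (int k) y))) \<longlonglongrightarrow> 0 + tr y *\<^sub>C \<Lambda> id_blinfun"
    by (rule Lim_transform_eventually)
  then show ?thesis by simp
qed

text \<open>Right translation by \<open>u^(-k)\<close> followed by \<open>U (int k)\<close> restores
  the index and sends \<open>\<Lambda> y\<close> to \<open>\<Lambda> (\<alpha> (int k) y)\<close>.
  Elementary vectors are thus covered by \<open>mean_ergodic_L2\<close>, and the uniform bound
  extends the convergence to all vectors.\<close>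

lemma mean_ergodic:
  "(\<lambda>n. (1 / real n) *\<^sub>R (\<Sum>k<n. U (int k) (right_op (- int k) id_blinfun \<xi>))) \<longlonglongrightarrow> Q \<xi>"
proof -
  define X where "X n = (1 / real n) *\<^sub>R (\<Sum>k<n. U (int k) o\<^sub>L right_op (- int k) id_blinfun)" for n
  have "norm (U (int k) o\<^sub>L right_op (- int k) id_blinfun) \<le> 1 * norm (adj id_blinfun :: 'h \<Rightarrow>\<^sub>L 'h)" for k
    by (rule order_trans[OF norm_blinfun_compose]) (intro mult_mono norm_U right_op(2), auto)
  then have bd: "norm (X n) \<le> 1 * norm (adj id_blinfun :: 'h \<Rightarrow>\<^sub>L 'h)" for n
    unfolding X_def by (rule norm_average_le)
  have d: "(\<lambda>n. X n (delta m (\<Lambda> y))) \<longlonglongrightarrow> Q (delta m (\<Lambda> y))" if y: "y \<in> N" for m y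
  proof -
    have "X n (delta m (\<Lambda> y)) = delta m ((1 / real n) *\<^sub>R (\<Sum>k<n. \<Lambda> (\<alpha> (int k) y)))" for n
      unfolding X_def average_apply linear_cmul[OF bounded_linear.linear[OF bounded_linear_delta]]
        linear_sum[OF bounded_linear.linear[OF bounded_linear_delta]]
      using y by (simp add: right_op)
    then show ?thesis
      using bounded_linear.tendsto[OF bounded_linear_delta mean_ergodic_L2[OF y], of m] y
      by (simp only: Q_delta)
  qed
  have conv: "convergent (\<lambda>n. X n \<xi>)" for \<xi>
  proof (rule ell2Z_induct[of "\<lambda>\<xi>. convergent (\<lambda>n. X n \<xi>)"])
    show "closed {\<xi>. convergent (\<lambda>n. X n \<xi>)}" by (rule closed_convergent_bounded[OF bd])
    show "convergent (\<lambda>n. X n (delta m (\<Lambda> y)))" if "y \<in> N" for m y by (rule convergentI[OF d[OF that]])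
  qed (simp add: blinfun.add_right convergent_add)
  obtain Y where Y: "\<And>\<xi>. (\<lambda>n. X n \<xi>) \<longlonglongrightarrow> blinfun_apply Y \<xi>" using exE[OF strong_limit_exists[OF bd conv]] by metis
  have "Y \<xi> = Q \<xi>" for \<xi>
  proof (rule ell2Z_induct[of "\<lambda>\<xi>. Y \<xi> = Q \<xi>"])
    show "closed {\<xi>. Y \<xi> = Q \<xi>}" by (intro closed_Collect_eq continuous_intros)
    show "Y (delta m (\<Lambda> y)) = Q (delta m (\<Lambda> y))" if "y \<in> N" for m y
      using LIMSEQ_unique[OF Y d[OF that]] .
  qed (simp add: blinfun.add_right)
  then show ?thesis using Y[of \<xi>] by (simp add: X_def average_apply)
qed

section \<open>Averages of conjugates and their limit \<open>E\<close>\<close>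

definition conj_avg :: "nat \<Rightarrow> ('k ell2Z \<Rightarrow>\<^sub>L 'k ell2Z) \<Rightarrow> ('k ell2Z \<Rightarrow>\<^sub>L 'k ell2Z)" where
  "conj_avg n T = (1 / real n) *\<^sub>R (\<Sum>k<n. U (int k) o\<^sub>L T o\<^sub>L U (- int k))"

lemma conj_avg_apply: "conj_avg n T \<xi> = (1 / real n) *\<^sub>R (\<Sum>k<n. U (int k) (T (U (- int k) \<xi>)))"
  by (simp add: conj_avg_def average_apply)

lemma norm_conj_avg: "norm (conj_avg n T) \<le> norm T"
  unfolding conj_avg_def
proof (rule norm_average_le)
  fix k
  have "norm (U (int k) o\<^sub>L T o\<^sub>L U (- int k)) \<le> norm (U (int k) o\<^sub>L T) * norm (U (- int k))"
    by (rule norm_blinfun_compose)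
  also have "\<dots> \<le> norm (U (int k) o\<^sub>L T)"
    by (rule mult_left_le[OF norm_U norm_ge_zero])
  also have "\<dots> \<le> norm (U (int k)) * norm T" by (rule norm_blinfun_compose)
  also have "\<dots> \<le> norm T" by (rule mult_left_le_one_le[OF norm_ge_zero norm_ge_zero norm_U])
  finally show "norm (U (int k) o\<^sub>L T o\<^sub>L U (- int k)) \<le> norm T" .
qed

text \<open>\<open>M\<close> is a commutant, and complex linearity and commutation relations survive
  pointwise limits.\<close>

lemma M_strong_limit:
  assumes X: "\<And>n. X n \<in> M" and Y: "\<And>\<xi>. (\<lambda>n. blinfun_apply (X n) \<xi>) \<longlonglongrightarrow> blinfun_apply Y \<xi>"
  shows "Y \<in> M"
proof -
  obtain G where G: "M = commutant G" by (auto simp: crossed_product_def vn_generated_def)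
  have "Y (c *\<^sub>C \<xi>) = c *\<^sub>C Y \<xi>" for c \<xi>
    using bounded_linear.tendsto[OF bounded_linear_scaleC Y[of \<xi>], of c] X
    by (intro LIMSEQ_unique[OF Y]) (simp add: copsD[OF M_cops[OF X]])
  moreover have "Y (g \<xi>) = g (Y \<xi>)" if g: "g \<in> G" for g \<xi>
    using blinfun.tendsto[OF tendsto_const Y[of \<xi>], of g] commutant_apply[OF X[unfolded G] g]
    by (intro LIMSEQ_unique[OF Y]) simp
  ultimately show ?thesis unfolding G by (simp add: commutant_def cops_def blinfun_eq_iff)
qed

lemma conj_avg_M: assumes T: "T \<in> M" shows "conj_avg n T \<in> M"
proof -
  have s: "(\<Sum>k<m. U (int k) o\<^sub>L T o\<^sub>L U (- int k)) \<in> M" for m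
  proof (induction m)
    case 0
    show ?case using M_diff[OF T T] by simp
  next
    case (Suc m)
    have "U (int m) o\<^sub>L T o\<^sub>L U (- int m) \<in> M" by (intro MI(3) U_M T)
    then show ?case using MI(4)[OF Suc] by (simp only: sum.lessThan_Suc)
  qed
  have "conj_avg n T = scaleC_op (complex_of_real (1 / real n)) (\<Sum>k<n. U (int k) o\<^sub>L T o\<^sub>L U (- int k))"
    by (simp add: conj_avg_def blinfun_eq_iff scaleC_op.rep_eq blinfun.scaleR_left scaleR_scaleC)
  then show ?thesis using s MI(5) by simp
qed

text \<open>\<open>U (- int k) \<Omega>\<close> is also the right translate of \<Omega> by
  \<open>u^(-k)\<close>. The translation passes through \<open>T\<close>, so conjugating
  \<open>T\<close> becomes applying an operator to the fixed vector
  \<open>T \<Omega>\<close>.\<close>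

lemma conj_avg_\<Omega>:
  assumes T: "T \<in> M" shows "(\<lambda>n. conj_avg n T \<Omega>) \<longlonglongrightarrow> Q (T \<Omega>)"
proof -
  have "T (U (- int k) \<Omega>) = right_op (- int k) id_blinfun (T \<Omega>)" for k
    using M_delta[OF T NI(2), of "- int k"] by simp
  then have "conj_avg n T \<Omega>
      = (1 / real n) *\<^sub>R (\<Sum>k<n. U (int k) (right_op (- int k) id_blinfun (T \<Omega>)))" for n
    by (simp only: conj_avg_apply)
  then show ?thesis using mean_ergodic[of "T \<Omega>"] by (simp only:)
qed

text \<open>The choice is meaningful on \<open>M\<close>, where \<open>E_limit\<close> shows that
  the strong limit exists.\<close>

definition E :: "('k ell2Z \<Rightarrow>\<^sub>L 'k ell2Z) \<Rightarrow> ('k ell2Z \<Rightarrow>\<^sub>L 'k ell2Z)" where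
  "E T = (SOME Y. \<forall>\<xi>. (\<lambda>n. conj_avg n T \<xi>) \<longlonglongrightarrow> blinfun_apply Y \<xi>)"

text \<open>The averages stay in \<open>M\<close>, so their values at
  \<open>delta m (\<Lambda> y)\<close> are the images under \<open>right_op m y\<close> of their
  values at \<Omega>, which converge; the bound \<open>norm T\<close> then covers all
  vectors.\<close>

lemma E_limit:
  assumes T: "T \<in> M" shows "(\<lambda>n. conj_avg n T \<xi>) \<longlonglongrightarrow> E T \<xi>"
proof -
  have "convergent (\<lambda>n. conj_avg n T \<xi>)" for \<xi>
  proof (rule ell2Z_induct[of "\<lambda>\<xi>. convergent (\<lambda>n. conj_avg n T \<xi>)"])
    show "closed {\<xi>. convergent (\<lambda>n. conj_avg n T \<xi>)}" by (rule closed_convergent_bounded[OF norm_conj_avg])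
    fix m y assume y: "y \<in> N"
    show "convergent (\<lambda>n. conj_avg n T (delta m (\<Lambda> y)))"
      unfolding M_delta[OF conj_avg_M[OF T] y]
      by (rule convergentI[OF blinfun.tendsto[OF tendsto_const conj_avg_\<Omega>[OF T]]])
  qed (simp add: blinfun.add_right convergent_add)
  from someI_ex[OF strong_limit_exists[OF norm_conj_avg this]]
  show ?thesis unfolding E_def by blast
qed

lemma E_M [simp, intro]: "T \<in> M \<Longrightarrow> E T \<in> M"
  by (rule M_strong_limit[OF conj_avg_M E_limit])

lemma E_\<Omega>: "T \<in> M \<Longrightarrow> E T \<Omega> = Q (T \<Omega>)"
  using LIMSEQ_unique[OF E_limit conj_avg_\<Omega>] .

text \<open>The hypothesis makes each coordinate of \<open>T \<Omega>\<close> a multiple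
  \<open>c j\<close> of \<open>\<Lambda> id_blinfun\<close>. Right multiplication carries this
  column to all others, which gives the scalar Laurent form.\<close>

lemma fixed_in_B:
  assumes T: "T \<in> M" and Q: "Q (T \<Omega>) = T \<Omega>"
  shows "T \<in> B"
proof (rule Laurent_in_vn_generated)
  show Tc: "T \<in> cops" using T by simp
  define c where "c j = cinner (\<Lambda> id_blinfun) (coord (T \<Omega>) j)" for j
  have c: "coord (T \<Omega>) j = c j *\<^sub>C \<Lambda> id_blinfun" for j
    using arg_cong[OF Q, of "\<lambda>\<xi>. coord \<xi> j"] unfolding coord_Q c_def by simp
  fix m v j
  show "coord (T (delta m v)) j = c (j - m) *\<^sub>C v"
  proof (rule L2_induct[of "\<lambda>v. coord (T (delta m v)) j = c (j - m) *\<^sub>C v"])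
    have "bounded_linear (\<lambda>v. coord (T (delta m v)) j)"
      by (intro bounded_linear_compose[OF bounded_linear_coord] bounded_linear_compose[OF blinfun.bounded_linear_right]
          bounded_linear_delta)
    then show "closed {v. coord (T (delta m v)) j = c (j - m) *\<^sub>C v}"
      by (intro closed_Collect_eq linear_continuous_on bounded_linear_scaleC)
    fix y assume y: "y \<in> N"
    have "coord (T (delta m (\<Lambda> y))) j = right_block m y (coord (T \<Omega>) (j - m))"
      by (simp only: M_delta[OF T y] right_op_def coord_amp)
    also have "\<dots> = c (j - m) *\<^sub>C \<Lambda> y"
      using y unfolding c by (simp add: copsD right_block)
    finally show "coord (T (delta m (\<Lambda> y))) j = c (j - m) *\<^sub>C \<Lambda> y" .
  qed
qed

lemma E_B: "T \<in> M \<Longrightarrow> E T \<in> B"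
  by (rule fixed_in_B[OF E_M]) (simp_all only: E_\<Omega> Q_Q)

lemma commuting_U:
  assumes T: "T o\<^sub>L crossed_unitary = crossed_unitary o\<^sub>L T"
  shows "T (U (int k) \<xi>) = U (int k) (T \<xi>)"
proof (induction k arbitrary: \<xi>)
  case 0
  show ?case by (simp add: amp_0_id)
next
  case (Suc k)
  have s: "U (int (Suc k)) \<eta> = U (int k) (crossed_unitary \<eta>)" for \<eta>
    by (intro coord_inject_ext) (simp add: crossed_unitary_eq_amp diff_diff_eq add.commute)
  show ?case
    using Suc[of "crossed_unitary \<xi>"] T unfolding s by (simp add: blinfun_eq_iff)
qed

lemma U_inverse: "U m (U (- m) \<xi>) = \<xi>"
  by (rule coord_inject_ext) simp

text \<open>Every conjugate of \<open>T\<close> by a power of \<open>u\<close> is \<open>T\<close>,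
  so the averages are constant from \<open>n = 1\<close> on.\<close>

lemma E_commuting:
  assumes T: "T \<in> M" "T o\<^sub>L crossed_unitary = crossed_unitary o\<^sub>L T"
  shows "E T = T"
proof (rule blinfun_eqI, rule LIMSEQ_unique[OF E_limit[OF T(1)]])
  fix \<xi>
  have "conj_avg n T \<xi> = T \<xi>" if "n \<ge> 1" for n
    using that average_const[of n "T \<xi>"] by (simp add: conj_avg_apply U_inverse flip: commuting_U[OF T(2)])
  then show "(\<lambda>n. conj_avg n T \<xi>) \<longlonglongrightarrow> T \<xi>"
    by (intro tendsto_eventually eventually_sequentiallyI) auto
qed

lemma B_abelian: "abelian B"
proof -
  let ?D = "{crossed_unitary :: 'k ell2Z \<Rightarrow>\<^sub>L 'k ell2Z} \<union> adj ` {crossed_unitary}"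
  have "?D \<subseteq> commutant ?D"
    by (auto simp: commutant_def crossed_unitary_cops cops_adj crossed_unitary_eq_amp adj_amp_id amp_compose cops_amp cops_id)
  \<comment> \<open>\<open>B\<close> commutes with the commutant of \<open>?D\<close>, and now also
    lies in it.\<close>
  then have "B \<subseteq> commutant ?D" unfolding vn_generated_def by (rule commutant_antimono)
  then show ?thesis unfolding abelian_def by (auto simp: vn_generated_def commutant_def)
qed

lemma B_crossed_unitary: "crossed_unitary \<in> B"
  using U_B[of 1] by (simp add: crossed_unitary_eq_amp)

lemma B_commutes: "a \<in> B \<Longrightarrow> a o\<^sub>L crossed_unitary = crossed_unitary o\<^sub>L a"
  using B_abelian B_crossed_unitary unfolding abelian_def by blast

lemma B_commutes_U: "a \<in> B \<Longrightarrow> a (U m \<xi>) = U m (a \<xi>)"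
  using B_abelian U_B[of m] unfolding abelian_def by (metis blinfun_apply_blinfun_compose)

text \<open>An abelian \<open>C\<close> containing \<open>B\<close> commutes with \<open>u\<close>,
  so \<open>E\<close> fixes its elements, while \<open>E\<close> takes values in
  \<open>B\<close>.\<close>

lemma masa_B: "masa B M"
proof -
  have "C = B" if C: "star_subalgebra C M" "abelian C" "B \<subseteq> C" for C
  proof
    show "C \<subseteq> B"
    proof
      fix c assume c: "c \<in> C"
      then have cM: "c \<in> M" using C(1) by (auto simp: star_subalgebra_def)
      have "c o\<^sub>L crossed_unitary = crossed_unitary o\<^sub>L c"
        using C c B_crossed_unitary unfolding abelian_def by blast
      then show "c \<in> B" using E_commuting[OF cM] E_B[OF cM] by simp
    qed
  qed (rule C(3))
  then show ?thesis
    using star_subalgebraI[OF B_vn B_subset_M] B_abelian by (auto simp: masa_def)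
qed

section \<open>\<open>E\<close> as the trace preserving conditional expectation onto
  \<open>B\<close>\<close>

lemma E_add: assumes "x \<in> M" "y \<in> M" shows "E (x + y) = E x + E y"
proof (rule blinfun_eqI, rule LIMSEQ_unique[OF E_limit])
  fix \<xi>
  show "(\<lambda>n. conj_avg n (x + y) \<xi>) \<longlonglongrightarrow> (E x + E y) \<xi>"
    using tendsto_add[OF E_limit[OF assms(1), of \<xi>] E_limit[OF assms(2), of \<xi>]]
    by (simp add: conj_avg_apply blinfun.add_left blinfun.add_right sum.distrib scaleR_right_distrib)
qed (use assms in auto)

text \<open>Elements of \<open>B\<close> commute with the powers of \<open>u\<close>, hence pull out
  of each conjugate and of the limit.\<close>

lemma E_bimodule:
  assumes a: "a \<in> B" and b: "b \<in> B" and x: "x \<in> M"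
  shows "E (a o\<^sub>L x o\<^sub>L b) = a o\<^sub>L E x o\<^sub>L b"
proof (rule blinfun_eqI, rule LIMSEQ_unique[OF E_limit])
  show "a o\<^sub>L x o\<^sub>L b \<in> M" using a b x B_subset_M by blast
  fix \<xi>
  show "(\<lambda>n. conj_avg n (a o\<^sub>L x o\<^sub>L b) \<xi>) \<longlonglongrightarrow> (a o\<^sub>L E x o\<^sub>L b) \<xi>"
    using blinfun.tendsto[OF tendsto_const E_limit[OF x, of "b \<xi>"], of a]
    by (simp add: conj_avg_apply blinfun.scaleR_right blinfun.sum_right B_commutes_U[OF a] B_commutes_U[OF b])
qed

lemma E_scaleC: assumes x: "x \<in> M" shows "E (scaleC_op c x) = scaleC_op c (E x)"
proof -
  have "scaleC_op c x = scaleC_op c id_blinfun o\<^sub>L x o\<^sub>L id_blinfun"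
    by (simp add: blinfun_eq_iff scaleC_op.rep_eq)
  moreover have "scaleC_op c id_blinfun o\<^sub>L E x o\<^sub>L id_blinfun = scaleC_op c (E x)"
    by (simp add: blinfun_eq_iff scaleC_op.rep_eq)
  ultimately show ?thesis
    using E_bimodule[OF _ _ x] von_neumann_algebraD(3,6)[OF B_vn] by metis
qed

text \<open>Conjugates of a positive operator by \<open>U (int k)\<close> are positive, and the
  quadratic form of \<open>E x\<close> is a limit in the closed set of nonnegative reals.\<close>

lemma E_positive: assumes x: "x \<in> M" and pos: "positive_op x" shows "positive_op (E x)"
proof -
  have "cinner \<xi> (E x \<xi>) \<in> \<real> \<inter> {z. 0 \<le> Re z}" for \<xi>
  proof (rule Lim_in_closed_set)
    show "closed (\<real> \<inter> {z. 0 \<le> Re z})" by (intro closed_Int closed_complex_Reals closed_halfspace_Re_ge)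
    show "(\<lambda>n. cinner \<xi> (conj_avg n x \<xi>)) \<longlonglongrightarrow> cinner \<xi> (E x \<xi>)"
      by (rule bounded_linear.tendsto[OF bounded_linear_cinner_right E_limit[OF x]])
    have k: "cinner \<xi> (U (int k) (x (U (- int k) \<xi>))) \<in> \<real> \<inter> {z. 0 \<le> Re z}" for k
    proof -
      have "cinner \<xi> (U (int k) (x (U (- int k) \<xi>))) = cinner (U (- int k) \<xi>) (x (U (- int k) \<xi>))"
        using adj_adjoint'[of "U (int k)" \<xi>] by (simp add: cops_amp cops_id adj_amp_id)
      then show ?thesis using pos by (simp add: positive_op_def)
    qed
    have "cinner \<xi> (conj_avg n x \<xi>) = complex_of_real (1 / real n) * (\<Sum>k<n. cinner \<xi> (U (int k) (x (U (- int k) \<xi>))))" for n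
      using bounded_linear.linear[OF bounded_linear_cinner_right[of \<xi>]]
      by (simp add: conj_avg_apply linear_cmul linear_sum scaleR_conv_of_real sum_divide_distrib)
    then have "cinner \<xi> (conj_avg n x \<xi>) \<in> \<real> \<inter> {z. 0 \<le> Re z}" for n
      using k by (auto intro!: Reals_mult sum_in_Reals divide_nonneg_nonneg sum_nonneg simp flip: of_real_divide)
    then show "\<forall>\<^sub>F n in sequentially. cinner \<xi> (conj_avg n x \<xi>) \<in> \<real> \<inter> {z. 0 \<le> Re z}" by simp
  qed simp
  then show ?thesis using x by (auto simp: positive_op_def)
qed

text \<open>The projection \<open>Q\<close> is self-adjoint and fixes \<Omega>.\<close>

lemma E_trace: assumes x: "x \<in> M" shows "\<tau> (E x) = \<tau> x"
  using adj_adjoint[OF Q_cops, of \<Omega> "x \<Omega>"]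
  unfolding crossed_trace_def E_\<Omega>[OF x] Q_adj Q_\<Omega> by simp

lemma E_fixed: "a \<in> B \<Longrightarrow> E a = a"
  using E_commuting B_commutes B_subset_M by blast

lemma E_cond_exp: "is_cond_exp \<tau> M B E"
  unfolding is_cond_exp_def by (simp add: E_B E_fixed E_add E_scaleC E_positive E_bimodule E_trace)

text \<open>The bimodule and trace conditions give
  \<open>\<tau> (adj d o\<^sub>L H x) = \<tau> (adj d o\<^sub>L x)\<close> for both expectations
  \<open>H\<close>, where \<open>d\<close> is their difference at \<open>x\<close>. Subtracting
  gives \<open>d \<Omega> = 0\<close>, and \<Omega> is separating.\<close>

lemma cond_exp_unique:
  assumes A: "star_subalgebra A M" "id_blinfun \<in> A"
    and F: "is_cond_exp \<tau> M A F" and G: "is_cond_exp \<tau> M A G" and x: "x \<in> M"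
  shows "F x = G x"
proof -
  define d where "d = F x - G x"
  have d: "d \<in> A" using F G x unfolding d_def is_cond_exp_def by (intro star_subalgebra_diff[OF A(1)]) auto
  have dA: "adj d \<in> A" and dM: "adj d \<in> M" "d \<in> M" and FG: "F x \<in> M" "G x \<in> M"
    using d A(1) F G x by (auto simp: star_subalgebra_def is_cond_exp_def)
  have tr: "\<tau> (adj d o\<^sub>L H x) = \<tau> (adj d o\<^sub>L x)" if H: "is_cond_exp \<tau> M A H" for H
  proof -
    have "H (adj d o\<^sub>L x o\<^sub>L id_blinfun) = adj d o\<^sub>L H x o\<^sub>L id_blinfun"
      using H dA A(2) x unfolding is_cond_exp_def by blast
    moreover have "\<tau> (H (adj d o\<^sub>L x)) = \<tau> (adj d o\<^sub>L x)"
      using H dM x unfolding is_cond_exp_def by blast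
    ultimately show ?thesis by simp
  qed
  have \<tau>d: "\<tau> (adj d o\<^sub>L z) = cinner (d \<Omega>) (z \<Omega>)" for z
    using adj_adjoint[OF M_cops[OF dM(2)]] by (simp add: crossed_trace_def)
  have "cinner (d \<Omega>) (d \<Omega>) = cinner (d \<Omega>) (F x \<Omega> - G x \<Omega>)"
    by (simp only: blinfun.diff_left[symmetric] d_def[symmetric])
  then have "cinner (d \<Omega>) (d \<Omega>) = \<tau> (adj d o\<^sub>L F x) - \<tau> (adj d o\<^sub>L G x)"
    by (simp only: \<tau>d cinner_simps)
  then have "cinner (d \<Omega>) (d \<Omega>) = 0" using tr[OF F] tr[OF G] by simp
  then have "d \<Omega> = 0" by (simp add: cinner_self)
  then have "d = 0" using \<Omega>_separating dM by blast
  then show ?thesis by (simp add: d_def)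
qed

text \<open>\<open>cond_exp\<close> is an extensional map, so \<open>F\<close> is restricted to
  \<open>M\<close> before uniqueness identifies the two.\<close>

lemma cond_exp_eq:
  assumes A: "star_subalgebra A M" "id_blinfun \<in> A" and F: "is_cond_exp \<tau> M A F" and x: "x \<in> M"
  shows "cond_exp \<tau> M A x = F x"
proof -
  have AM: "A \<subseteq> M" using A by (simp add: star_subalgebra_def)
  have F': "is_cond_exp \<tau> M A (restrict F M)"
    using F AM MI(3,4,5) unfolding is_cond_exp_def by (simp add: subset_iff)
  have "cond_exp \<tau> M A = restrict F M"
    unfolding cond_exp_def
  proof (rule the_equality)
    fix G assume G: "G \<in> extensional M \<and> is_cond_exp \<tau> M A G"
    show "G = restrict F M"
      by (rule extensionalityI[of _ M]) (use G cond_exp_unique[OF A _ F'] in auto)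
  qed (use F' in simp)
  then show ?thesis using x by simp
qed

lemma cond_exp_B: "x \<in> M \<Longrightarrow> cond_exp \<tau> M B x = E x"
  by (rule cond_exp_eq[OF star_subalgebraI[OF B_vn B_subset_M] von_neumann_algebraD(3)[OF B_vn] E_cond_exp])

section \<open>The expectation onto a unitary conjugate of \<open>B\<close>\<close>

context
  fixes w assumes w: "w \<in> M" and w_unitary: "unitary_op w"
begin

lemma w_cancel: "adj w o\<^sub>L w = id_blinfun" "w o\<^sub>L adj w = id_blinfun"
  "adj w o\<^sub>L (w o\<^sub>L x) = x" "w o\<^sub>L (adj w o\<^sub>L x) = x"
  using w_unitary by (simp_all add: unitary_op_def flip: blinfun_compose_assoc)

lemma conj_star_subalgebra: "star_subalgebra ((\<lambda>a. w o\<^sub>L a o\<^sub>L adj w) ` B) M"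
proof -
  note BI = von_neumann_algebraD(2-)[OF B_vn]
  have B0: "0 \<in> B" using star_subalgebraI[OF B_vn B_subset_M] by (simp add: star_subalgebra_def)
  have c: "w \<in> cops" "a \<in> B \<Longrightarrow> a \<in> cops" for a using w B_subset_M by auto
  show ?thesis
    unfolding star_subalgebra_def
  proof (intro conjI ballI allI)
    show "(\<lambda>a. w o\<^sub>L a o\<^sub>L adj w) ` B \<subseteq> M" using w B_subset_M by blast
    show "0 \<in> (\<lambda>a. w o\<^sub>L a o\<^sub>L adj w) ` B"
      by (rule image_eqI[OF _ B0]) simp
    fix x assume "x \<in> (\<lambda>a. w o\<^sub>L a o\<^sub>L adj w) ` B"
    then obtain a where a: "a \<in> B" "x = w o\<^sub>L a o\<^sub>L adj w" by blast
    show "scaleC_op c x \<in> (\<lambda>a. w o\<^sub>L a o\<^sub>L adj w) ` B" for c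
      by (rule image_eqI[OF _ BI(5)[OF a(1), of c]])
         (use c in \<open>simp add: a blinfun_eq_iff scaleC_op.rep_eq copsD\<close>)
    show "adj x \<in> (\<lambda>a. w o\<^sub>L a o\<^sub>L adj w) ` B"
      by (rule image_eqI[OF _ BI(1)[OF a(1)]])
         (use c a in \<open>simp add: adj_compose cops_compose cops_adj adj_adj blinfun_compose_assoc\<close>)
    fix y assume "y \<in> (\<lambda>a. w o\<^sub>L a o\<^sub>L adj w) ` B"
    then obtain b where b: "b \<in> B" "y = w o\<^sub>L b o\<^sub>L adj w" by blast
    show "x + y \<in> (\<lambda>a. w o\<^sub>L a o\<^sub>L adj w) ` B"
      by (rule image_eqI[OF _ BI(4)[OF a(1) b(1)]])
         (simp add: a b blinfun_eq_iff blinfun.add_left blinfun.add_right)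
    show "x o\<^sub>L y \<in> (\<lambda>a. w o\<^sub>L a o\<^sub>L adj w) ` B"
      by (rule image_eqI[OF _ BI(3)[OF a(1) b(1)]])
         (simp add: a b blinfun_compose_assoc w_cancel)
  qed
qed

lemma conj_id: "id_blinfun \<in> (\<lambda>a. w o\<^sub>L a o\<^sub>L adj w) ` B"
  by (rule image_eqI[OF _ von_neumann_algebraD(3)[OF B_vn]]) (simp add: w_cancel)

text \<open>Conjugation by \<open>w\<close> is a trace preserving automorphism of \<open>M\<close>
  taking \<open>B\<close> to its conjugate, so it transports \<open>E\<close>.\<close>

lemma conj_cond_exp:
  "is_cond_exp \<tau> M ((\<lambda>a. w o\<^sub>L a o\<^sub>L adj w) ` B) (\<lambda>x. w o\<^sub>L E (adj w o\<^sub>L x o\<^sub>L w) o\<^sub>L adj w)"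
proof -
  have wM: "adj w o\<^sub>L x o\<^sub>L w \<in> M" if "x \<in> M" for x using w that by blast
  have wc: "w \<in> cops" using w by simp
  show ?thesis
    unfolding is_cond_exp_def
  proof (intro conjI ballI allI impI)
    fix x assume x: "x \<in> M"
    show "w o\<^sub>L E (adj w o\<^sub>L x o\<^sub>L w) o\<^sub>L adj w \<in> (\<lambda>a. w o\<^sub>L a o\<^sub>L adj w) ` B"
      using E_B[OF wM[OF x]] by blast
    show "\<tau> (w o\<^sub>L E (adj w o\<^sub>L x o\<^sub>L w) o\<^sub>L adj w) = \<tau> x"
    proof -
      have "\<tau> (w o\<^sub>L E (adj w o\<^sub>L x o\<^sub>L w) o\<^sub>L adj w) = \<tau> (E (adj w o\<^sub>L x o\<^sub>L w))"
        by (rule \<tau>_unitary_conj[OF w w_unitary E_M[OF wM[OF x]]])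
      also have "\<dots> = \<tau> (adj w o\<^sub>L x o\<^sub>L w)" by (rule E_trace[OF wM[OF x]])
      also have "\<dots> = \<tau> (w o\<^sub>L (adj w o\<^sub>L x o\<^sub>L w) o\<^sub>L adj w)"
        by (rule \<tau>_unitary_conj[OF w w_unitary wM[OF x], symmetric])
      finally show ?thesis by (simp add: blinfun_compose_assoc w_cancel)
    qed
    show "positive_op (w o\<^sub>L E (adj w o\<^sub>L x o\<^sub>L w) o\<^sub>L adj w)" if "positive_op x"
      using positive_op_conj[OF cops_adj[OF wc] E_positive[OF wM[OF x] positive_op_conj[OF wc that]]] wc
      by (simp add: adj_adj)
    show "w o\<^sub>L E (adj w o\<^sub>L scaleC_op c x o\<^sub>L w) o\<^sub>L adj w
        = scaleC_op c (w o\<^sub>L E (adj w o\<^sub>L x o\<^sub>L w) o\<^sub>L adj w)" for c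
    proof -
      have "adj w o\<^sub>L scaleC_op c x o\<^sub>L w = scaleC_op c (adj w o\<^sub>L x o\<^sub>L w)"
        using cops_adj[OF wc] by (simp add: blinfun_eq_iff scaleC_op.rep_eq copsD)
      then have "E (adj w o\<^sub>L scaleC_op c x o\<^sub>L w) = scaleC_op c (E (adj w o\<^sub>L x o\<^sub>L w))"
        by (simp only: E_scaleC wM x)
      then show ?thesis using wc by (simp add: blinfun_eq_iff scaleC_op.rep_eq copsD)
    qed
    show "w o\<^sub>L E (adj w o\<^sub>L (x + y) o\<^sub>L w) o\<^sub>L adj w
        = (w o\<^sub>L E (adj w o\<^sub>L x o\<^sub>L w) o\<^sub>L adj w) + (w o\<^sub>L E (adj w o\<^sub>L y o\<^sub>L w) o\<^sub>L adj w)"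
      if y: "y \<in> M" for y
    proof -
      have "adj w o\<^sub>L (x + y) o\<^sub>L w = (adj w o\<^sub>L x o\<^sub>L w) + (adj w o\<^sub>L y o\<^sub>L w)"
        by (simp add: blinfun_eq_iff blinfun.add_left blinfun.add_right)
      then have "E (adj w o\<^sub>L (x + y) o\<^sub>L w) = E (adj w o\<^sub>L x o\<^sub>L w) + E (adj w o\<^sub>L y o\<^sub>L w)"
        by (simp only: E_add wM x y)
      then show ?thesis by (simp add: blinfun_eq_iff blinfun.add_left blinfun.add_right)
    qed
  next
    fix a' assume "a' \<in> (\<lambda>a. w o\<^sub>L a o\<^sub>L adj w) ` B"
    then obtain a where a: "a \<in> B" "a' = w o\<^sub>L a o\<^sub>L adj w" by blast
    show "w o\<^sub>L E (adj w o\<^sub>L a' o\<^sub>L w) o\<^sub>L adj w = a'"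
      by (simp add: a blinfun_compose_assoc w_cancel E_fixed)
    fix b' x assume "b' \<in> (\<lambda>a. w o\<^sub>L a o\<^sub>L adj w) ` B" and x: "x \<in> M"
    then obtain b where b: "b \<in> B" "b' = w o\<^sub>L b o\<^sub>L adj w" by blast
    have "adj w o\<^sub>L (a' o\<^sub>L x o\<^sub>L b') o\<^sub>L w = a o\<^sub>L (adj w o\<^sub>L x o\<^sub>L w) o\<^sub>L b"
      by (simp add: a b blinfun_compose_assoc w_cancel)
    then show "w o\<^sub>L E (adj w o\<^sub>L (a' o\<^sub>L x o\<^sub>L b') o\<^sub>L w) o\<^sub>L adj w
        = a' o\<^sub>L (w o\<^sub>L E (adj w o\<^sub>L x o\<^sub>L w) o\<^sub>L adj w) o\<^sub>L b'"
      by (simp only: E_bimodule[OF a(1) b(1) wM[OF x]]) (simp add: a b blinfun_compose_assoc w_cancel)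
  qed
qed

end

section \<open>Strong singularity\<close>

text \<open>At \<open>delta m (\<Lambda> z)\<close> the norm is exactly a mixing coefficient of
  \<open>z\<close> and \<open>\<alpha> n y\<close>, because \<open>tr y = 0\<close> removes the
  product of traces; boundedness and density extend this to \<xi>.\<close>

lemma cesaro_null_right_op:
  assumes y: "y \<in> N" "tr y = 0"
  shows "cesaro_null (\<lambda>k. norm (Q (right_op (n + int k) y \<xi>)))"
proof -
  have "cesaro_null (\<lambda>k. norm ((Q o\<^sub>L right_op (n + int k) y) \<xi>))"
  proof (rule cesaro_null_dense_induct[OF \<Lambda>D(4)])
    show "norm (Q o\<^sub>L right_op (n + int k) y) \<le> norm Q * norm (adj y)" for k
      by (rule order_trans[OF norm_blinfun_compose mult_left_mono[OF right_op(2)[OF y(1)] norm_ge_zero]])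
    fix m v assume "v \<in> \<Lambda> ` N"
    then obtain z where z: "z \<in> N" "v = \<Lambda> z" by blast
    have eq: "norm ((Q o\<^sub>L right_op (n + int k) y) (delta m v))
        = cmod (tr (z o\<^sub>L \<alpha> (int k) (\<alpha> n y)) - tr z * tr (\<alpha> n y))" for k
    proof -
      define z' where "z' = \<alpha> (- (n + int k)) z o\<^sub>L y"
      have z': "z' \<in> N" unfolding z'_def by (intro NI(3) \<alpha>_mem z y)
      have "norm ((Q o\<^sub>L right_op (n + int k) y) (delta m v)) = norm (Q (delta (m + (n + int k)) (\<Lambda> z')))"
        unfolding z(2) blinfun_apply_blinfun_compose right_op(3)[OF y(1) z(1)] z'_def ..
      also have "\<dots> = cmod (tr z')"
        unfolding Q_delta[OF z'] norm_delta norm_scaleC norm_\<Lambda>_id by simp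
      \<comment> \<open>Applying \<open>\<alpha> (n + int k)\<close> under the trace moves the twist
        from \<open>z\<close> to \<open>y\<close>.\<close>
      also have "tr z' = tr (\<alpha> (n + int k) z')" by (rule \<alpha>D(6)[OF z', symmetric])
      also have "\<alpha> (n + int k) z' = z o\<^sub>L \<alpha> (int k) (\<alpha> n y)"
        unfolding z'_def using z(1) y(1) by (simp add: \<alpha>D(3) \<alpha>_\<alpha> add.commute)
      finally show ?thesis using y by (simp add: \<alpha>D(6))
    qed
    show "cesaro_null (\<lambda>k. norm ((Q o\<^sub>L right_op (n + int k) y) (delta m v)))"
      unfolding eq by (rule mixingD[OF z(1) \<alpha>_mem[OF y(1)]])
  qed
  then show ?thesis by simp
qed

text \<open>On elementary vectors \<open>id_blinfun - Q\<close> subtracts the trace from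
  \<open>y\<close>, and \<open>U (int k)\<close> raises the index by \<open>k\<close>. Since
  \<open>T\<close> lies in \<open>M\<close>, the result is \<open>right_op (n + int k) y'\<close> at
  the fixed vector \<open>T \<Omega>\<close>, a case of \<open>cesaro_null_right_op\<close>.\<close>

lemma cesaro_null_compression:
  assumes T: "T \<in> M"
  shows "cesaro_null (\<lambda>k. norm (Q (T (U (int k) (\<xi> - Q \<xi>)))))"
proof -
  let ?X = "\<lambda>k. (Q o\<^sub>L T) o\<^sub>L U (int k) o\<^sub>L (id_blinfun - Q)"
  have "cesaro_null (\<lambda>k. norm (?X k \<xi>))"
  proof (rule cesaro_null_dense_induct[OF \<Lambda>D(4)])
    show "norm (?X k) \<le> norm (Q o\<^sub>L T) * norm (id_blinfun - Q)" for k
      by (rule norm_contraction_sandwich[OF norm_U])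
    fix n v assume "v \<in> \<Lambda> ` N"
    then obtain y where y: "y \<in> N" "v = \<Lambda> y" by blast
    define y' where "y' = y + scaleC_op (- tr y) id_blinfun"
    have y': "y' \<in> N" unfolding y'_def by (intro NI y)
    have try': "tr y' = 0"
      using y(1) trD(1)[OF y(1) NI(5)[OF NI(2)], of "- tr y"] trD(2)[OF NI(2), of "- tr y"]
      by (simp add: y'_def tr1)
    have \<Lambda>y': "\<Lambda> y' = \<Lambda> y - tr y *\<^sub>C \<Lambda> id_blinfun"
    proof -
      have "(- tr y) *\<^sub>C \<Lambda> id_blinfun = - (tr y *\<^sub>C \<Lambda> id_blinfun)"
        by (metis scaleC_minus1 scaleC_scaleC mult_minus1)
      then show ?thesis using \<Lambda>D(1)[OF y(1) NI(5)[OF NI(2)], of "- tr y"] \<Lambda>D(2)[OF NI(2), of "- tr y"]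
        by (simp add: y'_def)
    qed
    have "delta n (\<Lambda> y) - Q (delta n (\<Lambda> y)) = delta n (\<Lambda> y')"
      unfolding Q_delta[OF y(1)] \<Lambda>y' by (rule coord_inject_ext) simp
    then have "?X k (delta n v) = Q (right_op (n + int k) y' (T \<Omega>))" for k
      using M_delta[OF T y', of "n + int k"] by (simp add: y(2) blinfun.diff_left del: coord_amp)
    then show "cesaro_null (\<lambda>k. norm (?X k (delta n v)))"
      using cesaro_null_right_op[OF y' try', of n "T \<Omega>"] by (simp only:)
  qed
  then show ?thesis by (simp add: blinfun.diff_left)
qed

text \<open>With \<open>x = adj w o\<^sub>L U (int k) o\<^sub>L w\<close>, the difference of the
  expectations is the conjugate of \<open>x - E x\<close> by \<open>w\<close>, as
  \<open>U (int k)\<close> lies in \<open>B\<close>. Its norm at \<Omega> follows from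
  \<open>Q_Pythagoras\<close> at the unit vector \<open>x \<Omega>\<close>.\<close>

lemma norm2_conj_cond_exp:
  assumes w: "w \<in> M" "unitary_op w"
  shows "norm2 \<tau> (cond_exp \<tau> M B (U (int k)) - cond_exp \<tau> M ((\<lambda>a. w o\<^sub>L a o\<^sub>L adj w) ` B) (U (int k)))
    = sqrt (1 - (norm (Q (adj w (U (int k) (w \<Omega>)))))\<^sup>2)"
proof -
  define x where "x = adj w o\<^sub>L U (int k) o\<^sub>L w"
  have xM: "x \<in> M" unfolding x_def by (intro MI U_M w)
  define y where "y = x - E x"
  have yM: "y \<in> M" unfolding y_def by (intro M_diff E_M xM)
  have wM: "adj w \<in> M" by (intro MI w)
  note cancel = w_cancel[OF w]
  have wy: "w o\<^sub>L y o\<^sub>L adj w = U (int k) - (w o\<^sub>L E x o\<^sub>L adj w)"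
  proof -
    have "w o\<^sub>L y o\<^sub>L adj w = (w o\<^sub>L x o\<^sub>L adj w) - (w o\<^sub>L E x o\<^sub>L adj w)"
      by (simp add: y_def blinfun_eq_iff blinfun.diff_left blinfun.diff_right)
    also have "w o\<^sub>L x o\<^sub>L adj w = U (int k)"
      unfolding x_def by (simp add: blinfun_compose_assoc cancel)
    finally show ?thesis .
  qed
  have "E (U (int k)) = U (int k)"
    using E_commuting[OF U_M B_commutes[OF U_B]] .
  then have "cond_exp \<tau> M B (U (int k)) - cond_exp \<tau> M ((\<lambda>a. w o\<^sub>L a o\<^sub>L adj w) ` B) (U (int k))
      = w o\<^sub>L y o\<^sub>L adj w"
    unfolding cond_exp_B[OF U_M]
      cond_exp_eq[OF conj_star_subalgebra[OF w] conj_id[OF w] conj_cond_exp[OF w] U_M]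
    by (simp only: wy x_def)
  \<comment> \<open>The left factor \<open>w\<close> is isometric; \<open>norm_adj_\<Omega>\<close>
    brings the right factor to the left.\<close>
  moreover have "norm ((w o\<^sub>L y o\<^sub>L adj w) \<Omega>) = norm (y \<Omega>)"
  proof -
    have "norm ((w o\<^sub>L y o\<^sub>L adj w) \<Omega>) = norm ((y o\<^sub>L adj w) \<Omega>)"
      using unitary_norm[OF w(2)] by simp
    also have "\<dots> = norm (adj (y o\<^sub>L adj w) \<Omega>)" by (rule norm_adj_\<Omega>[symmetric]) (intro MI yM wM)
    also have "\<dots> = norm (adj y \<Omega>)"
      using unitary_norm[OF w(2)] M_cops[OF yM] M_cops[OF w(1)] by (simp add: adj_compose adj_adj cops_adj)
    also have "\<dots> = norm (y \<Omega>)" by (rule norm_adj_\<Omega>[OF yM])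
    finally show ?thesis .
  qed
  moreover have "norm (y \<Omega>) = sqrt (1 - (norm (Q (x \<Omega>)))\<^sup>2)"
  proof -
    have "unitary_op (adj w)" using w M_cops[OF w(1)] by (simp add: unitary_op_def cops_adj adj_adj)
    moreover have "unitary_op (U m)" for m
      by (simp add: unitary_op_def cops_amp cops_id adj_amp_id amp_compose amp_0_id)
    ultimately have "norm (x \<Omega>) = 1"
      using unitary_norm[OF w(2)] unitary_norm[of "U (int k)"] unitary_norm[of "adj w"] norm_\<Omega>
      by (simp add: x_def)
    moreover have "y \<Omega> = x \<Omega> - Q (x \<Omega>)" unfolding y_def blinfun.diff_left E_\<Omega>[OF xM] ..
    ultimately have "(norm (y \<Omega>))\<^sup>2 = 1 - (norm (Q (x \<Omega>)))\<^sup>2" using Q_Pythagoras[of "x \<Omega>"] by simp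
    then show ?thesis by (metis norm_ge_zero real_sqrt_unique)
  qed
  moreover have "x \<Omega> = adj w (U (int k) (w \<Omega>))" by (simp add: x_def)
  moreover have "w o\<^sub>L y o\<^sub>L adj w \<in> M" by (intro MI yM wM w)
  ultimately show ?thesis using norm2_\<tau> by presburger
qed

text \<open>The contradiction hypothesis supplies a gap: a supremum \<open>r\<close> below
  \<open>sqrt (1 - d\<^sup>2)\<close> forces every \<open>g k\<close> to be at least some
  \<open>d' > d\<close>. Then \<open>h k\<close> is at least \<open>d' - d\<close> for all
  \<open>k\<close>, contrary to its null Cesaro means.\<close>

lemma norm_inf_2_ge:
  assumes w: "w \<in> M" "unitary_op w"
  shows "ereal (norm2 \<tau> (w - cond_exp \<tau> M B w))
    \<le> norm_inf_2 \<tau> M (\<lambda>x. cond_exp \<tau> M B x - cond_exp \<tau> M ((\<lambda>a. w o\<^sub>L a o\<^sub>L adj w) ` B) x)" (is "_ \<le> ?s")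
proof (rule ccontr)
  define d where "d = norm (Q (w \<Omega>))"
  define g where "g k = norm (Q (adj w (U (int k) (w \<Omega>))))" for k
  define h where "h k = norm (Q (adj w (U (int k) (w \<Omega> - Q (w \<Omega>)))))" for k
  have wM: "adj w \<in> M" by (intro MI w)
  have adj_w: "unitary_op (adj w)"
    using w M_cops[OF w(1)] by (simp add: unitary_op_def cops_adj adj_adj)
  have gh: "g k \<le> d + h k" for k
  proof -
    have "Q (adj w (U (int k) (w \<Omega>)))
        = Q (adj w (U (int k) (Q (w \<Omega>)))) + Q (adj w (U (int k) (w \<Omega> - Q (w \<Omega>))))"
      by (simp only: blinfun.diff_right) simp
    then have "g k \<le> norm (Q (adj w (U (int k) (Q (w \<Omega>))))) + h k"
      unfolding g_def h_def by (metis norm_triangle_ineq)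
    also have "norm (Q (adj w (U (int k) (Q (w \<Omega>))))) \<le> norm (adj w (U (int k) (Q (w \<Omega>))))"
      by (rule norm_Q_le)
    also have "\<dots> = norm (U (int k) (Q (w \<Omega>)))" by (rule unitary_norm[OF adj_w])
    also have "\<dots> \<le> norm (U (int k)) * norm (Q (w \<Omega>))" by (rule norm_blinfun)
    also have "\<dots> \<le> 1 * d" unfolding d_def by (rule mult_right_mono[OF norm_U norm_ge_zero])
    finally show ?thesis by simp
  qed
  have g_le: "ereal (sqrt (1 - (g k)\<^sup>2)) \<le> ?s" for k
    unfolding g_def norm2_conj_cond_exp[OF w, symmetric] norm_inf_2_def
    by (rule SUP_upper) (simp add: norm_U)
  have c: "norm2 \<tau> (w - cond_exp \<tau> M B w) = sqrt (1 - d\<^sup>2)"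
  proof -
    have "(norm ((w - E w) \<Omega>))\<^sup>2 = 1 - d\<^sup>2"
      using Q_Pythagoras[of "w \<Omega>"] unitary_norm[OF w(2)] norm_\<Omega>
      unfolding blinfun.diff_left E_\<Omega>[OF w(1)] d_def by simp
    then have "norm ((w - E w) \<Omega>) = sqrt (1 - d\<^sup>2)" by (metis norm_ge_zero real_sqrt_unique)
    then show ?thesis unfolding cond_exp_B[OF w(1)] using norm2_\<tau>[of "w - E w"] w(1) by simp
  qed
  assume "\<not> ?thesis"
  then have lt: "?s < ereal (sqrt (1 - d\<^sup>2))" by (simp add: c)
  \<comment> \<open>The supremum is a real number, bounded above by the assumption and below by its
    terms.\<close>
  obtain r where r: "?s = ereal r"
    using lt g_le[of 0] by (cases ?s) auto
  have rd: "r < sqrt (1 - d\<^sup>2)" using lt by (simp add: r)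
  have rg: "sqrt (1 - (g k)\<^sup>2) \<le> r" for k using g_le[of k] by (simp add: r)
  have d1: "d \<le> 1" "0 \<le> d"
    using norm_Q_le[of "w \<Omega>"] unitary_norm[OF w(2), of \<Omega>] norm_\<Omega> by (simp_all add: d_def)
  have g1: "g k \<le> 1" "0 \<le> g k" for k
    using norm_Q_le[of "adj w (U (int k) (w \<Omega>))"] unitary_norm[OF adj_w, of "U (int k) (w \<Omega>)"]
      order_trans[OF norm_blinfun mult_right_mono[OF norm_U norm_ge_zero], of "int k" "w \<Omega>"]
      unitary_norm[OF w(2), of \<Omega>] norm_\<Omega> by (simp_all add: g_def del: coord_amp)
  have r0: "0 \<le> r" using rg[of 0] g1[of 0] by (smt (verit) power_le_one real_sqrt_ge_zero)
  \<comment> \<open>The value at which \<open>sqrt (1 - d'\<^sup>2)\<close> equals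
    \<open>r\<close>.\<close>
  define d' where "d' = sqrt (1 - r\<^sup>2)"
  have "r\<^sup>2 < (sqrt (1 - d\<^sup>2))\<^sup>2" using rd r0 by (intro power_strict_mono) auto
  also have "\<dots> = 1 - d\<^sup>2" using d1 by (simp add: power_le_one)
  finally have "d\<^sup>2 < 1 - r\<^sup>2" by simp
  then have dd': "d < d'" unfolding d'_def by (rule real_less_rsqrt)
  have "d' \<le> g k" for k
  proof -
    have "1 - (g k)\<^sup>2 = (sqrt (1 - (g k)\<^sup>2))\<^sup>2" using g1 by (simp add: power_le_one)
    also have "\<dots> \<le> r\<^sup>2" using rg g1 by (intro power_mono) (auto simp: power_le_one)
    finally show ?thesis unfolding d'_def using g1 by (intro real_le_lsqrt) auto
  qed
  then have "d' - d \<le> h k" for k using gh[of k] by (smt (verit))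
  moreover have "cesaro_null h" unfolding h_def by (rule cesaro_null_compression[OF wM])
  ultimately show False
    using cesaro_null_frequently_small[of h "d' - d"] dd' by (meson diff_gt_0_iff_gt not_le)
qed

lemma strongly_singular_B: "strongly_singular \<tau> M B"
  unfolding strongly_singular_def using B_vn B_subset_M norm_inf_2_ge by blast

end

theorem lemma3p2:
  fixes N :: "('h::chilbert_space \<Rightarrow>\<^sub>L 'h) set"
    and tr :: "('h \<Rightarrow>\<^sub>L 'h) \<Rightarrow> complex"
    and \<theta> :: "('h \<Rightarrow>\<^sub>L 'h) \<Rightarrow> ('h \<Rightarrow>\<^sub>L 'h)"
    and \<Lambda> :: "('h \<Rightarrow>\<^sub>L 'h) \<Rightarrow> 'k::chilbert_space"
  assumes "von_neumann_algebra N"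
    and "faithful_normal_trace N tr" and "tr id_blinfun = 1"
    and "star_automorphism N \<theta>" and "trace_preserving N tr \<theta>" and "weakly_mixing N tr \<theta>"
    and "is_L2_space N tr \<Lambda>"
  shows "masa (vn_generated {crossed_unitary}) (crossed_product N \<theta> \<Lambda>) \<and>
    strongly_singular (crossed_trace \<Lambda>) (crossed_product N \<theta> \<Lambda>) (vn_generated {crossed_unitary})"
proof -
  interpret weakly_mixing_system N tr \<theta> \<Lambda> by unfold_locales (rule assms)+
  show ?thesis using masa_B strongly_singular_B by blast
qed

end
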